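(* The space $\mathcal{G}(\mathbb{R}\times\mathbb{Z})$ of closed subgroups of $\mathbb{R}\times\mathbb{Z}$, endowed with the Chabauty topology, is homeomorphic to the adjunction space $C_\infty\cup_{g_\infty}A$ obtained by gluing $C_\infty$ and $A$ along $g_\infty:\partial C_\infty\to A$.
   Context: Conventions: $\mathbb{N}$ contains $0$. For a locally compact topological group $G$, $\mathcal{G}(G)$ is the set of closed subgroups of $G$ with the Chabauty topology: the open sets are the arbitrary unions of finite intersections of sets of the form $O_K=\{H: H\cap K=\emptyset\}$ ($K\subset G$ compact) and $O'_U=\{H: H\cap U\neq\emptyset\}$ ($U\subset G$ open). $\mathbb{R}\times\mathbb{Z}$ carries the product topology. Every rational is written $\frac{a}{b}$ with $a\in\mathbb{Z}$, $b\in\mathbb{N}\setminus\{0\}$ coprime; $\overline{\beta}$ denotes the class of $\beta\in\mathbb{R}$ in $\mathbb{R}/\mathbb{Z}$. Gluing: for disjoint spaces $X,Y$, a closed subset $B\subset X$ and a continuous map $f:B\to Y$, $X\cup_f Y$ is the quotient of $X\sqcup Y$ by the equivalence relation generated by $b\sim f(b)$, $b\in B$. Hawaiian earring: $A=\bigcup_{n\in\mathbb{N}\setminus\{0\}}A_n\subset\mathbb{C}$, where $A_n$ is the circle with centre $\frac1n$ and radius $\frac1n$; points of $A_n$ are written $\frac1n(1+e^{2i\theta})$ with $\theta\in[-\frac\pi2,\frac\pi2]$. Closed cone: $\overline{C}$ is the quotient of $[0,\infty]\times\mathbb{R}/\mathbb{Z}$ obtained by collapsing $\{\infty\}\times\mathbb{R}/\mathbb{Z}$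 to a point; $\partial\overline{C}$ is the image of $\{0\}\times\mathbb{R}/\mathbb{Z}$ in $\overline{C}$. Blown-up circle: $R=\{(\overline{\beta},\theta)\in\mathbb{R}/\mathbb{Z}\times[-\frac\pi2,\frac\pi2] : \text{if }\overline\beta\notin\mathbb{Q}/\mathbb{Z}\text{ then }\theta=\frac\pi2\}$, with the topology coming from the lexicographic order: it is the quotient, under $(\beta,\theta)\mapsto(\beta+1,\theta)$, of the set $\{(\beta,\theta)\in\mathbb{R}\times[-\frac\pi2,\frac\pi2] : \beta\notin\mathbb{Q}\Rightarrow\theta=\frac\pi2\}$ equipped with the order topology of the lexicographic order ($(\beta,\theta)\le(\beta',\theta')$ iff $\beta<\beta'$, or $\beta=\beta'$ and $\theta\le\theta'$). The space $R$ is homeomorphic to a circle; fix a homeomorphism $\xi=(\xi_1,\xi_2):\mathbb{R}/\mathbb{Z}\to R$. Define the continuous map $g:\partial\overline{C}\to A$ by $g(0,\overline\beta)=\frac1b(1+e^{2i\xi_2(\overline\beta)})$ if $\xi_1(\overline\beta)=\overline{\frac ab}\in\mathbb{Q}/\mathbb{Z}$, and $g(0,\overline\beta)=0$ otherwise. $C_\infty$ is the quotient of $\mathcal{G}(\mathbb{Z})\times\overline{C}$ by the relation $(\{0\},\alpha,\overline\beta)\sim(\{0\},\alpha,\overline{\beta'})$ for all $\alpha\in[0,\infty]$ and $\overline\beta,\overline{\beta'}\in\mathbb{R}/\mathbb{Z}$. Its subset $\partial C_\infty$ is the image of $\mathcal{G}(\mathbb{Z})\times\partial\overline{C}$. The map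 $g_\infty:\partial C_\infty\to A$ is $g_\infty(n\mathbb{Z},c)=\frac{1}{nb}(1+e^{2i\theta})$ if $n\neq0$ and $g(c)=\frac1b(1+e^{2i\theta})$ (so it is $0$ when $g(c)=0$), and $g_\infty(n\mathbb{Z},c)=0$ if $n=0$. *)

theory Defs
  imports "HOL-Analysis.Analysis"
begin

section \<open>General topological constructions\<close>

text \<open>The final (quotient) topology on \<open>f ` topspace X\<close>.\<close>

definition final_topology :: "'a topology \<Rightarrow> ('a \<Rightarrow> 'b) \<Rightarrow> 'b topology" where
  "final_topology X f =
     topology (\<lambda>U. U \<subseteq> f ` topspace X \<and> openin X {x \<in> topspace X. f x \<in> U})"

lemma openin_final_topology:
  "openin (final_topology X f) U \<longleftrightarrow>
     U \<subseteq> f ` topspace X \<and> openin X {x \<in> topspace X. f x \<in> U}"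
proof -
  have "istopology (\<lambda>U. U \<subseteq> f ` topspace X \<and> openin X {x \<in> topspace X. f x \<in> U})"
    unfolding istopology_def
  proof (intro conjI allI impI)
    fix S T
    assume S: "S \<subseteq> f ` topspace X \<and> openin X {x \<in> topspace X. f x \<in> S}"
      and T: "T \<subseteq> f ` topspace X \<and> openin X {x \<in> topspace X. f x \<in> T}"
    have "{x \<in> topspace X. f x \<in> S \<inter> T}
        = {x \<in> topspace X. f x \<in> S} \<inter> {x \<in> topspace X. f x \<in> T}" by auto
    then show "openin X {x \<in> topspace X. f x \<in> S \<inter> T}" using S T by (simp add: openin_Int)
    show "S \<inter> T \<subseteq> f ` topspace X" using S by auto
  next
    fix K
    assume K: "\<forall>S\<in>K. S \<subseteq> f ` topspace X \<and> openin X {x \<in> topspace X. f x \<in> S}"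
    have "{x \<in> topspace X. f x \<in> \<Union>K} = (\<Union>S\<in>K. {x \<in> topspace X. f x \<in> S})" by auto
    then show "openin X {x \<in> topspace X. f x \<in> \<Union>K}" using K by auto
    show "\<Union>K \<subseteq> f ` topspace X" using K by auto
  qed
  then show ?thesis by (simp add: final_topology_def)
qed

lemma topspace_final_topology [simp]: "topspace (final_topology X f) = f ` topspace X"
proof -
  have "{x \<in> topspace X. f x \<in> f ` topspace X} = topspace X" by auto
  then have "openin (final_topology X f) (f ` topspace X)"
    by (simp add: openin_final_topology)
  then show ?thesis
    by (metis openin_final_topology openin_subset openin_topspace subset_antisym)
qed

lemma quotient_map_final_topology: "quotient_map X (final_topology X f) f"
  by (simp add: quotient_map_def openin_final_topology)

text \<open>Class of a point, and quotient of a space, under the equivalence relation generated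
  by an arbitrary relation \<open>r\<close>.\<close>

definition generated_class :: "('a \<times> 'a) set \<Rightarrow> 'a \<Rightarrow> 'a set" where
  "generated_class r x = (r \<union> r\<inverse>)\<^sup>* `` {x}"

definition quotient_topology :: "'a topology \<Rightarrow> ('a \<times> 'a) set \<Rightarrow> 'a set topology" where
  "quotient_topology X r = final_topology X (generated_class r)"

definition disjoint_union_topology :: "'a topology \<Rightarrow> 'b topology \<Rightarrow> ('a + 'b) topology" where
  "disjoint_union_topology X Y = topology (\<lambda>U. openin X (Inl -` U) \<and> openin Y (Inr -` U))"

lemma openin_disjoint_union_topology:
  "openin (disjoint_union_topology X Y) U \<longleftrightarrow> openin X (Inl -` U) \<and> openin Y (Inr -` U)"
proof -
  have "istopology (\<lambda>U. openin X (Inl -` U) \<and> openin Y (Inr -` U))"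
    unfolding istopology_def by (auto simp: vimage_Union)
  then show ?thesis by (simp add: disjoint_union_topology_def)
qed

lemma topspace_disjoint_union_topology [simp]:
  "topspace (disjoint_union_topology X Y) = topspace X <+> topspace Y"
proof
  have "openin X (Inl -` topspace (disjoint_union_topology X Y))"
    "openin Y (Inr -` topspace (disjoint_union_topology X Y))"
    using openin_topspace[of "disjoint_union_topology X Y"]
    unfolding openin_disjoint_union_topology by auto
  then have "Inl -` topspace (disjoint_union_topology X Y) \<subseteq> topspace X"
    "Inr -` topspace (disjoint_union_topology X Y) \<subseteq> topspace Y"
    by (auto dest: openin_subset)
  then show "topspace (disjoint_union_topology X Y) \<subseteq> topspace X <+> topspace Y"
    by (intro subsetI, rename_tac z, case_tac z) auto
  have "Inl -` (topspace X <+> topspace Y) = topspace X"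
    "Inr -` (topspace X <+> topspace Y) = topspace Y" by auto
  then show "topspace X <+> topspace Y \<subseteq> topspace (disjoint_union_topology X Y)"
    by (intro openin_subset) (simp add: openin_disjoint_union_topology)
qed

text \<open>The adjunction space of \<open>X\<close> and \<open>Y\<close> along \<open>f\<close> defined on \<open>B \<subseteq> topspace X\<close>.\<close>

definition adjunction_space ::
    "'a topology \<Rightarrow> 'b topology \<Rightarrow> 'a set \<Rightarrow> ('a \<Rightarrow> 'b) \<Rightarrow> ('a + 'b) set topology" where
  "adjunction_space X Y B f =
     quotient_topology (disjoint_union_topology X Y) {(Inl b, Inr (f b)) | b. b \<in> B}"

definition order_topology_on :: "'a set \<Rightarrow> ('a \<Rightarrow> 'a \<Rightarrow> bool) \<Rightarrow> 'a topology" where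
  "order_topology_on S le = topology_generated_by
     (insert S ((\<lambda>a. {x \<in> S. le x a \<and> x \<noteq> a}) ` S \<union> (\<lambda>a. {x \<in> S. le a x \<and> x \<noteq> a}) ` S))"


section \<open>Closed subgroups and the Chabauty topology\<close>

definition closed_subgroups :: "'a::{group_add, topological_space} set set" where
  "closed_subgroups =
     {H. closed H \<and> 0 \<in> H \<and> (\<forall>x\<in>H. \<forall>y\<in>H. x + y \<in> H) \<and> (\<forall>x\<in>H. - x \<in> H)}"

text \<open>Taking \<open>K = {}\<close> shows that the underlying set is \<open>closed_subgroups\<close>.\<close>

definition chabauty_topology :: "'a::{group_add, topological_space} set topology" where
  "chabauty_topology = topology_generated_by
     ({{H \<in> closed_subgroups. H \<inter> K = {}} | K. compact K} \<union>
      {{H \<in> closed_subgroups. H \<inter> U \<noteq> {}} | U. open U})"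

lemma topspace_chabauty_topology [simp]: "topspace chabauty_topology = closed_subgroups"
proof -
  have "closed_subgroups \<in> {{H \<in> closed_subgroups. H \<inter> K = {}} | K. compact K}"
    by (auto intro!: exI[of _ "{}"])
  then show ?thesis unfolding chabauty_topology_def topology_generated_by_topspace by auto
qed

definition multiples :: "nat \<Rightarrow> int set" where
  "multiples n = range (\<lambda>k. int n * k)"


section \<open>The circle, the Hawaiian earring, the closed cone and the blown-up circle\<close>

definition circle_class :: "real \<Rightarrow> real set" where
  "circle_class x = {y. y - x \<in> \<int>}"

definition circle :: "real set topology" where
  "circle = final_topology euclideanreal circle_class"

definition earring_point :: "nat \<Rightarrow> real \<Rightarrow> complex" where
  "earring_point n \<theta> = (1 / of_nat n) * (1 + exp (2 * \<i> * complex_of_real \<theta>))"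

definition hawaiian_earring :: "complex set" where
  "hawaiian_earring = (\<Union>n\<in>{1..}. sphere (1 / of_nat n) (1 / real n))"

definition cone_rel :: "((ennreal \<times> real set) \<times> (ennreal \<times> real set)) set" where
  "cone_rel = {((\<infinity>, x), (\<infinity>, y)) | x y. x \<in> topspace circle \<and> y \<in> topspace circle}"

definition cone_point :: "ennreal \<Rightarrow> real set \<Rightarrow> (ennreal \<times> real set) set" where
  "cone_point \<alpha> x = generated_class cone_rel (\<alpha>, x)"

definition closed_cone :: "(ennreal \<times> real set) set topology" where
  "closed_cone = quotient_topology (prod_topology (euclidean :: ennreal topology) circle) cone_rel"

definition cone_boundary :: "(ennreal \<times> real set) set set" where
  "cone_boundary = cone_point 0 ` topspace circle"

definition lex_le :: "real \<times> real \<Rightarrow> real \<times> real \<Rightarrow> bool" where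
  "lex_le p q \<longleftrightarrow> fst p < fst q \<or> (fst p = fst q \<and> snd p \<le> snd q)"

definition blown_up_line :: "(real \<times> real) topology" where
  "blown_up_line = order_topology_on
     {(\<beta>, \<theta>). \<theta> \<in> {- pi/2 .. pi/2} \<and> (\<beta> \<notin> \<rat> \<longrightarrow> \<theta> = pi/2)} lex_le"

text \<open>The fibres of \<open>(\<beta>, \<theta>) \<mapsto> (circle_class \<beta>, \<theta>)\<close> are the orbits of
  \<open>(\<beta>, \<theta>) \<mapsto> (\<beta> + 1, \<theta>)\<close>.\<close>

definition blown_up_circle :: "(real set \<times> real) topology" where
  "blown_up_circle = final_topology blown_up_line (\<lambda>(\<beta>, \<theta>). (circle_class \<beta>, \<theta>))"


section \<open>The gluing data\<close>

text \<open>The attaching maps are functions of equivalence classes, so they are defined by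
  definite description over representatives; the lemmas
  \<open>cone_attach_rational\<close>, \<open>cone_attach_irrational\<close>, \<open>infinite_cone_attach_zero\<close>
  and \<open>infinite_cone_attach_pos\<close> below show that the descriptions are proper.\<close>

definition cone_attach ::
    "(real set \<Rightarrow> real set \<times> real) \<Rightarrow> (ennreal \<times> real set) set \<Rightarrow> complex" where
  "cone_attach \<xi> c = (THE z. \<exists>x\<in>topspace circle. c = cone_point 0 x \<and>
     ((\<exists>(a::int) (b::nat). b > 0 \<and> coprime a (int b)
          \<and> fst (\<xi> x) = circle_class (of_int a / of_nat b)
          \<and> z = earring_point b (snd (\<xi> x)))
      \<or> (fst (\<xi> x) \<notin> circle_class ` \<rat> \<and> z = 0)))"

definition infinite_cone_rel ::
    "((int set \<times> (ennreal \<times> real set) set) \<times> (int set \<times> (ennreal \<times> real set) set)) set" where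
  "infinite_cone_rel = {(({0}, cone_point \<alpha> x), ({0}, cone_point \<alpha> y)) | \<alpha> x y.
     x \<in> topspace circle \<and> y \<in> topspace circle}"

definition infinite_cone_point ::
    "int set \<Rightarrow> (ennreal \<times> real set) set \<Rightarrow> (int set \<times> (ennreal \<times> real set) set) set" where
  "infinite_cone_point H c = generated_class infinite_cone_rel (H, c)"

definition infinite_cone :: "(int set \<times> (ennreal \<times> real set) set) set topology" where
  "infinite_cone = quotient_topology (prod_topology chabauty_topology closed_cone) infinite_cone_rel"

definition infinite_cone_boundary :: "(int set \<times> (ennreal \<times> real set) set) set set" where
  "infinite_cone_boundary =
     (\<lambda>(H, c). infinite_cone_point H c) ` (closed_subgroups \<times> cone_boundary)"

definition infinite_cone_attach ::
    "(real set \<Rightarrow> real set \<times> real) \<Rightarrow> (int set \<times> (ennreal \<times> real set) set) set \<Rightarrow> complex" where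
  "infinite_cone_attach \<xi> e = (THE z. \<exists>n. \<exists>c\<in>cone_boundary.
     e = infinite_cone_point (multiples n) c \<and>
     ((n = 0 \<and> z = 0) \<or>
      (n > 0 \<and> (\<exists>b \<theta>. b > 0 \<and> \<theta> \<in> {- pi/2 .. pi/2} \<and> cone_attach \<xi> c = earring_point b \<theta>
                  \<and> z = earring_point (n * b) \<theta>))))"

lemma generated_class_self: "x \<in> generated_class r x"
  by (simp add: generated_class_def)

lemma cone_point_eq_iff:
  assumes "\<alpha> \<noteq> \<infinity>"
  shows "cone_point \<alpha> x = cone_point \<alpha> y \<longleftrightarrow> x = y"
proof
  have inv: "q = p" if "(p, q) \<in> (cone_rel \<union> cone_rel\<inverse>)\<^sup>*" "fst p = \<alpha>" for p q
    using that(1)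
  proof (induction rule: rtrancl_induct)
    case (step q q')
    from step.hyps(2) have "fst q = \<infinity>" by (auto simp: cone_rel_def)
    with step.IH that(2) assms show ?case by simp
  qed (rule refl)
  assume "cone_point \<alpha> x = cone_point \<alpha> y"
  then have "(\<alpha>, y) \<in> generated_class cone_rel (\<alpha>, x)"
    using generated_class_self[of "(\<alpha>, y)" cone_rel] by (simp add: cone_point_def)
  then have "((\<alpha>, x), (\<alpha>, y)) \<in> (cone_rel \<union> cone_rel\<inverse>)\<^sup>*"
    by (simp add: generated_class_def)
  from inv[OF this] show "x = y" by simp
qed simp

lemma circle_class_eq_iff: "circle_class x = circle_class y \<longleftrightarrow> x - y \<in> \<int>"
proof
  assume "circle_class x = circle_class y"
  moreover have "x \<in> circle_class x" by (simp add: circle_class_def)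
  ultimately show "x - y \<in> \<int>" by (simp add: circle_class_def)
next
  assume *: "x - y \<in> \<int>"
  have "z - x \<in> \<int> \<longleftrightarrow> z - y \<in> \<int>" for z
    using Ints_add[OF _ *, of "z - x"] Ints_diff[OF _ *, of "z - y"] by auto
  then show "circle_class x = circle_class y" by (simp add: circle_class_def)
qed

lemma circle_class_denominator_unique:
  assumes "circle_class (of_int a / of_nat b) = circle_class (of_int c / of_nat d)"
    and "b > 0" "d > 0" "coprime a (int b)" "coprime c (int d)"
  shows "b = d"
proof -
  obtain k where k: "of_int a / of_nat b - of_int c / of_nat d = (of_int k :: real)"
    using assms(1) by (auto simp: circle_class_eq_iff elim: Ints_cases)
  then have "real_of_int (a * int d - c * int b) = of_int (k * int b * int d)"
    using assms(2,3) by (simp add: field_simps)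
  then have e: "a * int d - c * int b = k * int b * int d" by linarith
  have "a * int d = (c + k * int d) * int b" "c * int b = (a - k * int b) * int d"
    using e by (simp_all add: algebra_simps)
  then have "int b dvd a * int d" "int d dvd c * int b" by (metis dvd_triv_right)+
  then have "int b dvd int d" "int d dvd int b"
    using assms(4,5) by (simp_all add: coprime_commute coprime_dvd_mult_right_iff)
  then show ?thesis by (simp add: dvd_antisym)
qed

lemma cone_attach_rational:
  assumes "x \<in> topspace circle" "b > 0" "coprime a (int b)"
    and "fst (\<xi> x) = circle_class (of_int a / of_nat b)"
  shows "cone_attach \<xi> (cone_point 0 x) = earring_point b (snd (\<xi> x))"
  unfolding cone_attach_def
proof (rule the_equality)
  fix z
  assume "\<exists>y\<in>topspace circle. cone_point 0 x = cone_point 0 y \<and>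
     ((\<exists>(a::int) (b::nat). b > 0 \<and> coprime a (int b)
          \<and> fst (\<xi> y) = circle_class (of_int a / of_nat b)
          \<and> z = earring_point b (snd (\<xi> y)))
      \<or> (fst (\<xi> y) \<notin> circle_class ` \<rat> \<and> z = 0))"
  moreover have "fst (\<xi> x) \<in> circle_class ` \<rat>" using assms by auto
  ultimately obtain c d where "d > 0" "coprime c (int d)"
    "fst (\<xi> x) = circle_class (of_int c / of_nat d)" "z = earring_point d (snd (\<xi> x))"
    by (auto simp: cone_point_eq_iff)
  then show "z = earring_point b (snd (\<xi> x))"
    using circle_class_denominator_unique[of a b c d] assms by simp
next
  have "\<exists>(a::int) (b'::nat). b' > 0 \<and> coprime a (int b')
      \<and> fst (\<xi> x) = circle_class (of_int a / of_nat b')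
      \<and> earring_point b (snd (\<xi> x)) = earring_point b' (snd (\<xi> x))"
    by (rule exI[of _ a], rule exI[of _ b]) (simp add: assms)
  then show "\<exists>y\<in>topspace circle. cone_point 0 x = cone_point 0 y \<and>
     ((\<exists>(a::int) (b'::nat). b' > 0 \<and> coprime a (int b')
          \<and> fst (\<xi> y) = circle_class (of_int a / of_nat b')
          \<and> earring_point b (snd (\<xi> x)) = earring_point b' (snd (\<xi> y)))
      \<or> (fst (\<xi> y) \<notin> circle_class ` \<rat> \<and> earring_point b (snd (\<xi> x)) = 0))"
    by (intro bexI[OF _ assms(1)] conjI refl disjI1)
qed

lemma cone_attach_irrational:
  assumes "x \<in> topspace circle" "fst (\<xi> x) \<notin> circle_class ` \<rat>"
  shows "cone_attach \<xi> (cone_point 0 x) = 0"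
  unfolding cone_attach_def
  by (rule the_equality) (use assms in \<open>auto simp: cone_point_eq_iff\<close>)

lemma infinite_cone_point_eqD:
  assumes "infinite_cone_point H c = infinite_cone_point H' c'"
  shows "H = H' \<and> (H \<noteq> {0} \<longrightarrow> c = c')"
proof -
  have inv: "fst q = fst p \<and> (fst p \<noteq> {0} \<longrightarrow> snd q = snd p)"
    if "(p, q) \<in> (infinite_cone_rel \<union> infinite_cone_rel\<inverse>)\<^sup>*" for p q
    using that
  proof (induction rule: rtrancl_induct)
    case (step q q')
    from step.hyps(2) have "fst q = {0}" "fst q' = {0}" by (auto simp: infinite_cone_rel_def)
    with step.IH show ?case by simp
  qed simp
  have "(H', c') \<in> generated_class infinite_cone_rel (H, c)"
    using assms generated_class_self[of "(H', c')" infinite_cone_rel]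
    by (simp add: infinite_cone_point_def)
  then have "((H, c), (H', c')) \<in> (infinite_cone_rel \<union> infinite_cone_rel\<inverse>)\<^sup>*"
    by (simp add: generated_class_def)
  from inv[OF this] show ?thesis by simp
qed

lemma multiples_0 [simp]: "multiples 0 = {0}"
  by (auto simp: multiples_def)

lemma multiples_eq_iff: "multiples m = multiples n \<longleftrightarrow> m = n"
proof
  assume *: "multiples m = multiples n"
  have dvd: "i \<in> multiples k \<longleftrightarrow> int k dvd i" for i k
    by (auto simp: multiples_def dvd_def)
  have "int n dvd int m" "int m dvd int n"
    using * dvd by (metis dvd_refl)+
  then show "m = n" by (simp add: dvd_antisym)
qed simp

lemma infinite_cone_attach_zero:
  assumes "c \<in> cone_boundary"
  shows "infinite_cone_attach \<xi> (infinite_cone_point {0} c) = 0"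
  unfolding infinite_cone_attach_def
proof (rule the_equality)
  show "\<exists>n. \<exists>d\<in>cone_boundary. infinite_cone_point {0} c = infinite_cone_point (multiples n) d \<and>
     ((n = 0 \<and> (0::complex) = 0) \<or>
      (n > 0 \<and> (\<exists>b \<theta>. b > 0 \<and> \<theta> \<in> {- pi/2 .. pi/2} \<and> cone_attach \<xi> d = earring_point b \<theta>
                  \<and> 0 = earring_point (n * b) \<theta>)))"
    using assms by (intro exI[of _ 0] bexI[of _ c]) auto
next
  fix z
  assume "\<exists>n. \<exists>d\<in>cone_boundary. infinite_cone_point {0} c = infinite_cone_point (multiples n) d \<and>
     ((n = 0 \<and> z = 0) \<or>
      (n > 0 \<and> (\<exists>b \<theta>. b > 0 \<and> \<theta> \<in> {- pi/2 .. pi/2} \<and> cone_attach \<xi> d = earring_point b \<theta>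
                  \<and> z = earring_point (n * b) \<theta>)))"
  then show "z = 0"
    by (metis infinite_cone_point_eqD multiples_0 multiples_eq_iff less_irrefl)
qed

lemma infinite_cone_attach_pos:
  assumes "c \<in> cone_boundary" "n > 0" "b > 0" "\<theta> \<in> {- pi/2 .. pi/2}"
    and "cone_attach \<xi> c = earring_point b \<theta>"
  shows "infinite_cone_attach \<xi> (infinite_cone_point (multiples n) c) = earring_point (n * b) \<theta>"
  unfolding infinite_cone_attach_def
proof (rule the_equality)
  show "\<exists>m. \<exists>d\<in>cone_boundary.
     infinite_cone_point (multiples n) c = infinite_cone_point (multiples m) d \<and>
     ((m = 0 \<and> earring_point (n * b) \<theta> = 0) \<or>
      (m > 0 \<and> (\<exists>b' \<theta>'. b' > 0 \<and> \<theta>' \<in> {- pi/2 .. pi/2} \<and> cone_attach \<xi> d = earring_point b' \<theta>'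
                  \<and> earring_point (n * b) \<theta> = earring_point (m * b') \<theta>')))"
    using assms by blast
next
  fix z
  assume "\<exists>m. \<exists>d\<in>cone_boundary.
     infinite_cone_point (multiples n) c = infinite_cone_point (multiples m) d \<and>
     ((m = 0 \<and> z = 0) \<or>
      (m > 0 \<and> (\<exists>b \<theta>. b > 0 \<and> \<theta> \<in> {- pi/2 .. pi/2} \<and> cone_attach \<xi> d = earring_point b \<theta>
                  \<and> z = earring_point (m * b) \<theta>)))"
  then obtain m d where d: "infinite_cone_point (multiples n) c = infinite_cone_point (multiples m) d"
    and z: "(m = 0 \<and> z = 0) \<or>
      (m > 0 \<and> (\<exists>b \<theta>. b > 0 \<and> \<theta> \<in> {- pi/2 .. pi/2} \<and> cone_attach \<xi> d = earring_point b \<theta>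
                  \<and> z = earring_point (m * b) \<theta>))" by blast
  have "m = n" "d = c"
    using infinite_cone_point_eqD[OF d] assms(2) multiples_eq_iff multiples_0 by (metis less_irrefl)+
  with z assms(2) obtain b' \<theta>' where "cone_attach \<xi> c = earring_point b' \<theta>'"
    "z = earring_point (n * b') \<theta>'" by auto
  moreover have "earring_point (n * k) t = earring_point k t / of_nat n" for k t
    by (simp add: earring_point_def)
  ultimately show "z = earring_point (n * b) \<theta>" using assms(5) by simp
qed

end

theory Submission
  imports Defs
begin

text \<open>A closed subgroup \<open>H\<close> of \<open>\<real> \<times> \<int>\<close> projects onto some \<open>n\<int>\<close> and meets \<open>\<real>\<close> in \<open>{0}\<close>, in a
  lattice \<open>(1/a)\<int>\<close> or in all of \<open>\<real>\<close>.  If the intersection is \<open>(1/a)\<int>\<close>, then \<open>H\<close> consists of the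
  points \<open>(v, n l)\<close> with \<open>l y - a v \<in> \<int>\<close>, where \<open>y\<close> is determined modulo 1 when \<open>n > 0\<close> and is
  irrelevant when \<open>n = 0\<close>; for the intersection \<open>\<real>\<close>, that is \<open>a = \<infinity>\<close>, the value of \<open>y\<close> is
  irrelevant too.  These are the points of the open cones of the infinite cone.  The subgroups that
  meet \<open>\<real>\<close> trivially are cyclic; letting the group generated by \<open>(tan \<theta>, m)\<close> correspond to the
  point \<open>(1 + e^(2i\<theta>)) / m\<close>, they form the Hawaiian earring.

  The whole difficulty lies in the behaviour for \<open>a \<rightarrow> 0\<close>.  For \<open>n = 1\<close> the lattice with parameters
  \<open>(a, y)\<close> tends to the group generated by \<open>(x, b)\<close> exactly when \<open>y\<close> tends to a fraction \<open>q\<close> with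
  denominator \<open>b\<close> in such a way that \<open>b (y - q) / a \<rightarrow> x\<close>; otherwise it leaves every compact set
  and tends to the trivial group.  Hence \<open>y\<close> is the wrong coordinate near the boundary, and for
  every \<open>a > 0\<close> the circle of all \<open>y\<close> has to be identified with the blown-up circle so that \<open>y\<close>
  at distance \<open>a x / b\<close> from \<open>q\<close> corresponds approximately to the point \<open>(q, arctan x)\<close>.

  Such identifications are obtained all at once from one strictly increasing function.  Attach to
  each rational \<open>q\<close> a degree one staircase which jumps at \<open>q + \<int>\<close>, the jump being smoothed to an
  arctangent at the scale \<open>a / b\<close>, and add all the staircases with weights of sum 1.  The result
  \<open>warp a\<close> is an increasing bijection of \<open>\<real>\<close> that commutes with integer translations.  For
  \<open>a \<rightarrow> 0\<close> every staircase becomes a true jump, and the sums converge to the function \<open>height\<close> on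
  the blown-up line, in which the jump at \<open>q\<close> is filled in by the angle over \<open>q\<close>
  (\<open>warp_blow_up\<close>).  This function is again an increasing bijection onto \<open>\<real>\<close>, so that a real
  number \<open>s\<close> can serve as a common coordinate: for \<open>a > 0\<close> it stands for the solution \<open>y\<close> of
  \<open>warp a y = s\<close>, and for \<open>a = 0\<close> for the point of height \<open>s\<close>.  Monotonicity turns the pointwise
  limit \<open>warp_blow_up\<close> into continuity of the family of lattices up to the boundary
  (\<open>lattice_limit_boundary\<close>).

  The rest is formal.  The index \<open>n\<close> enters through the continuous operation \<open>stretch\<close>, the given
  homeomorphism onto the blown-up circle is absorbed by composing it with \<open>height\<close>, and the
  resulting map from the adjunction space to the Chabauty space is continuous, injective
  (\<open>glued_family_inj\<close>) and surjective (\<open>glued_family_surj\<close>, the classification above).  Since its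
  source is compact and its target is Hausdorff, it is a homeomorphism.\<close>

section \<open>Smoothed staircases\<close>

text \<open>This is the continuous branch of \<open>arctan (c tan (\<pi> y)) / \<pi>\<close>.  Writing it as \<open>y\<close> plus the
  difference of two arctangents, merged by the addition formula, gives one expression valid for all
  \<open>y\<close>, without a case distinction at the poles of the tangent.\<close>

definition staircase :: "real \<Rightarrow> real \<Rightarrow> real" where
  "staircase c y = y + arctan ((c - 1) * (sin (pi * y) * cos (pi * y))
      / ((cos (pi * y))\<^sup>2 + c * (sin (pi * y))\<^sup>2)) / pi"

lemma staircase_denominator_pos:
  assumes "c > 0"
  shows "(cos t)\<^sup>2 + c * (sin t)\<^sup>2 > (0::real)"
proof (cases "sin t = 0")
  case True
  then show ?thesis using sin_cos_squared_add[of t] by simp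
next
  case False
  then have "c * (sin t)\<^sup>2 > 0" using assms by simp
  then show ?thesis by (simp add: add_nonneg_pos)
qed

lemma staircase_add_int: "staircase c (y + of_int n) = staircase c y + of_int n"
proof -
  have s0: "sin (pi * of_int n) = 0"
    using sin_times_pi_eq_0[of "of_int n"] by (simp add: mult.commute)
  have c1: "(cos (pi * of_int n))\<^sup>2 = 1"
    using sin_cos_squared_add[of "pi * of_int n"] s0 by simp
  have s: "sin (pi * (y + of_int n)) = sin (pi * y) * cos (pi * of_int n)"
    and c: "cos (pi * (y + of_int n)) = cos (pi * y) * cos (pi * of_int n)"
    by (simp_all add: distrib_left sin_add cos_add s0)
  have "sin (pi * (y + of_int n)) * cos (pi * (y + of_int n))
      = sin (pi * y) * cos (pi * y) * (cos (pi * of_int n))\<^sup>2"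
    by (simp only: s c) (simp add: power2_eq_square mult_ac)
  moreover have "(sin (pi * (y + of_int n)))\<^sup>2 = (sin (pi * y))\<^sup>2"
      "(cos (pi * (y + of_int n)))\<^sup>2 = (cos (pi * y))\<^sup>2"
    by (simp_all only: s c power_mult_distrib c1 mult_1_right)
  ultimately show ?thesis by (simp add: staircase_def c1)
qed

lemma abs_arctan_div_pi: "\<bar>arctan t / pi\<bar> \<le> 1 / 2"
  using arctan_bounded[of t] by (auto simp: abs_le_iff field_simps)

lemma staircase_bound: "\<bar>staircase c y - y\<bar> \<le> 1 / 2"
  using abs_arctan_div_pi by (simp add: staircase_def)

text \<open>The numerator and denominator of the quotient rule, and the sum of squares that comes from the
  arctangent, each contain the factor \<open>sin\<^sup>2 + cos\<^sup>2\<close>; removing it leaves the manifestly positive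
  derivative below, which is what makes the staircases strictly increasing.\<close>

lemma staircase_has_derivative:
  assumes c: "c > 0"
  shows "(staircase c has_real_derivative
    c / ((cos (pi * y))\<^sup>2 + c\<^sup>2 * (sin (pi * y))\<^sup>2)) (at y)"
proof -
  define s where "s = sin (pi * y)"
  define k where "k = cos (pi * y)"
  have sk: "s\<^sup>2 + k\<^sup>2 = 1" by (simp add: s_def k_def)
  have D: "k\<^sup>2 + c * s\<^sup>2 > 0" unfolding s_def k_def by (rule staircase_denominator_pos[OF c])
  have E: "k\<^sup>2 + c\<^sup>2 * s\<^sup>2 > 0"
    unfolding s_def k_def by (rule staircase_denominator_pos) (use c in simp)
  let ?N = "(c - 1) * (s * k)" and ?D = "k\<^sup>2 + c * s\<^sup>2"
  let ?N' = "(c - 1) * (pi * (k\<^sup>2 - s\<^sup>2))" and ?D' = "2 * pi * (c - 1) * (s * k)"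
  have norm: "?D\<^sup>2 + ?N\<^sup>2 = k\<^sup>2 + c\<^sup>2 * s\<^sup>2"
  proof -
    have "?D\<^sup>2 + ?N\<^sup>2 = (k\<^sup>2 + c\<^sup>2 * s\<^sup>2) * (s\<^sup>2 + k\<^sup>2)"
      by (simp add: power2_eq_square algebra_simps)
    then show ?thesis by (simp add: sk)
  qed
  have num: "?N' * ?D - ?N * ?D' = pi * ((c - 1) * (k\<^sup>2 - c * s\<^sup>2))"
  proof -
    have "?N' * ?D - ?N * ?D' = pi * ((c - 1) * ((k\<^sup>2 - c * s\<^sup>2) * (s\<^sup>2 + k\<^sup>2)))"
      by (simp add: power2_eq_square algebra_simps)
    then show ?thesis by (simp add: sk)
  qed
  have "((\<lambda>y. (c - 1) * (sin (pi * y) * cos (pi * y))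
      / ((cos (pi * y))\<^sup>2 + c * (sin (pi * y))\<^sup>2)) has_real_derivative
      (?N' * ?D - ?N * ?D') / (?D * ?D)) (at y)"
    using D unfolding s_def k_def
    by (auto intro!: derivative_eq_intros simp: power2_eq_square algebra_simps)
  from DERIV_chain2[OF DERIV_arctan this]
  have "((\<lambda>y. arctan ((c - 1) * (sin (pi * y) * cos (pi * y))
      / ((cos (pi * y))\<^sup>2 + c * (sin (pi * y))\<^sup>2))) has_real_derivative
      inverse (1 + (?N / ?D)\<^sup>2) * ((?N' * ?D - ?N * ?D') / (?D * ?D))) (at y)"
    by (simp add: s_def k_def)
  moreover have "inverse (1 + (?N / ?D)\<^sup>2) * ((?N' * ?D - ?N * ?D') / (?D * ?D))
     = pi * ((c - 1) * (k\<^sup>2 - c * s\<^sup>2)) / (k\<^sup>2 + c\<^sup>2 * s\<^sup>2)"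
  proof -
    have "1 + (?N / ?D)\<^sup>2 = (k\<^sup>2 + c\<^sup>2 * s\<^sup>2) / ?D\<^sup>2"
      using D by (simp add: norm[symmetric] power_divide add_divide_distrib)
    then show ?thesis unfolding num using D E
      by (simp add: power2_eq_square)
  qed
  ultimately have "(staircase c has_real_derivative
      1 + pi * ((c - 1) * (k\<^sup>2 - c * s\<^sup>2)) / (k\<^sup>2 + c\<^sup>2 * s\<^sup>2) / pi) (at y)"
    unfolding staircase_def by (intro DERIV_add DERIV_ident DERIV_cdivide) simp
  moreover have "1 + pi * ((c - 1) * (k\<^sup>2 - c * s\<^sup>2)) / (k\<^sup>2 + c\<^sup>2 * s\<^sup>2) / pi
      = c / (k\<^sup>2 + c\<^sup>2 * s\<^sup>2)"
  proof -
    have "k\<^sup>2 + c\<^sup>2 * s\<^sup>2 + (c - 1) * (k\<^sup>2 - c * s\<^sup>2) = c * (s\<^sup>2 + k\<^sup>2)"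
      by (simp add: power2_eq_square algebra_simps)
    moreover have "1 + pi * ((c - 1) * (k\<^sup>2 - c * s\<^sup>2)) / (k\<^sup>2 + c\<^sup>2 * s\<^sup>2) / pi
      = (k\<^sup>2 + c\<^sup>2 * s\<^sup>2 + (c - 1) * (k\<^sup>2 - c * s\<^sup>2)) / (k\<^sup>2 + c\<^sup>2 * s\<^sup>2)"
      using E by (subst add_divide_distrib) simp
    ultimately show ?thesis by (simp add: sk)
  qed
  ultimately show ?thesis by (simp add: s_def k_def)
qed

lemma staircase_strict_mono:
  assumes "c > 0" "x < y"
  shows "staircase c x < staircase c y"
proof (rule DERIV_pos_imp_increasing[OF assms(2)])
  fix t
  show "\<exists>d. (staircase c has_real_derivative d) (at t) \<and> 0 < d"
    using staircase_has_derivative[OF assms(1)] assms(1)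
      staircase_denominator_pos[of "c\<^sup>2" "pi * t"]
    by (intro exI[of _ "c / ((cos (pi * t))\<^sup>2 + c\<^sup>2 * (sin (pi * t))\<^sup>2)"]) simp
qed

lemma staircase_tendsto:
  assumes "(f \<longlongrightarrow> c) F" "(g \<longlongrightarrow> y) F" "c > 0"
  shows "((\<lambda>x. staircase (f x) (g x)) \<longlongrightarrow> staircase c y) F"
  unfolding staircase_def
  using staircase_denominator_pos[OF assms(3), of "pi * y"]
  by (intro tendsto_intros assms isCont_tendsto_compose[OF isCont_sin]
      isCont_tendsto_compose[OF isCont_cos]) auto

text \<open>Away from the integers the argument of the arctangent tends to \<open>cot (\<pi> y)\<close>, and
  \<open>arctan (cot (\<pi> u)) = \<pi> / 2 - \<pi> u\<close> for \<open>0 < u < 1\<close>: the limit is the step function.\<close>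

lemma staircase_tendsto_floor:
  assumes f: "filterlim f at_top F" and g: "(g \<longlongrightarrow> y) F" and y: "y \<notin> \<int>"
  shows "((\<lambda>x. staircase (f x) (g x)) \<longlongrightarrow> of_int \<lfloor>y\<rfloor> + 1 / 2) F"
proof -
  have inv: "((\<lambda>x. inverse (f x)) \<longlongrightarrow> 0) F"
    by (rule tendsto_inverse_0_at_top[OF f])
  have s: "sin (pi * y) \<noteq> 0"
    using y sin_times_pi_eq_0[of y] by (simp add: mult.commute)
  define H where "H = (\<lambda>x. (1 - inverse (f x)) * (sin (pi * g x) * cos (pi * g x))
      / (inverse (f x) * (cos (pi * g x))\<^sup>2 + (sin (pi * g x))\<^sup>2))"
  have "(H \<longlongrightarrow> (1 - 0) * (sin (pi * y) * cos (pi * y))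
      / (0 * (cos (pi * y))\<^sup>2 + (sin (pi * y))\<^sup>2)) F"
    unfolding H_def using s by (intro tendsto_intros inv g isCont_tendsto_compose[OF isCont_sin]
      isCont_tendsto_compose[OF isCont_cos]) auto
  then have H: "(H \<longlongrightarrow> cot (pi * y)) F"
    using s by (simp add: cot_def power2_eq_square)
  have "\<forall>\<^sub>F x in F. f x > 0"
    using f by (simp add: filterlim_at_top_dense)
  then have eq: "\<forall>\<^sub>F x in F. g x + arctan (H x) / pi = staircase (f x) (g x)"
  proof eventually_elim
    case (elim x)
    have "H x = (f x * ((1 - inverse (f x)) * (sin (pi * g x) * cos (pi * g x))))
      / (f x * (inverse (f x) * (cos (pi * g x))\<^sup>2 + (sin (pi * g x))\<^sup>2))"
      using elim unfolding H_def by simp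
    also have "\<dots> = (f x - 1) * (sin (pi * g x) * cos (pi * g x))
      / ((cos (pi * g x))\<^sup>2 + f x * (sin (pi * g x))\<^sup>2)"
    proof -
      have "f x * (1 - inverse (f x)) = f x - 1" "f x * inverse (f x) = 1"
        using elim by (simp_all add: right_diff_distrib)
      then show ?thesis by (simp add: distrib_left mult.assoc[symmetric])
    qed
    finally show ?case by (simp add: staircase_def)
  qed
  have "((\<lambda>x. g x + arctan (H x) / pi) \<longlongrightarrow> y + arctan (cot (pi * y)) / pi) F"
    by (intro tendsto_intros g H) simp
  moreover have "y + arctan (cot (pi * y)) / pi = of_int \<lfloor>y\<rfloor> + 1 / 2"
  proof -
    define u where "u = y - of_int \<lfloor>y\<rfloor>"
    have u: "0 < u" "u < 1" 
    proof -
      have "y \<noteq> of_int \<lfloor>y\<rfloor>" using y by (metis Ints_of_int)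
      then show "0 < u" "u < 1" unfolding u_def by linarith+
    qed
    have "cot (pi * y) = tan (pi / 2 - pi * y)"
      by (simp add: tan_cot cot_def tan_def inverse_eq_divide sin_diff cos_diff)
    also have "\<dots> = tan (pi / 2 - pi * u + of_int (- \<lfloor>y\<rfloor>) * pi)"
      by (simp add: u_def algebra_simps)
    also have "\<dots> = tan (pi / 2 - pi * u)" by (rule tan_periodic_int)
    finally have "arctan (cot (pi * y)) = pi / 2 - pi * u"
      using u by (simp only:) (rule arctan_tan, auto simp: field_simps)
    then show ?thesis by (simp add: u_def field_simps)
  qed
  ultimately show ?thesis using tendsto_cong[OF eq] by simp
qed

text \<open>At an integer the step is resolved at the scale \<open>1 / c\<close>: with \<open>c = b / (\<pi> a)\<close> and \<open>y = a x / b\<close>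
  one has \<open>c sin (\<pi> y) \<rightarrow> x\<close>.\<close>

lemma staircase_tendsto_arctan:
  assumes b: "b > 0"
  shows "((\<lambda>a. staircase (b / (pi * a)) (a * x / b)) \<longlongrightarrow> arctan x / pi) (at_right 0)"
proof -
  have u: "((\<lambda>a. a * x / b) \<longlongrightarrow> 0) (at_right 0)"
    using b by (auto intro!: tendsto_eq_intros)
  have cs: "((\<lambda>a. b / (pi * a) * sin (pi * (a * x / b))) \<longlongrightarrow> x) (at_right 0)"
  proof -
    have "((\<lambda>a. sin (pi * (a * x / b))) has_real_derivative
        cos (pi * (0 * x / b)) * (pi * (x / b))) (at 0)"
      using b by (auto intro!: derivative_eq_intros)
    then have "((\<lambda>a. sin (pi * (a * x / b)) / a) \<longlongrightarrow> pi * (x / b)) (at 0)"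
      by (simp add: has_field_derivative_iff)
    then have "((\<lambda>a. b / pi * (sin (pi * (a * x / b)) / a)) \<longlongrightarrow> b / pi * (pi * (x / b))) (at_right 0)"
      by (intro tendsto_mult tendsto_const) (rule tendsto_within_subset[where S = UNIV], auto)
    then show ?thesis using b by (simp add: field_simps)
  qed
  have sn: "((\<lambda>a. sin (pi * (a * x / b))) \<longlongrightarrow> 0) (at_right 0)"
    and cn: "((\<lambda>a. cos (pi * (a * x / b))) \<longlongrightarrow> 1) (at_right 0)"
    using tendsto_sin[OF tendsto_mult[OF tendsto_const[of pi] u]]
      tendsto_cos[OF tendsto_mult[OF tendsto_const[of pi] u]] by simp_all
  have "((\<lambda>a. a * x / b + arctan ((b / (pi * a) * sin (pi * (a * x / b)) - sin (pi * (a * x / b)))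
        * cos (pi * (a * x / b)) / ((cos (pi * (a * x / b)))\<^sup>2
        + (b / (pi * a) * sin (pi * (a * x / b))) * sin (pi * (a * x / b)))) / pi)
     \<longlongrightarrow> 0 + arctan ((x - 0) * 1 / (1\<^sup>2 + x * 0)) / pi) (at_right 0)"
    by (intro tendsto_intros u cs sn cn) auto
  then show ?thesis
    unfolding staircase_def by (simp add: algebra_simps power2_eq_square)
qed

section \<open>Dyadic sums\<close>

definition dyadic_sum :: "(nat \<Rightarrow> real) \<Rightarrow> real" where
  "dyadic_sum f = (\<Sum>i. (1 / 2) ^ Suc i * f i)"

lemma dyadic_summable:
  assumes "\<And>i. \<bar>f i\<bar> \<le> B"
  shows "summable (\<lambda>i. (1 / 2) ^ Suc i * f i :: real)"
proof (rule summable_comparison_test')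
  show "summable (\<lambda>i. (1 / 2) ^ Suc i * B)"
    by (intro summable_mult2 sums_summable[OF power_half_series])
  show "norm ((1 / 2) ^ Suc i * f i) \<le> (1 / 2) ^ Suc i * B" for i
    using assms[of i] by (simp add: abs_mult mult_left_mono)
qed

lemma dyadic_sum_add_const:
  assumes "\<And>i. \<bar>f i\<bar> \<le> B"
  shows "dyadic_sum (\<lambda>i. f i + y) = dyadic_sum f + y"
proof -
  have "(\<lambda>i. (1 / 2) ^ Suc i * f i + (1 / 2) ^ Suc i * y) sums (dyadic_sum f + 1 * y)"
    unfolding dyadic_sum_def
    by (intro sums_add summable_sums dyadic_summable[OF assms] sums_mult2 power_half_series)
  then show ?thesis unfolding dyadic_sum_def by (simp add: distrib_left sums_iff)
qed

lemma dyadic_sum_strict_mono: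
  assumes "\<And>i. \<bar>f i\<bar> \<le> B" "\<And>i. \<bar>g i\<bar> \<le> B" and "\<And>i. f i \<le> g i" "f j < g j"
  shows "dyadic_sum f < dyadic_sum g"
proof -
  have "0 < (\<Sum>i. (1 / 2) ^ Suc i * g i - (1 / 2) ^ Suc i * f i)"
  proof (rule suminf_pos2[where i = j])
    show "summable (\<lambda>i. (1 / 2) ^ Suc i * g i - (1 / 2) ^ Suc i * f i)"
      by (rule summable_diff[OF dyadic_summable[OF assms(2)] dyadic_summable[OF assms(1)]])
    show "0 \<le> (1 / 2) ^ Suc i * g i - (1 / 2) ^ Suc i * f i" for i
      using mult_left_mono[OF assms(3), of "(1 / 2) ^ Suc i" i] by simp
    show "0 < (1 / 2) ^ Suc j * g j - (1 / 2) ^ Suc j * f j"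
      using mult_strict_left_mono[OF assms(4), of "(1 / 2) ^ Suc j"] by simp
  qed
  then show ?thesis unfolding dyadic_sum_def
    using suminf_diff[OF dyadic_summable[of g B, OF assms(2)] dyadic_summable[of f B, OF assms(1)]]
    by simp
qed

lemma dyadic_sum_le:
  assumes "\<And>i. \<bar>f i\<bar> \<le> B" "\<And>i. \<bar>g i\<bar> \<le> B" and "\<And>i. f i \<le> g i"
  shows "dyadic_sum f \<le> dyadic_sum g"
proof (cases "\<exists>j. f j < g j")
  case True
  then show ?thesis using dyadic_sum_strict_mono[of f B g] assms by (meson less_imp_le)
next
  case False
  then have "f = g" using assms(3) by (meson ext antisym_conv1)
  then show ?thesis by simp
qed

lemma dyadic_sum_close:
  assumes "\<And>i. \<bar>f i - y\<bar> \<le> B"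
  shows "\<bar>dyadic_sum f - y\<bar> \<le> B"
proof -
  have f: "\<bar>f i\<bar> \<le> \<bar>y\<bar> + B" for i using assms[of i] by linarith
  have B: "0 \<le> B" using assms[of 0] by linarith
  have c: "dyadic_sum (\<lambda>i. z) = z" for z
    using dyadic_sum_add_const[of "\<lambda>_. 0" 0 z] by (simp add: dyadic_sum_def)
  have "dyadic_sum (\<lambda>i. y - B) \<le> dyadic_sum f" "dyadic_sum f \<le> dyadic_sum (\<lambda>i. y + B)"
    using assms B by (auto intro!: dyadic_sum_le[where B = "\<bar>y\<bar> + B"] f simp: abs_le_iff algebra_simps)
  then show ?thesis by (simp add: c)
qed

text \<open>Dominated convergence; it carries all limits of the superpositions below.\<close>

lemma dyadic_sum_tendsto:
  assumes "\<And>i. ((\<lambda>x. f i x) \<longlongrightarrow> l i) F" and "\<forall>\<^sub>F x in F. \<forall>i. \<bar>f i x\<bar> \<le> B"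
  shows "((\<lambda>x. dyadic_sum (\<lambda>i. f i x)) \<longlongrightarrow> dyadic_sum l) F"
proof (cases "F = bot")
  case False
  have "\<forall>\<^sub>F (i, x) in at_top \<times>\<^sub>F F. norm ((1 / 2) ^ Suc i * f i x) \<le> (1 / 2) ^ Suc i * B"
    unfolding eventually_prod_filter
  proof (intro exI conjI allI impI)
    show "\<forall>\<^sub>F i in at_top. True" by simp
    show "\<forall>\<^sub>F x in F. \<forall>i. \<bar>f i x\<bar> \<le> B" by (rule assms)
    show "case (i, x) of (i, x) \<Rightarrow> norm ((1 / 2) ^ Suc i * f i x) \<le> (1 / 2) ^ Suc i * B"
      if "\<forall>i. \<bar>f i x\<bar> \<le> B" for i x
      using that by (simp add: abs_mult mult_left_mono)
  qed
  moreover have "summable (\<lambda>i. (1 / 2) ^ Suc i * B)"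
    by (intro summable_mult2 sums_summable[OF power_half_series])
  ultimately show ?thesis
    unfolding dyadic_sum_def
    using tannerys_theorem[of "\<lambda>i x. (1 / 2) ^ Suc i * f i x" "\<lambda>i. (1 / 2) ^ Suc i * l i" F
        "\<lambda>i. (1 / 2) ^ Suc i * B", OF tendsto_mult[OF tendsto_const assms(1)]] False
    by blast
qed simp

section \<open>Denominators of rational numbers\<close>

definition denominator :: "real \<Rightarrow> nat" where
  "denominator \<beta> = (LEAST b. b > 0 \<and> of_nat b * \<beta> \<in> \<int>)"

lemma denominator:
  assumes "\<beta> \<in> \<rat>"
  shows "denominator \<beta> > 0" "of_nat (denominator \<beta>) * \<beta> \<in> \<int>"
proof -
  obtain a b where "b > 0" "\<beta> = of_int a / of_int b"
    using assms by (metis Rats_cases')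
  then have "nat b > 0 \<and> of_nat (nat b) * \<beta> \<in> \<int>" by simp
  then have "denominator \<beta> > 0 \<and> of_nat (denominator \<beta>) * \<beta> \<in> \<int>"
    unfolding denominator_def by (rule LeastI)
  then show "denominator \<beta> > 0" "of_nat (denominator \<beta>) * \<beta> \<in> \<int>" by auto
qed

text \<open>The least positive multiplier divides every multiplier, because the remainder of a multiplier
  modulo the least one is again a multiplier.\<close>

lemma int_mult_Ints_iff_denominator_dvd:
  assumes "\<beta> \<in> \<rat>"
  shows "of_int k * \<beta> \<in> \<int> \<longleftrightarrow> int (denominator \<beta>) dvd k"
proof
  let ?d = "denominator \<beta>"
  assume k: "of_int k * \<beta> \<in> \<int>"
  define m where "m = nat (k mod int ?d)"
  have m: "int m = k mod int ?d" using denominator(1)[OF assms] by (simp add: m_def)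
  have "real_of_int (k mod int ?d) = of_int k - of_int (k div int ?d) * real ?d"
    by (simp add: minus_div_mult_eq_mod[symmetric])
  then have "of_nat m * \<beta> = of_int k * \<beta> - of_int (k div int ?d) * (real ?d * \<beta>)"
    using m by (metis left_diff_distrib mult.assoc of_int_of_nat_eq)
  also have "\<dots> \<in> \<int>"
    by (rule Ints_diff[OF k Ints_mult[OF Ints_of_int denominator(2)[OF assms]]])
  finally have "of_nat m * \<beta> \<in> \<int>" .
  moreover have "m < ?d" using m denominator(1)[OF assms]
    by (metis of_nat_0_less_iff of_nat_less_iff pos_mod_bound)
  ultimately have "m = 0"
    using not_less_Least[of m "\<lambda>b. b > 0 \<and> of_nat b * \<beta> \<in> \<int>"] by (auto simp: denominator_def)
  then show "int ?d dvd k" using m by (simp add: dvd_eq_mod_eq_0)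
next
  assume "int (denominator \<beta>) dvd k"
  then obtain j where "k = int (denominator \<beta>) * j" by auto
  then have "of_int k * \<beta> = of_int j * (of_nat (denominator \<beta>) * \<beta>)" by simp
  then show "of_int k * \<beta> \<in> \<int>"
    by (simp only:) (rule Ints_mult[OF Ints_of_int denominator(2)[OF assms]])
qed

lemma denominator_add_int: "denominator (\<beta> + of_int n) = denominator \<beta>"
proof -
  have "of_nat b * (\<beta> + of_int n) \<in> \<int> \<longleftrightarrow> of_nat b * \<beta> \<in> \<int>" for b :: nat
  proof -
    have "of_nat b * (\<beta> + of_int n) = of_nat b * \<beta> + of_int (int b * n)"
      by (simp add: distrib_left)
    then show ?thesis by (metis Ints_of_int add_in_Ints_iff_right)
  qed
  then show ?thesis by (simp add: denominator_def)
qed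

lemma denominator_fraction:
  assumes "b > 0" "coprime a (int b)"
  shows "denominator (of_int a / of_nat b) = b"
proof -
  let ?\<beta> = "of_int a / of_nat b :: real"
  have q: "?\<beta> \<in> \<rat>" by simp
  have "of_int (int b) * ?\<beta> = of_int a" using assms by simp
  then have "of_int (int b) * ?\<beta> \<in> \<int>" by (metis Ints_of_int)
  then have 1: "int (denominator ?\<beta>) dvd int b" using int_mult_Ints_iff_denominator_dvd[OF q] by blast
  obtain m where "of_nat (denominator ?\<beta>) * ?\<beta> = of_int m"
    using denominator(2)[OF q] by (auto elim: Ints_cases)
  then have "real_of_int (int (denominator ?\<beta>) * a) = of_int (m * int b)"
    using assms by (simp add: field_simps)
  then have "int b dvd int (denominator ?\<beta>) * a" by (metis dvd_triv_right of_int_eq_iff)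
  then have "int b dvd int (denominator ?\<beta>)"
    using assms(2) by (simp add: coprime_commute coprime_dvd_mult_left_iff)
  with 1 show ?thesis by (simp add: dvd_antisym)
qed

section \<open>Superposed staircases and their limit\<close>

definition nth_rat :: "nat \<Rightarrow> real" where
  "nth_rat = from_nat_into \<rat>"

lemma nth_rat_in: "nth_rat i \<in> \<rat>"
  unfolding nth_rat_def by (rule from_nat_into) (use Rats_0 in blast)

lemma nth_rat_surj: "q \<in> \<rat> \<Longrightarrow> \<exists>i. nth_rat i = q"
  unfolding nth_rat_def using from_nat_into_surj[OF countable_rat] by blast

text \<open>The scale of the smoothing at \<open>q\<close> is inversely proportional to the denominator of \<open>q\<close>: this is
  dictated by the group generated by \<open>(x, b)\<close>, to which the lattice of \<open>y = q + a x / b\<close> is close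
  when \<open>b\<close> is the denominator of \<open>q\<close>.  The enumeration runs over all rationals and hence repeats
  every class modulo 1, which only adds up weights.  Adding \<open>nth_rat i\<close> back
  keeps each term within \<open>1 / 2\<close> of \<open>y\<close>, so that the unbounded enumeration does no harm.\<close>

definition warp :: "real \<Rightarrow> real \<Rightarrow> real" where
  "warp a y = dyadic_sum (\<lambda>i. nth_rat i
     + staircase (of_nat (denominator (nth_rat i)) / (pi * a)) (y - nth_rat i))"

text \<open>The unit step function on the blown-up line; over an integer the step is filled in by the angle,
  which grows by \<open>\<pi>\<close>.\<close>

definition jump :: "real \<Rightarrow> real \<Rightarrow> real" where
  "jump \<beta> \<theta> = (if \<beta> \<in> \<int> then \<beta> + \<theta> / pi else of_int \<lfloor>\<beta>\<rfloor> + 1 / 2)"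

definition height :: "real \<Rightarrow> real \<Rightarrow> real" where
  "height \<beta> \<theta> = dyadic_sum (\<lambda>i. nth_rat i + jump (\<beta> - nth_rat i) \<theta>)"

lemma warp_term_close: "\<bar>r + staircase c (y - r) - y\<bar> \<le> 1 / 2"
  using staircase_bound[of c "y - r"] by (simp add: algebra_simps)

lemma warp_term_bound: "\<bar>y\<bar> \<le> B \<Longrightarrow> \<bar>r + staircase c (y - r)\<bar> \<le> B + 1 / 2"
  using warp_term_close[of r c y] by linarith

lemma warp_close: "\<bar>warp a y - y\<bar> \<le> 1 / 2"
  unfolding warp_def by (rule dyadic_sum_close[OF warp_term_close])

lemma warp_add_int: "warp a (y + of_int n) = warp a y + of_int n"
proof -
  have "r + staircase c (y + of_int n - r) = r + staircase c (y - r) + of_int n" for r c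
    using staircase_add_int[of c "y - r" n] by (simp add: algebra_simps)
  then show ?thesis unfolding warp_def
    by (simp only:) (rule dyadic_sum_add_const, rule warp_term_bound, rule order_refl)
qed

lemma warp_strict_mono:
  assumes "a > 0" "y < z"
  shows "warp a y < warp a z"
proof -
  have "staircase (of_nat (denominator (nth_rat i)) / (pi * a)) (y - nth_rat i)
      < staircase (of_nat (denominator (nth_rat i)) / (pi * a)) (z - nth_rat i)" for i
    by (rule staircase_strict_mono) (use assms denominator(1)[OF nth_rat_in] in auto)
  then show ?thesis unfolding warp_def
    by (intro dyadic_sum_strict_mono[where B = "max \<bar>y\<bar> \<bar>z\<bar> + 1 / 2"] warp_term_bound)
      (auto intro: less_imp_le)
qed

lemma warp_tendsto:
  assumes "(f \<longlongrightarrow> a) F" "(g \<longlongrightarrow> y) F" "a > 0"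
  shows "((\<lambda>x. warp (f x) (g x)) \<longlongrightarrow> warp a y) F"
  unfolding warp_def
proof (rule dyadic_sum_tendsto)
  fix i
  show "((\<lambda>x. nth_rat i
     + staircase (of_nat (denominator (nth_rat i)) / (pi * f x)) (g x - nth_rat i)) \<longlongrightarrow>
     nth_rat i + staircase (of_nat (denominator (nth_rat i)) / (pi * a)) (y - nth_rat i)) F"
    using assms denominator(1)[OF nth_rat_in]
    by (intro tendsto_intros staircase_tendsto) auto
next
  have "\<forall>\<^sub>F x in F. dist (g x) y < 1" using assms(2) by (simp add: tendsto_iff)
  then show "\<forall>\<^sub>F x in F. \<forall>i. \<bar>nth_rat i
     + staircase (of_nat (denominator (nth_rat i)) / (pi * f x)) (g x - nth_rat i)\<bar> \<le> \<bar>y\<bar> + 1 + 1 / 2"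
  proof eventually_elim
    case (elim x)
    then have "\<bar>g x\<bar> \<le> \<bar>y\<bar> + 1" unfolding dist_real_def by linarith
    then show ?case by (blast intro: warp_term_bound)
  qed
qed

text \<open>A continuous function at bounded distance from the identity is onto, by the intermediate value
  theorem.\<close>

lemma real_surj_close:
  fixes f :: "real \<Rightarrow> real"
  assumes "continuous_on UNIV f" "\<And>y. \<bar>f y - y\<bar> \<le> B"
  shows "\<exists>y. f y = s"
proof -
  have "0 \<le> B" using assms(2)[of 0] by linarith
  then have "s - B \<le> s + B" by simp
  moreover have "f (s - B) \<le> s" "s \<le> f (s + B)"
    using assms(2)[of "s - B"] assms(2)[of "s + B"] by linarith+
  moreover have "continuous_on {s - B..s + B} f"
    by (rule continuous_on_subset[OF assms(1)]) simp
  ultimately show ?thesis using IVT'[of f "s - B" s "s + B"] by blast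
qed

lemma warp_surj:
  assumes "a > 0"
  shows "\<exists>y. warp a y = s"
proof (rule real_surj_close)
  show "continuous_on UNIV (warp a)"
    unfolding continuous_on_def using assms by (auto intro!: warp_tendsto)
qed (rule warp_close)

lemma jump_add_int: "jump (\<beta> + of_int n) \<theta> = jump \<beta> \<theta> + of_int n"
  by (simp add: jump_def)

lemma jump_between:
  assumes "\<theta> \<in> {- pi / 2..pi / 2}"
  shows "of_int \<lceil>\<beta>\<rceil> - 1 / 2 \<le> jump \<beta> \<theta>" "jump \<beta> \<theta> \<le> of_int \<lfloor>\<beta>\<rfloor> + 1 / 2"
proof -
  have t: "- 1 / 2 \<le> \<theta> / pi" "\<theta> / pi \<le> 1 / 2" using assms by (auto simp: field_simps)
  show "of_int \<lceil>\<beta>\<rceil> - 1 / 2 \<le> jump \<beta> \<theta>" "jump \<beta> \<theta> \<le> of_int \<lfloor>\<beta>\<rfloor> + 1 / 2"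
    using t by (auto simp: jump_def ceiling_altdef elim!: Ints_cases)
qed

lemma jump_mono:
  assumes "\<beta> < \<beta>'" "\<theta> \<in> {- pi / 2..pi / 2}" "\<theta>' \<in> {- pi / 2..pi / 2}"
  shows "jump \<beta> \<theta> \<le> jump \<beta>' \<theta>'"
proof -
  have "\<lfloor>\<beta>\<rfloor> < \<lceil>\<beta>'\<rceil>" using assms(1) by linarith
  then have "real_of_int \<lfloor>\<beta>\<rfloor> + 1 \<le> of_int \<lceil>\<beta>'\<rceil>" by linarith
  then show ?thesis using jump_between[OF assms(2), of \<beta>] jump_between[OF assms(3), of \<beta>'] by linarith
qed

lemma height_term_close:
  assumes "\<theta> \<in> {- pi / 2..pi / 2}"
  shows "\<bar>r + jump (\<beta> - r) \<theta> - \<beta>\<bar> \<le> 1 / 2"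
  using jump_between[OF assms, of "\<beta> - r"] by linarith

lemma height_term_bound:
  assumes "\<theta> \<in> {- pi / 2..pi / 2}" "\<bar>\<beta>\<bar> \<le> B"
  shows "\<bar>r + jump (\<beta> - r) \<theta>\<bar> \<le> B + 1 / 2"
  using height_term_close[OF assms(1), of r \<beta>] assms(2) by linarith

lemma height_close: "\<theta> \<in> {- pi / 2..pi / 2} \<Longrightarrow> \<bar>height \<beta> \<theta> - \<beta>\<bar> \<le> 1 / 2"
  unfolding height_def by (rule dyadic_sum_close[OF height_term_close])

lemma height_add_int:
  assumes "\<theta> \<in> {- pi / 2..pi / 2}"
  shows "height (\<beta> + of_int n) \<theta> = height \<beta> \<theta> + of_int n"
proof -
  have "r + jump (\<beta> + of_int n - r) \<theta> = r + jump (\<beta> - r) \<theta> + of_int n" for r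
  proof -
    have "\<beta> + of_int n - r = (\<beta> - r) + of_int n" by simp
    then show ?thesis by (simp only: jump_add_int add.assoc)
  qed
  then show ?thesis unfolding height_def
    by (simp only:) (rule dyadic_sum_add_const, rule height_term_bound[OF assms order_refl])
qed

text \<open>Every jump function is monotone, and one that is centred at a rational between the two base
  points increases strictly.\<close>

lemma height_strict_mono:
  assumes "\<beta> < \<beta>'" "\<theta> \<in> {- pi / 2..pi / 2}" "\<theta>' \<in> {- pi / 2..pi / 2}"
  shows "height \<beta> \<theta> < height \<beta>' \<theta>'"
proof -
  obtain q where q: "q \<in> \<rat>" "\<beta> < q" "q < \<beta>'" using Rats_dense_in_real[OF assms(1)] by blast
  obtain j where j: "nth_rat j = q" using nth_rat_surj[OF q(1)] by blast
  have "\<lfloor>\<beta> - q\<rfloor> \<le> -1" "\<lceil>\<beta>' - q\<rceil> \<ge> 1" using q by linarith+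
  then have "real_of_int \<lfloor>\<beta> - q\<rfloor> \<le> -1" "real_of_int \<lceil>\<beta>' - q\<rceil> \<ge> 1" by linarith+
  then have "jump (\<beta> - nth_rat j) \<theta> < jump (\<beta>' - nth_rat j) \<theta>'"
    using jump_between[OF assms(2), of "\<beta> - q"] jump_between[OF assms(3), of "\<beta>' - q"]
    unfolding j by linarith
  then show ?thesis unfolding height_def
    by (intro dyadic_sum_strict_mono[where B = "max \<bar>\<beta>\<bar> \<bar>\<beta>'\<bar> + 1 / 2" and j = j] height_term_bound)
      (use assms jump_mono in auto)
qed

lemma height_strict_mono_angle:
  assumes "\<beta> \<in> \<rat>" "\<theta> < \<theta>'" "\<theta> \<in> {- pi / 2..pi / 2}" "\<theta>' \<in> {- pi / 2..pi / 2}"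
  shows "height \<beta> \<theta> < height \<beta> \<theta>'"
proof -
  obtain j where j: "nth_rat j = \<beta>" using nth_rat_surj[OF assms(1)] by blast
  show ?thesis unfolding height_def
    by (intro dyadic_sum_strict_mono[where B = "\<bar>\<beta>\<bar> + 1 / 2" and j = j] height_term_bound)
      (use assms j in \<open>auto simp: jump_def divide_strict_right_mono intro!: divide_right_mono\<close>)
qed

text \<open>An irrational point never sits on a step, so the angle has no influence there.\<close>

lemma height_irrational:
  assumes "\<beta> \<notin> \<rat>"
  shows "height \<beta> \<theta> = height \<beta> \<theta>'"
proof -
  have "\<beta> - nth_rat i \<notin> \<int>" for i
  proof
    assume "\<beta> - nth_rat i \<in> \<int>"
    then have "\<beta> - nth_rat i + nth_rat i \<in> \<rat>"
      using Ints_subset_Rats by (intro Rats_add nth_rat_in) auto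
    with assms show False by simp
  qed
  then show ?thesis by (simp add: height_def jump_def)
qed

text \<open>Dominated convergence reduces this to single terms.  The staircases centred at points of
  \<open>q + \<int>\<close> all have the denominator of \<open>q\<close> and are therefore seen at exactly the scale at which they
  look like an arctangent; all others converge to their step function.\<close>

lemma warp_blow_up:
  assumes q: "q \<in> \<rat>"
  shows "((\<lambda>a. warp a (q + a * x / of_nat (denominator q))) \<longlongrightarrow> height q (arctan x)) (at_right 0)"
  unfolding warp_def height_def
proof (rule dyadic_sum_tendsto)
  let ?d = "real (denominator q)"
  have d: "?d > 0" using denominator(1)[OF q] by simp
  have lim: "((\<lambda>a. q + a * x / ?d) \<longlongrightarrow> q) (at_right 0)"
    using d by (auto intro!: tendsto_eq_intros)
  then have "\<forall>\<^sub>F a in at_right 0. dist (q + a * x / ?d) q < 1" by (simp add: tendsto_iff)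
  then show "\<forall>\<^sub>F a in at_right 0. \<forall>i. \<bar>nth_rat i + staircase (of_nat (denominator (nth_rat i)) / (pi * a))
      (q + a * x / ?d - nth_rat i)\<bar> \<le> \<bar>q\<bar> + 1 + 1 / 2"
  proof eventually_elim
    case (elim a)
    then have "\<bar>q + a * x / ?d\<bar> \<le> \<bar>q\<bar> + 1" unfolding dist_real_def by linarith
    then show ?case by (blast intro: warp_term_bound)
  qed
  fix i
  show "((\<lambda>a. nth_rat i + staircase (of_nat (denominator (nth_rat i)) / (pi * a))
      (q + a * x / ?d - nth_rat i)) \<longlongrightarrow> nth_rat i + jump (q - nth_rat i) (arctan x)) (at_right 0)"
  proof (cases "q - nth_rat i \<in> \<int>")
    case True
    then obtain n where n: "q - nth_rat i = of_int n" by (auto elim: Ints_cases)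
    then have "q = nth_rat i + of_int n" by simp
    then have d': "denominator (nth_rat i) = denominator q" using denominator_add_int by metis
    have "q + a * x / ?d - nth_rat i = a * x / ?d + of_int n" for a using n by simp
    moreover have "jump (q - nth_rat i) (arctan x) = arctan x / pi + of_int n"
      by (simp add: n jump_def)
    ultimately show ?thesis
      by (simp only: d' staircase_add_int) (intro tendsto_intros staircase_tendsto_arctan[OF d])
  next
    case False
    have "filterlim (\<lambda>a. of_nat (denominator (nth_rat i)) / (pi * a)) at_top (at_right 0)"
    proof -
      have "filterlim (\<lambda>a. (of_nat (denominator (nth_rat i)) / pi) * inverse a) at_top (at_right 0)"
        using denominator(1)[OF nth_rat_in[of i]]
        by (intro filterlim_tendsto_pos_mult_at_top[OF tendsto_const] filterlim_inverse_at_top_right) auto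
      then show ?thesis by (simp add: field_simps)
    qed
    from staircase_tendsto_floor[OF this tendsto_diff[OF lim tendsto_const] False]
    show ?thesis using False by (auto simp: jump_def intro!: tendsto_intros)
  qed
qed

text \<open>For fixed angle \<open>\<pi> / 2\<close> the height is right continuous in the base point, and its left limits
  are the values at the angle \<open>- \<pi> / 2\<close>.  So the supremum \<open>\<beta>\<close> of the base points of height at most
  \<open>s\<close> has \<open>s\<close> between its two extreme heights, and the intermediate value theorem in the angle
  finishes.\<close>

lemma height_surj: "\<exists>\<beta> \<theta>. \<theta> \<in> {- pi / 2..pi / 2} \<and> (\<beta> \<notin> \<rat> \<longrightarrow> \<theta> = pi / 2) \<and> height \<beta> \<theta> = s"
proof -
  have P: "pi / 2 \<in> {- pi / 2..pi / 2}" "- pi / 2 \<in> {- pi / 2..pi / 2}" by auto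
  define A where "A = {\<beta>. height \<beta> (pi / 2) \<le> s}"
  define \<beta> where "\<beta> = Sup A"
  have "s - 1 / 2 \<in> A" using height_close[OF P(1), of "s - 1 / 2"] unfolding A_def mem_Collect_eq by linarith
  then have ne: "A \<noteq> {}" by blast
  have bdd: "bdd_above A"
  proof
    fix t assume "t \<in> A"
    then show "t \<le> s + 1 / 2" using height_close[OF P(1), of t] unfolding A_def mem_Collect_eq by linarith
  qed
  have up: "height \<beta> (- pi / 2) \<le> s"
  proof (rule tendsto_upperbound)
    show "((\<lambda>t. height t (pi / 2)) \<longlongrightarrow> height \<beta> (- pi / 2)) (at_left \<beta>)"
      unfolding height_def
    proof (rule dyadic_sum_tendsto)
      have "\<forall>\<^sub>F t in at_left \<beta>. t \<in> {\<beta> - 1<..<\<beta>}" by (rule eventually_at_leftI) auto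
      then show "\<forall>\<^sub>F t in at_left \<beta>. \<forall>i. \<bar>nth_rat i + jump (t - nth_rat i) (pi / 2)\<bar> \<le> \<bar>\<beta>\<bar> + 1 + 1 / 2"
        by eventually_elim (intro allI height_term_bound P, auto)
      fix i
      let ?r = "nth_rat i"
      have "\<forall>\<^sub>F t in at_left \<beta>. t \<in> {?r + of_int (\<lceil>\<beta> - ?r\<rceil> - 1)<..<\<beta>}"
        by (rule eventually_at_leftI) (auto, linarith)
      then have "\<forall>\<^sub>F t in at_left \<beta>. jump (\<beta> - ?r) (- pi / 2) = jump (t - ?r) (pi / 2)"
      proof eventually_elim
        case (elim t)
        then have "\<lfloor>t - ?r\<rfloor> = \<lceil>\<beta> - ?r\<rceil> - 1" by (intro floor_unique) (auto, linarith)
        moreover have "t - ?r \<notin> \<int>"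
        proof
          assume "t - ?r \<in> \<int>"
          then obtain m where "t - ?r = of_int m" by (auto elim: Ints_cases)
          then have "t = ?r + of_int m" by simp
          with elim have "real_of_int \<lceil>\<beta> - ?r\<rceil> < of_int (m + 1)" "of_int m < \<beta> - ?r" by auto
          then have "\<lceil>\<beta> - ?r\<rceil> \<le> m" "of_int m < \<beta> - ?r" by linarith+
          then show False by (simp add: ceiling_le_iff)
        qed
        moreover have "\<beta> - ?r = of_int \<lfloor>\<beta> - ?r\<rfloor> \<longleftrightarrow> \<beta> - ?r \<in> \<int>"
          by (metis Ints_of_int Ints_cases floor_of_int)
        ultimately show ?case by (auto simp: jump_def ceiling_altdef)
      qed
      then show "((\<lambda>t. ?r + jump (t - ?r) (pi / 2)) \<longlongrightarrow> ?r + jump (\<beta> - ?r) (- pi / 2)) (at_left \<beta>)"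
        by (intro tendsto_add tendsto_const) (rule Lim_transform_eventually[OF tendsto_const])
    qed
    have "\<forall>\<^sub>F t in at_left \<beta>. t < \<beta>" by (rule eventually_at_leftI[of "\<beta> - 1"]) auto
    then show "\<forall>\<^sub>F t in at_left \<beta>. height t (pi / 2) \<le> s"
    proof eventually_elim
      case (elim t)
      then obtain t' where "t' \<in> A" "t < t'" unfolding \<beta>_def using less_cSup_iff[OF ne bdd] by blast
      then show ?case using height_strict_mono[OF _ P(1) P(1), of t t'] unfolding A_def by auto
    qed
  qed simp
  have lo: "s \<le> height \<beta> (pi / 2)"
  proof (rule tendsto_lowerbound)
    show "((\<lambda>t. height t (pi / 2)) \<longlongrightarrow> height \<beta> (pi / 2)) (at_right \<beta>)"
      unfolding height_def
    proof (rule dyadic_sum_tendsto)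
      have "\<forall>\<^sub>F t in at_right \<beta>. t \<in> {\<beta><..<\<beta> + 1}" by (rule eventually_at_rightI) auto
      then show "\<forall>\<^sub>F t in at_right \<beta>. \<forall>i. \<bar>nth_rat i + jump (t - nth_rat i) (pi / 2)\<bar> \<le> \<bar>\<beta>\<bar> + 1 + 1 / 2"
        by eventually_elim (intro allI height_term_bound P, auto)
      fix i
      let ?r = "nth_rat i"
      have "\<forall>\<^sub>F t in at_right \<beta>. t \<in> {\<beta><..<?r + of_int (\<lfloor>\<beta> - ?r\<rfloor> + 1)}"
        by (rule eventually_at_rightI) (auto, linarith)
      then have "\<forall>\<^sub>F t in at_right \<beta>. jump (\<beta> - ?r) (pi / 2) = jump (t - ?r) (pi / 2)"
      proof eventually_elim
        case (elim t)
        then have "\<lfloor>t - ?r\<rfloor> = \<lfloor>\<beta> - ?r\<rfloor>" by (intro floor_unique) (auto, linarith)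
        then show ?case by (auto simp: jump_def elim!: Ints_cases)
      qed
      then show "((\<lambda>t. ?r + jump (t - ?r) (pi / 2)) \<longlongrightarrow> ?r + jump (\<beta> - ?r) (pi / 2)) (at_right \<beta>)"
        by (intro tendsto_add tendsto_const) (rule Lim_transform_eventually[OF tendsto_const])
    qed
    have "\<forall>\<^sub>F t in at_right \<beta>. \<beta> < t" by (rule eventually_at_rightI[of _ "\<beta> + 1"]) auto
    then show "\<forall>\<^sub>F t in at_right \<beta>. s \<le> height t (pi / 2)"
    proof eventually_elim
      case (elim t)
      then have "t \<notin> A" unfolding \<beta>_def using cSup_upper[OF _ bdd] by fastforce
      then show ?case unfolding A_def by auto
    qed
  qed simp
  show ?thesis
  proof (cases "\<beta> \<in> \<rat>")
    case False
    then have "height \<beta> (pi / 2) = s" using up lo height_irrational[OF False, of "pi / 2" "- pi / 2"] by simp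
    then show ?thesis using P by blast
  next
    case True
    have "continuous_on {- pi / 2..pi / 2} (height \<beta>)"
      unfolding continuous_on_def
    proof
      fix \<theta> assume "\<theta> \<in> {- pi / 2..pi / 2}"
      show "(height \<beta> \<longlongrightarrow> height \<beta> \<theta>) (at \<theta> within {- pi / 2..pi / 2})"
        unfolding height_def
      proof (rule dyadic_sum_tendsto)
        show "\<forall>\<^sub>F t in at \<theta> within {- pi / 2..pi / 2}. \<forall>i. \<bar>nth_rat i + jump (\<beta> - nth_rat i) t\<bar> \<le> \<bar>\<beta>\<bar> + 1 / 2"
          unfolding eventually_at_filter
          by (intro always_eventually allI impI height_term_bound) auto
      qed (auto simp: jump_def intro!: tendsto_intros)
    qed
    then obtain \<theta> where "- pi / 2 \<le> \<theta>" "\<theta> \<le> pi / 2" "height \<beta> \<theta> = s"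
      using IVT'[of "height \<beta>" "- pi / 2" s "pi / 2"] up lo by auto
    then show ?thesis using True by (intro exI[of _ \<beta>] exI[of _ \<theta>]) auto
  qed
qed

section \<open>Slicewise convergence in the Chabauty space\<close>

lemma closed_subgroupsD:
  assumes "H \<in> closed_subgroups"
  shows "closed H" "0 \<in> H" "\<And>x y. x \<in> H \<Longrightarrow> y \<in> H \<Longrightarrow> x + y \<in> H" "\<And>x. x \<in> H \<Longrightarrow> - x \<in> H"
  using assms by (auto simp: closed_subgroups_def)

lemma openin_chabauty_hit:
  "open U \<Longrightarrow> openin chabauty_topology {H \<in> closed_subgroups. H \<inter> U \<noteq> {}}"
  unfolding chabauty_topology_def by (rule topology_generated_by_Basis) blast

lemma openin_chabauty_miss:
  "compact K \<Longrightarrow> openin chabauty_topology {H \<in> closed_subgroups. H \<inter> K = {}}"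
  unfolding chabauty_topology_def by (rule topology_generated_by_Basis) blast

lemma open_slice_neighbourhood:
  fixes U :: "(real \<times> int) set"
  assumes "open U" "(v, k) \<in> U"
  obtains \<epsilon> where "\<epsilon> > 0" "\<And>w. \<bar>w - v\<bar> < \<epsilon> \<Longrightarrow> (w, k) \<in> U"
proof -
  have "open ((\<lambda>w. (w, k)) -` U)"
    by (intro open_vimage assms continuous_intros)
  then obtain \<epsilon> where "\<epsilon> > 0" "ball v \<epsilon> \<subseteq> (\<lambda>w. (w, k)) -` U"
    using assms(2) unfolding open_contains_ball by blast
  then show ?thesis by (intro that[of \<epsilon>]) (auto simp: subset_iff dist_real_def abs_minus_commute)
qed

lemma open_slice_box: "open ({w::real. \<bar>w - v\<bar> < \<epsilon>} \<times> {k::int})"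
proof -
  have "{w::real. \<bar>w - v\<bar> < \<epsilon>} = ball v \<epsilon>" by (auto simp: dist_real_def)
  then show ?thesis by (simp add: open_Times open_discrete)
qed

lemma compact_slice_box: "compact ({w::real. \<bar>w - v\<bar> \<le> \<epsilon>} \<times> {k::int})"
proof -
  have "{w::real. \<bar>w - v\<bar> \<le> \<epsilon>} = cball v \<epsilon>" by (auto simp: dist_real_def)
  then show ?thesis by (simp add: compact_Times)
qed

text \<open>Chabauty convergence in \<open>\<real> \<times> \<int>\<close>, tested on the slices \<open>\<real> \<times> {k}\<close>: points of the limit are
  approached, and points outside it have a neighbourhood that is eventually avoided.  Since \<open>\<int>\<close> is
  discrete, only the real coordinate has to move.\<close>

definition slicewise_limit :: "('x \<Rightarrow> (real \<times> int) set) \<Rightarrow> 'x filter \<Rightarrow> (real \<times> int) set \<Rightarrow> bool" where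
  "slicewise_limit f F H \<longleftrightarrow>
     (\<forall>(v, k) \<in> H. \<forall>\<epsilon>>0. \<forall>\<^sub>F x in F. \<exists>w. \<bar>w - v\<bar> < \<epsilon> \<and> (w, k) \<in> f x) \<and>
     (\<forall>v k. (v, k) \<notin> H \<longrightarrow> (\<exists>\<epsilon>>0. \<forall>\<^sub>F x in F. \<forall>w. \<bar>w - v\<bar> < \<epsilon> \<longrightarrow> (w, k) \<notin> f x))"

lemma slicewise_limitI:
  assumes "\<And>v k \<epsilon>. (v, k) \<in> H \<Longrightarrow> \<epsilon> > 0 \<Longrightarrow> \<forall>\<^sub>F x in F. \<exists>w. \<bar>w - v\<bar> < \<epsilon> \<and> (w, k) \<in> f x"
    and "\<And>v k. (v, k) \<notin> H \<Longrightarrow> \<exists>\<epsilon>>0. \<forall>\<^sub>F x in F. \<forall>w. \<bar>w - v\<bar> < \<epsilon> \<longrightarrow> (w, k) \<notin> f x"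
  shows "slicewise_limit f F H"
  using assms unfolding slicewise_limit_def by blast

lemma slicewise_limitD1:
  assumes "slicewise_limit f F H" "(v, k) \<in> H" "\<epsilon> > 0"
  shows "\<forall>\<^sub>F x in F. \<exists>w. \<bar>w - v\<bar> < \<epsilon> \<and> (w, k) \<in> f x"
  using assms unfolding slicewise_limit_def by blast

lemma slicewise_limitD2:
  assumes "slicewise_limit f F H" "(v, k) \<notin> H"
  obtains \<epsilon> where "\<epsilon> > 0" "\<forall>\<^sub>F x in F. \<forall>w. \<bar>w - v\<bar> < \<epsilon> \<longrightarrow> (w, k) \<notin> f x"
  using assms unfolding slicewise_limit_def by blast

lemma slicewise_limit_compose:
  assumes "slicewise_limit f G H" "filterlim g G F"
  shows "slicewise_limit (\<lambda>x. f (g x)) F H"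
proof (rule slicewise_limitI)
  fix v k and \<epsilon> :: real
  assume "(v, k) \<in> H" "\<epsilon> > 0"
  from slicewise_limitD1[OF assms(1) this]
  show "\<forall>\<^sub>F x in F. \<exists>w. \<bar>w - v\<bar> < \<epsilon> \<and> (w, k) \<in> f (g x)"
    by (rule eventually_compose_filterlim[OF _ assms(2)])
next
  fix v k assume "(v, k) \<notin> H"
  then obtain \<epsilon> where "\<epsilon> > 0" "\<forall>\<^sub>F x in G. \<forall>w. \<bar>w - v\<bar> < \<epsilon> \<longrightarrow> (w, k) \<notin> f x"
    by (rule slicewise_limitD2[OF assms(1)])
  then show "\<exists>\<epsilon>>0. \<forall>\<^sub>F x in F. \<forall>w. \<bar>w - v\<bar> < \<epsilon> \<longrightarrow> (w, k) \<notin> f (g x)"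
    using eventually_compose_filterlim[OF _ assms(2)] by blast
qed

lemma slicewise_limit_cong:
  assumes "slicewise_limit f F H" "\<forall>\<^sub>F x in F. f x = g x"
  shows "slicewise_limit g F H"
proof (rule slicewise_limitI)
  fix v k and \<epsilon> :: real
  assume "(v, k) \<in> H" "\<epsilon> > 0"
  from slicewise_limitD1[OF assms(1) this] assms(2)
  show "\<forall>\<^sub>F x in F. \<exists>w. \<bar>w - v\<bar> < \<epsilon> \<and> (w, k) \<in> g x"
    by eventually_elim auto
next
  fix v k assume "(v, k) \<notin> H"
  then obtain \<epsilon> where \<epsilon>: "\<epsilon> > 0" "\<forall>\<^sub>F x in F. \<forall>w. \<bar>w - v\<bar> < \<epsilon> \<longrightarrow> (w, k) \<notin> f x"
    by (rule slicewise_limitD2[OF assms(1)])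
  from \<epsilon>(2) assms(2) have "\<forall>\<^sub>F x in F. \<forall>w. \<bar>w - v\<bar> < \<epsilon> \<longrightarrow> (w, k) \<notin> g x"
    by eventually_elim auto
  with \<epsilon>(1) show "\<exists>\<epsilon>>0. \<forall>\<^sub>F x in F. \<forall>w. \<bar>w - v\<bar> < \<epsilon> \<longrightarrow> (w, k) \<notin> g x" by blast
qed

text \<open>For a subbasic set defined by a compact set, finitely many of the avoided neighbourhoods cover
  it.\<close>

lemma continuous_map_chabauty_slicewise:
  fixes f :: "'x \<Rightarrow> (real \<times> int) set"
  assumes sub: "\<And>x. x \<in> topspace X \<Longrightarrow> f x \<in> closed_subgroups"
    and lim: "\<And>x. x \<in> topspace X \<Longrightarrow> slicewise_limit f (nhdsin X x) (f x)"
  shows "continuous_map X chabauty_topology f"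
  unfolding chabauty_topology_def
proof (rule continuous_on_generated_topo)
  have openI: "openin X (f -` A \<inter> topspace X)"
    if near: "\<And>x. x \<in> topspace X \<Longrightarrow> f x \<in> A \<Longrightarrow> \<forall>\<^sub>F y in nhdsin X x. y \<in> topspace X \<longrightarrow> f y \<in> A" for A
  proof (subst openin_subopen, intro ballI)
    fix x assume x: "x \<in> f -` A \<inter> topspace X"
    then obtain S where "openin X S" "x \<in> S" "\<forall>y\<in>S. y \<in> topspace X \<longrightarrow> f y \<in> A"
      using near[of x] by (auto simp: eventually_nhdsin)
    then show "\<exists>T. openin X T \<and> x \<in> T \<and> T \<subseteq> f -` A \<inter> topspace X"
      using openin_subset by (intro exI[of _ S]) blast
  qed
  fix A :: "(real \<times> int) set set"
  assume "A \<in> {{H \<in> closed_subgroups. H \<inter> K = {}} |K. compact K} \<union>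
    {{H \<in> closed_subgroups. H \<inter> U \<noteq> {}} |U. open U}"
  then consider (miss) K where "compact K" "A = {H \<in> closed_subgroups. H \<inter> K = {}}"
    | (hit) U where "open U" "A = {H \<in> closed_subgroups. H \<inter> U \<noteq> {}}" by blast
  then show "openin X (f -` A \<inter> topspace X)"
  proof cases
    case miss
    show ?thesis
    proof (rule openI)
      fix x assume x: "x \<in> topspace X" "f x \<in> A"
      have "\<exists>W. open W \<and> p \<in> W \<and> (\<forall>\<^sub>F y in nhdsin X x. f y \<inter> W = {})" if "p \<in> K" for p
      proof -
        obtain v k where p: "p = (v, k)" by (cases p)
        have "(v, k) \<notin> f x" using that x(2) p miss by auto
        then obtain \<epsilon> where \<epsilon>: "\<epsilon> > 0" "\<forall>\<^sub>F y in nhdsin X x. \<forall>w. \<bar>w - v\<bar> < \<epsilon> \<longrightarrow> (w, k) \<notin> f y"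
          by (rule slicewise_limitD2[OF lim[OF x(1)]])
        from \<epsilon>(2) have "\<forall>\<^sub>F y in nhdsin X x. f y \<inter> {w. \<bar>w - v\<bar> < \<epsilon>} \<times> {k} = {}"
          by eventually_elim auto
        then show ?thesis using open_slice_box[of v \<epsilon> k] \<epsilon>(1) p
          by (intro exI[of _ "{w. \<bar>w - v\<bar> < \<epsilon>} \<times> {k}"]) auto
      qed
      then obtain W where W: "\<And>p. p \<in> K \<Longrightarrow> open (W p)" "\<And>p. p \<in> K \<Longrightarrow> p \<in> W p"
        "\<And>p. p \<in> K \<Longrightarrow> \<forall>\<^sub>F y in nhdsin X x. f y \<inter> W p = {}" by metis
      obtain D where D: "D \<subseteq> K" "finite D" "K \<subseteq> (\<Union>p\<in>D. W p)"
        using compactE_image[OF miss(1), of K W] W(1,2) by blast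
      have "\<forall>\<^sub>F y in nhdsin X x. \<forall>p\<in>D. f y \<inter> W p = {}"
        using D(1,2) W(3) by (intro eventually_ball_finite) auto
      then show "\<forall>\<^sub>F y in nhdsin X x. y \<in> topspace X \<longrightarrow> f y \<in> A"
      proof eventually_elim
        case (elim y)
        then have "f y \<inter> K = {}" using D(3) by blast
        then show ?case using sub by (auto simp: miss)
      qed
    qed
  next
    case hit
    show ?thesis
    proof (rule openI)
      fix x assume x: "x \<in> topspace X" "f x \<in> A"
      then obtain v k where vk: "(v, k) \<in> f x" "(v, k) \<in> U" using hit by auto
      obtain \<epsilon> where \<epsilon>: "\<epsilon> > 0" "\<And>w. \<bar>w - v\<bar> < \<epsilon> \<Longrightarrow> (w, k) \<in> U"
        by (rule open_slice_neighbourhood[OF hit(1) vk(2)]) blast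
      from slicewise_limitD1[OF lim[OF x(1)] vk(1) \<epsilon>(1)]
      show "\<forall>\<^sub>F y in nhdsin X x. y \<in> topspace X \<longrightarrow> f y \<in> A"
      proof eventually_elim
        case (elim y)
        then show ?case using sub[of y] \<epsilon>(2) hit by auto
      qed
    qed
  qed
next
  have "closed_subgroups \<in> {{H \<in> closed_subgroups. H \<inter> K = {}} |K. compact K}"
    by (auto intro!: exI[of _ "{}"])
  then show "f ` topspace X \<subseteq> \<Union> ({{H \<in> closed_subgroups. H \<inter> K = {}} |K. compact K} \<union>
      {{H \<in> closed_subgroups. H \<inter> U \<noteq> {}} |U. open U})"
    using sub by (intro subsetI UnionI[of closed_subgroups]) auto
qed

lemma eventually_nhdsin_openin:
  "openin X S \<Longrightarrow> a \<in> S \<Longrightarrow> \<forall>\<^sub>F x in nhdsin X a. x \<in> S"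
  by (auto simp: eventually_nhdsin)

lemma slicewise_limit_id:
  assumes "H \<in> closed_subgroups"
  shows "slicewise_limit (\<lambda>H. H) (nhdsin chabauty_topology H) H"
proof (rule slicewise_limitI)
  fix v k and \<epsilon> :: real
  assume vk: "(v, k) \<in> H" "\<epsilon> > 0"
  let ?U = "{w. \<bar>w - v\<bar> < \<epsilon>} \<times> {k}"
  have "\<forall>\<^sub>F L in nhdsin chabauty_topology H. L \<in> {L \<in> closed_subgroups. L \<inter> ?U \<noteq> {}}"
    using vk assms by (intro eventually_nhdsin_openin openin_chabauty_hit open_slice_box) auto
  then show "\<forall>\<^sub>F L in nhdsin chabauty_topology H. \<exists>w. \<bar>w - v\<bar> < \<epsilon> \<and> (w, k) \<in> L"
    by eventually_elim auto
next
  fix v k assume "(v, k) \<notin> H"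
  moreover have "open (- H)" using closed_subgroupsD(1)[OF assms] by (simp add: open_Compl)
  ultimately obtain \<epsilon> where \<epsilon>: "\<epsilon> > 0" "\<And>w. \<bar>w - v\<bar> < \<epsilon> \<Longrightarrow> (w, k) \<notin> H"
    by (metis open_slice_neighbourhood ComplI Compl_iff)
  let ?K = "{w. \<bar>w - v\<bar> \<le> \<epsilon> / 2} \<times> {k}"
  have "\<forall>\<^sub>F L in nhdsin chabauty_topology H. L \<in> {L \<in> closed_subgroups. L \<inter> ?K = {}}"
    using \<epsilon> assms by (intro eventually_nhdsin_openin openin_chabauty_miss compact_slice_box) auto
  then have "\<forall>\<^sub>F L in nhdsin chabauty_topology H. \<forall>w. \<bar>w - v\<bar> < \<epsilon> / 2 \<longrightarrow> (w, k) \<notin> L"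
    by eventually_elim force
  then show "\<exists>\<epsilon>>0. \<forall>\<^sub>F L in nhdsin chabauty_topology H. \<forall>w. \<bar>w - v\<bar> < \<epsilon> \<longrightarrow> (w, k) \<notin> L"
    using \<epsilon>(1) by (intro exI[of _ "\<epsilon> / 2"]) auto
qed

text \<open>A point of one subgroup outside another has a compact neighbourhood missing the second
  subgroup.\<close>

lemma Hausdorff_chabauty: "Hausdorff_space (chabauty_topology :: (real \<times> int) set topology)"
proof -
  have sep: "\<exists>A B. openin chabauty_topology A \<and> openin chabauty_topology B \<and> H \<in> A \<and> L \<in> B \<and> disjnt A B"
    if HL: "H \<in> closed_subgroups" "L \<in> closed_subgroups" "p \<in> H" "p \<notin> L"
    for H L :: "(real \<times> int) set" and p
  proof -
    obtain v k where p: "p = (v, k)" by (cases p)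
    have "open (- L)" "(v, k) \<in> - L" using closed_subgroupsD(1)[OF HL(2)] HL(4) p by (auto simp: open_Compl)
    then obtain \<epsilon> where \<epsilon>: "\<epsilon> > 0" "\<And>w. \<bar>w - v\<bar> < \<epsilon> \<Longrightarrow> (w, k) \<in> - L"
      by (rule open_slice_neighbourhood) blast
    let ?U = "{w. \<bar>w - v\<bar> < \<epsilon> / 2} \<times> {k}" and ?K = "{w. \<bar>w - v\<bar> \<le> \<epsilon> / 2} \<times> {k}"
    have "openin chabauty_topology {H \<in> closed_subgroups. H \<inter> ?U \<noteq> {}}"
      "openin chabauty_topology {H \<in> closed_subgroups. H \<inter> ?K = {}}"
      by (intro openin_chabauty_hit openin_chabauty_miss open_slice_box compact_slice_box)+
    moreover have "H \<in> {H \<in> closed_subgroups. H \<inter> ?U \<noteq> {}}" using HL p \<epsilon>(1) by auto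
    moreover have "L \<in> {H \<in> closed_subgroups. H \<inter> ?K = {}}" using HL \<epsilon> by auto
    moreover have "disjnt {H \<in> closed_subgroups. H \<inter> ?U \<noteq> {}} {H \<in> closed_subgroups. H \<inter> ?K = {}}"
      by (auto simp: disjnt_def)
    ultimately show ?thesis by blast
  qed
  show ?thesis
    unfolding Hausdorff_space_def topspace_chabauty_topology
  proof (intro allI impI)
    fix H L :: "(real \<times> int) set"
    assume *: "H \<in> closed_subgroups \<and> L \<in> closed_subgroups \<and> H \<noteq> L"
    then consider p where "p \<in> H" "p \<notin> L" | p where "p \<in> L" "p \<notin> H" by blast
    then show "\<exists>U V. openin chabauty_topology U \<and> openin chabauty_topology V \<and> H \<in> U \<and> L \<in> V \<and> disjnt U V"
    proof cases
      case 1
      then show ?thesis using sep * by blast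
    next
      case (2 p)
      then show ?thesis using sep[of L H p] * disjnt_sym by blast
    qed
  qed
qed

section \<open>Cyclic subgroups and the Hawaiian earring\<close>

lemma closed_slicewise:
  fixes H :: "(real \<times> int) set"
  assumes "\<And>k. closed {v. (v, k) \<in> H}"
  shows "closed H"
proof -
  have "- H = (\<Union>k. (- {v. (v, k) \<in> H}) \<times> {k})" by auto
  moreover have "open \<dots>"
    using assms by (intro open_UN ballI open_Times open_Compl open_discrete) auto
  ultimately show ?thesis by (simp add: closed_def)
qed

lemma closed_slice: "closed (H :: (real \<times> int) set) \<Longrightarrow> closed {v. (v, k) \<in> H}"
proof -
  assume "closed H"
  then have "closed ((\<lambda>v. (v, k)) -` H)" by (intro closed_vimage continuous_intros)
  then show ?thesis by (simp add: vimage_def)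
qed

definition cyclic_subgroup :: "real \<Rightarrow> int \<Rightarrow> (real \<times> int) set" where
  "cyclic_subgroup x m = range (\<lambda>l. (of_int l * x, l * m))"

lemma mem_cyclic_subgroup: "(v, k) \<in> cyclic_subgroup x m \<longleftrightarrow> (\<exists>l. v = of_int l * x \<and> k = l * m)"
  by (auto simp: cyclic_subgroup_def)

lemma cyclic_subgroup_trivial: "cyclic_subgroup 0 0 = {0}"
  by (auto simp: cyclic_subgroup_def zero_prod_def)

lemma cyclic_subgroup_closed:
  assumes "m \<noteq> 0 \<or> x = 0"
  shows "cyclic_subgroup x m \<in> closed_subgroups"
  unfolding closed_subgroups_def
proof (intro CollectI conjI ballI)
  show "closed (cyclic_subgroup x m)"
  proof (rule closed_slicewise)
    fix k
    have "{v. (v, k) \<in> cyclic_subgroup x m} \<subseteq> {of_int (k div m) * x}"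
      using assms by (auto simp: mem_cyclic_subgroup)
    then show "closed {v. (v, k) \<in> cyclic_subgroup x m}"
      using finite_subset finite_imp_closed by blast
  qed
  show "0 \<in> cyclic_subgroup x m"
    by (auto simp: cyclic_subgroup_def zero_prod_def intro!: image_eqI[of _ _ 0])
  show "p + q \<in> cyclic_subgroup x m" if pq: "p \<in> cyclic_subgroup x m" "q \<in> cyclic_subgroup x m" for p q
  proof -
    obtain i j where "p = (of_int i * x, i * m)" "q = (of_int j * x, j * m)"
      using pq by (auto simp: cyclic_subgroup_def)
    then show ?thesis
      by (auto simp: cyclic_subgroup_def algebra_simps intro!: image_eqI[of _ _ "i + j"])
  qed
  show "- p \<in> cyclic_subgroup x m" if p: "p \<in> cyclic_subgroup x m" for p
  proof -
    obtain i where "p = (of_int i * x, i * m)" using p by (auto simp: cyclic_subgroup_def)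
    then show ?thesis by (auto simp: cyclic_subgroup_def intro!: image_eqI[of _ _ "- i"])
  qed
qed

lemma cyclic_subgroup_eqD:
  assumes "cyclic_subgroup x m = cyclic_subgroup y n" "m > 0" "n > 0"
  shows "m = n" "x = y"
proof -
  have "(x, m) \<in> cyclic_subgroup x m" "(y, n) \<in> cyclic_subgroup y n"
    by (auto simp: mem_cyclic_subgroup intro: exI[of _ 1])
  then have "(x, m) \<in> cyclic_subgroup y n" "(y, n) \<in> cyclic_subgroup x m" using assms(1) by auto
  then have "\<exists>i. x = of_int i * y \<and> m = i * n" "\<exists>j. n = j * m"
    unfolding mem_cyclic_subgroup by blast+
  then obtain i j where i: "x = of_int i * y" "m = i * n" and j: "n = j * m" by blast
  have "m dvd n" by (subst j) simp
  moreover have "n dvd m" by (subst i(2)) simp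
  ultimately show "m = n" using assms(2,3) by (intro zdvd_antisym_nonneg) simp_all
  with i assms show "x = y" by simp
qed

lemma slicewise_limit_cyclic_subgroup:
  assumes "(f \<longlongrightarrow> x) F" "m \<noteq> 0"
  shows "slicewise_limit (\<lambda>z. cyclic_subgroup (f z) m) F (cyclic_subgroup x m)"
proof -
  have lim: "\<forall>\<^sub>F z in F. \<bar>of_int l * f z - of_int l * x\<bar> < \<epsilon>" if "\<epsilon> > 0" for l \<epsilon>
    using tendstoD[OF tendsto_mult[OF tendsto_const assms(1)] that] by (simp add: dist_real_def)
  show ?thesis
  proof (rule slicewise_limitI)
    fix v k and \<epsilon> :: real
    assume "(v, k) \<in> cyclic_subgroup x m" and \<epsilon>: "\<epsilon> > 0"
    then obtain l where l: "v = of_int l * x" "k = l * m" by (auto simp: mem_cyclic_subgroup)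
    show "\<forall>\<^sub>F z in F. \<exists>w. \<bar>w - v\<bar> < \<epsilon> \<and> (w, k) \<in> cyclic_subgroup (f z) m"
      using lim[OF \<epsilon>, of l] by eventually_elim (use l in \<open>auto simp: mem_cyclic_subgroup\<close>)
  next
    fix v k assume vk: "(v, k) \<notin> cyclic_subgroup x m"
    show "\<exists>\<epsilon>>0. \<forall>\<^sub>F z in F. \<forall>w. \<bar>w - v\<bar> < \<epsilon> \<longrightarrow> (w, k) \<notin> cyclic_subgroup (f z) m"
    proof (cases "m dvd k")
      case False
      then have "(w, k) \<notin> cyclic_subgroup y m" for w y by (auto simp: mem_cyclic_subgroup)
      then show ?thesis by (intro exI[of _ 1]) auto
    next
      case True
      then obtain l where l: "k = l * m" by (metis dvdE mult.commute)
      then have "v \<noteq> of_int l * x" using vk by (auto simp: mem_cyclic_subgroup)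
      then have \<epsilon>: "\<bar>v - of_int l * x\<bar> / 2 > 0" by simp
      have "\<forall>\<^sub>F z in F. \<forall>w. \<bar>w - v\<bar> < \<bar>v - of_int l * x\<bar> / 2 \<longrightarrow> (w, k) \<notin> cyclic_subgroup (f z) m"
        using lim[OF \<epsilon>, of l]
      proof eventually_elim
        case (elim z)
        show ?case
        proof (intro allI impI notI)
          fix w assume w: "\<bar>w - v\<bar> < \<bar>v - of_int l * x\<bar> / 2" "(w, k) \<in> cyclic_subgroup (f z) m"
          then have "w = of_int l * f z" using l assms(2) by (auto simp: mem_cyclic_subgroup)
          moreover define u where "u = of_int l * x"
          ultimately have "dist w u < dist v u / 2" "dist v w < dist v u / 2"
            using elim w(1) by (auto simp: dist_real_def abs_minus_commute)
          then show False using dist_triangle[of v u w] by simp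
        qed
      qed
      then show ?thesis using \<epsilon> by blast
    qed
  qed
qed

text \<open>For \<open>z = (1 + e^(2i\<theta>)) / m = (2 cos \<theta> / m) e^(i\<theta>)\<close> the two parameters are \<open>tan \<theta>\<close> and \<open>m\<close>, so
  this is the group generated by \<open>(tan \<theta>, m)\<close>.  At \<open>z = 0\<close> both quotients have the default value 0,
  which gives the trivial group.\<close>

definition earring_subgroup :: "complex \<Rightarrow> (real \<times> int) set" where
  "earring_subgroup z = cyclic_subgroup (Im z / Re z) \<lfloor>2 * Re z / (cmod z)\<^sup>2\<rfloor>"

lemma Re_Im_earring_point:
  "Re (earring_point m \<theta>) = 2 * (cos \<theta>)\<^sup>2 / m" "Im (earring_point m \<theta>) = 2 * sin \<theta> * cos \<theta> / m"
proof -
  have "exp (2 * \<i> * complex_of_real \<theta>) = cis (2 * \<theta>)"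
    by (simp add: cis_conv_exp mult_ac)
  then have e: "earring_point m \<theta> = (1 + cis (2 * \<theta>)) / of_real (real m)" 
    by (simp add: earring_point_def)
  show "Re (earring_point m \<theta>) = 2 * (cos \<theta>)\<^sup>2 / m"
    unfolding e Re_divide_of_real using cos_double_cos[of \<theta>] by simp
  show "Im (earring_point m \<theta>) = 2 * sin \<theta> * cos \<theta> / m"
    unfolding e Im_divide_of_real using sin_double[of \<theta>] by simp
qed

lemma norm_earring_point: "(cmod (earring_point m \<theta>))\<^sup>2 = 4 * (cos \<theta>)\<^sup>2 / (real m)\<^sup>2"
proof -
  have "(2 * (cos \<theta>)\<^sup>2)\<^sup>2 + (2 * sin \<theta> * cos \<theta>)\<^sup>2 = 4 * (cos \<theta>)\<^sup>2 * ((sin \<theta>)\<^sup>2 + (cos \<theta>)\<^sup>2)"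
    by algebra
  then have "(2 * (cos \<theta>)\<^sup>2)\<^sup>2 + (2 * sin \<theta> * cos \<theta>)\<^sup>2 = 4 * (cos \<theta>)\<^sup>2"
    by (simp only: sin_cos_squared_add mult_1_right)
  then show ?thesis
    by (simp only: cmod_power2 Re_Im_earring_point power_divide add_divide_distrib[symmetric])
qed

lemma earring_point_end: "cos \<theta> = 0 \<Longrightarrow> earring_point m \<theta> = 0"
  by (simp add: complex_eq_iff Re_Im_earring_point)

lemma earring_point_in: "m > 0 \<Longrightarrow> earring_point m \<theta> \<in> hawaiian_earring"
proof -
  assume m: "m > 0"
  have "earring_point m \<theta> - 1 / of_nat m = (1 / of_nat m) * exp (\<i> * complex_of_real (2 * \<theta>))"
    by (simp add: earring_point_def algebra_simps)
  then have "norm (earring_point m \<theta> - 1 / of_nat m) = 1 / real m"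
    using norm_exp_i_times[of "2 * \<theta>"] by (simp add: norm_mult norm_divide)
  then show ?thesis using m
    by (auto simp: hawaiian_earring_def dist_norm norm_minus_commute intro!: bexI[of _ m])
qed

lemma zero_in_earring: "0 \<in> hawaiian_earring"
  using earring_point_in[of 1 "pi / 2"] by (simp add: earring_point_end)

text \<open>The equation of the circle says \<open>|z|\<^sup>2 = 2 Re z / m\<close>; hence \<open>Re z > 0\<close> off the origin, and the
  angle is the argument of \<open>z\<close>.\<close>

lemma earring_cases:
  assumes "z \<in> hawaiian_earring"
  obtains "z = 0" | m \<theta> where "m > 0" "- pi / 2 < \<theta>" "\<theta> < pi / 2" "z = earring_point m \<theta>"
proof (cases "z = 0")
  case False
  obtain m where m: "m \<ge> 1" "dist (1 / of_nat m) z = 1 / real m"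
    using assms by (auto simp: hawaiian_earring_def)
  define R where "R = Re z"
  define I where "I = Im z"
  have "(cmod (z - 1 / of_nat m))\<^sup>2 = (1 / real m)\<^sup>2"
    using m by (simp add: dist_norm norm_minus_commute)
  then have "(R - 1 / real m)\<^sup>2 + I\<^sup>2 = (1 / real m)\<^sup>2"
    by (simp add: cmod_power2 R_def I_def Re_divide_of_nat Im_divide_of_nat)
  then have eq: "R\<^sup>2 + I\<^sup>2 = 2 * R / real m"
    by (simp add: power2_diff)
  have "R\<^sup>2 + I\<^sup>2 > 0" using False by (auto simp: R_def I_def complex_eq_iff sum_power2_gt_zero_iff)
  then have R: "R > 0" using m by (simp add: eq zero_less_divide_iff)
  define t where "t = I / R"
  have "1 + t\<^sup>2 = (R\<^sup>2 + I\<^sup>2) / R\<^sup>2"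
    using R by (simp add: t_def add_divide_distrib power_divide)
  also have "\<dots> = 2 / (real m * R)" unfolding eq using R by (simp add: power2_eq_square)
  finally have t: "1 + t\<^sup>2 = 2 / (real m * R)" .
  have c: "cos (arctan t) \<noteq> 0" by (rule cos_arctan_not_zero)
  have "(cos (arctan t))\<^sup>2 = inverse (1 + t\<^sup>2)"
    using tan_sec[OF c] c by (simp add: tan_arctan power_inverse)
  then have c2: "(cos (arctan t))\<^sup>2 = real m * R / 2" unfolding t by simp
  have "sin (arctan t) = t * cos (arctan t)"
    using tan_arctan[of t] c by (simp add: tan_def field_simps)
  then have "2 * sin (arctan t) * cos (arctan t) / m = t * (2 * (cos (arctan t))\<^sup>2 / m)"
    by (simp add: power2_eq_square)
  moreover have re: "2 * (cos (arctan t))\<^sup>2 / m = R" using m by (simp add: c2)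
  ultimately have "2 * sin (arctan t) * cos (arctan t) / m = t * R" by (simp only:)
  also have "\<dots> = I" using R by (simp add: t_def)
  finally have "2 * sin (arctan t) * cos (arctan t) / m = I" .
  then have "z = earring_point m (arctan t)"
    using re by (simp add: complex_eq_iff Re_Im_earring_point R_def I_def)
  then show ?thesis using that(2)[of m "arctan t"] arctan_bounded[of t] m by auto
qed (use that in blast)

lemma earring_subgroup_zero: "earring_subgroup 0 = {0}"
  by (simp add: earring_subgroup_def cyclic_subgroup_trivial)

lemma earring_point_invariants:
  assumes "m > 0" "cos \<theta> \<noteq> 0"
  shows "Im (earring_point m \<theta>) / Re (earring_point m \<theta>) = tan \<theta>"
    "2 * Re (earring_point m \<theta>) / (cmod (earring_point m \<theta>))\<^sup>2 = real m"
    "earring_point m \<theta> \<noteq> 0"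
proof -
  show "Im (earring_point m \<theta>) / Re (earring_point m \<theta>) = tan \<theta>"
    using assms by (simp add: Re_Im_earring_point tan_def power2_eq_square)
  show "2 * Re (earring_point m \<theta>) / (cmod (earring_point m \<theta>))\<^sup>2 = real m"
    using assms unfolding norm_earring_point Re_Im_earring_point by (simp add: power2_eq_square)
  show "earring_point m \<theta> \<noteq> 0"
    using assms by (simp add: complex_eq_iff Re_Im_earring_point)
qed

lemma earring_subgroup_point:
  assumes "m > 0" "cos \<theta> \<noteq> 0"
  shows "earring_subgroup (earring_point m \<theta>) = cyclic_subgroup (tan \<theta>) (int m)"
  unfolding earring_subgroup_def earring_point_invariants[OF assms] by simp

lemma earring_subgroup_closed:
  assumes "z \<in> hawaiian_earring"
  shows "earring_subgroup z \<in> closed_subgroups"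
  using assms
proof (cases rule: earring_cases)
  case 1
  then show ?thesis using cyclic_subgroup_closed[of 0 0]
    by (simp add: earring_subgroup_zero cyclic_subgroup_trivial)
next
  case (2 m \<theta>)
  then have "cos \<theta> > 0" using cos_gt_zero_pi by auto
  then show ?thesis using 2 earring_subgroup_point[of m \<theta>] cyclic_subgroup_closed by simp
qed

lemma earring_subgroup_inj: "inj_on earring_subgroup hawaiian_earring"
proof (rule inj_onI)
  have aux: "earring_subgroup 0 \<noteq> earring_subgroup (earring_point m \<theta>)" if "m > 0" "cos \<theta> \<noteq> 0" for m \<theta>
  proof -
    have "(tan \<theta>, int m) \<in> earring_subgroup (earring_point m \<theta>)"
      unfolding earring_subgroup_point[OF that] by (auto simp: mem_cyclic_subgroup intro: exI[of _ 1])
    moreover have "(tan \<theta>, int m) \<notin> {0}" using that by (simp add: zero_prod_def)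
    ultimately show ?thesis by (auto simp: earring_subgroup_zero)
  qed
  fix z w assume zw: "z \<in> hawaiian_earring" "w \<in> hawaiian_earring" "earring_subgroup z = earring_subgroup w"
  have pos: "cos \<theta> \<noteq> 0" if "- pi / 2 < \<theta>" "\<theta> < pi / 2" for \<theta>
    using cos_gt_zero_pi[of \<theta>] that by auto
  from zw(1) show "z = w"
  proof (cases rule: earring_cases)
    case 1
    from zw(2) show ?thesis
      by (cases rule: earring_cases) (use 1 zw(3) aux pos in auto)
  next
    case z: (2 m \<theta>)
    from zw(2) show ?thesis
    proof (cases rule: earring_cases)
      case 1
      then show ?thesis using z zw(3) aux pos by metis
    next
      case w: (2 n \<phi>)
      have "cyclic_subgroup (tan \<theta>) (int m) = cyclic_subgroup (tan \<phi>) (int n)"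
        using zw(3) earring_subgroup_point z w pos by metis
      from cyclic_subgroup_eqD[OF this] have eq: "m = n" "tan \<theta> = tan \<phi>"
        using z(1) w(1) by simp_all
      have "arctan (tan \<theta>) = \<theta>" "arctan (tan \<phi>) = \<phi>"
        using z(2,3) w(2,3) by (intro arctan_tan; simp)+
      then have "\<theta> = \<phi>" using eq(2) by metis
      then show ?thesis using z(4) w(4) eq(1) by simp
    qed
  qed
qed

lemma nhdsin_top_of_set:
  assumes "a \<in> S"
  shows "nhdsin (top_of_set S) a = inf (nhds a) (principal S)"
proof (rule filter_eqI)
  fix P
  show "eventually P (nhdsin (top_of_set S) a) \<longleftrightarrow> eventually P (inf (nhds a) (principal S))"
  proof
    assume "eventually P (nhdsin (top_of_set S) a)"
    then obtain T where "open T" "a \<in> T" "\<forall>x\<in>S \<inter> T. P x"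
      using assms by (auto simp: eventually_nhdsin openin_open)
    then show "eventually P (inf (nhds a) (principal S))"
      unfolding eventually_inf_principal eventually_nhds by blast
  next
    assume "eventually P (inf (nhds a) (principal S))"
    then obtain T where "open T" "a \<in> T" "\<forall>x\<in>T. x \<in> S \<longrightarrow> P x"
      unfolding eventually_inf_principal eventually_nhds by blast
    then show "eventually P (nhdsin (top_of_set S) a)"
      using assms unfolding eventually_nhdsin openin_open
      by (intro disjI2 exI[of _ "S \<inter> T"]) auto
  qed
qed

text \<open>Away from 0 the integer \<open>2 Re z / |z|\<^sup>2\<close> is continuous on the earring, hence locally constant,
  and the generator moves continuously.  Near 0 the identity \<open>|z|\<^sup>2 m\<^sup>2 (1 + tan\<^sup>2 \<theta>) = 4\<close> shows that
  the generator, and with it every nonzero element, leaves each bounded set.\<close>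

lemma continuous_map_earring_subgroup:
  "continuous_map (top_of_set hawaiian_earring) chabauty_topology earring_subgroup"
proof (rule continuous_map_chabauty_slicewise)
  fix z assume "z \<in> topspace (top_of_set hawaiian_earring)"
  then have z: "z \<in> hawaiian_earring" by simp
  then show "earring_subgroup z \<in> closed_subgroups" by (rule earring_subgroup_closed)
  let ?F = "inf (nhds z) (principal hawaiian_earring)"
  have ident: "((\<lambda>x. x) \<longlongrightarrow> z) ?F" by (simp add: filterlim_def le_infI1)
  have inA: "\<forall>\<^sub>F x in ?F. x \<in> hawaiian_earring" by (simp add: eventually_inf_principal)
  have pos: "cos \<theta> > 0" if "- pi / 2 < \<theta>" "\<theta> < pi / 2" for \<theta>
    using cos_gt_zero_pi[of \<theta>] that by auto
  have "slicewise_limit earring_subgroup ?F (earring_subgroup z)"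
    using z
  proof (cases rule: earring_cases)
    case (2 m \<theta>)
    have c: "cos \<theta> \<noteq> 0" using pos[of \<theta>] 2 by simp
    note inv = earring_point_invariants[OF 2(1) c, folded 2(4)]
    have Re: "Re z \<noteq> 0" using 2 c by (simp add: Re_Im_earring_point)
    have "((\<lambda>x. 2 * Re x / (cmod x)\<^sup>2) \<longlongrightarrow> 2 * Re z / (cmod z)\<^sup>2) ?F"
      using inv(3) by (intro tendsto_intros ident) auto
    then have "\<forall>\<^sub>F x in ?F. dist (2 * Re x / (cmod x)\<^sup>2) m < 1"
      unfolding inv(2) by (rule tendstoD) simp
    moreover have "\<forall>\<^sub>F x in ?F. x \<noteq> 0"
      using ident inv(3) by (rule tendsto_imp_eventually_ne)
    ultimately have "\<forall>\<^sub>F x in ?F. cyclic_subgroup (Im x / Re x) (int m) = earring_subgroup x"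
      using inA
    proof eventually_elim
      case (elim x)
      from elim(3) obtain m' \<theta>' where x: "m' > 0" "- pi / 2 < \<theta>'" "\<theta>' < pi / 2" "x = earring_point m' \<theta>'"
        by (cases rule: earring_cases) (use elim(2) in auto)
      have "2 * Re x / (cmod x)\<^sup>2 = real m'" unfolding x(4)
        by (rule earring_point_invariants) (use x pos[of \<theta>'] in auto)
      with elim(1) have "\<lfloor>2 * Re x / (cmod x)\<^sup>2\<rfloor> = int m" by (simp add: dist_real_def)
      then show ?case by (simp add: earring_subgroup_def)
    qed
    moreover have "slicewise_limit (\<lambda>x. cyclic_subgroup (Im x / Re x) (int m)) ?F
        (cyclic_subgroup (Im z / Re z) (int m))"
      using Re 2(1) by (intro slicewise_limit_cyclic_subgroup tendsto_intros ident) auto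
    ultimately show ?thesis
      using slicewise_limit_cong inv(2) by (fastforce simp: earring_subgroup_def)
  next
    case 1
    have J0: "earring_subgroup z = {(0, 0)}" by (simp add: 1 earring_subgroup_zero zero_prod_def)
    show ?thesis unfolding J0
    proof (rule slicewise_limitI)
      fix v k and \<epsilon> :: real
      assume "(v, k) \<in> {(0::real, 0::int)}" "\<epsilon> > 0"
      then show "\<forall>\<^sub>F x in ?F. \<exists>w. \<bar>w - v\<bar> < \<epsilon> \<and> (w, k) \<in> earring_subgroup x"
        by (intro always_eventually allI exI[of _ 0])
          (auto simp: earring_subgroup_def mem_cyclic_subgroup intro: exI[of _ 0])
    next
      fix v :: real and k :: int assume vk: "(v, k) \<notin> {(0, 0)}"
      define C where "C = (real_of_int k)\<^sup>2 * (1 + (\<bar>v\<bar> + 1)\<^sup>2)"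
      have mem: "(k = 0 \<and> w = 0) \<or> (k \<noteq> 0 \<and> 4 \<le> (cmod x)\<^sup>2 * ((real_of_int k)\<^sup>2 * (1 + w\<^sup>2)))"
        if x: "x \<in> hawaiian_earring" "(w, k) \<in> earring_subgroup x" for x w
        using x(1)
      proof (cases rule: earring_cases)
        case 1
        then show ?thesis using x(2) by (simp add: earring_subgroup_zero zero_prod_def)
      next
        case (2 m \<theta>)
        have c: "cos \<theta> > 0" using pos 2 by simp
        obtain l where l: "w = of_int l * tan \<theta>" "k = l * int m"
          using x(2) 2 c earring_subgroup_point[of m \<theta>] by (auto simp: mem_cyclic_subgroup)
        show ?thesis
        proof (cases "l = 0")
          case True
          then show ?thesis using l by simp
        next
          case False
          then have l2: "1 \<le> (real_of_int l)\<^sup>2"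
            using abs_le_square_iff[of 1 "real_of_int l"] by simp linarith
          have "(real m)\<^sup>2 * (1 + (tan \<theta>)\<^sup>2) \<le> (real_of_int k)\<^sup>2 * (1 + w\<^sup>2)"
          proof (rule mult_mono)
            show "(real m)\<^sup>2 \<le> (real_of_int k)\<^sup>2" 
              using mult_right_mono[OF l2, of "(real m)\<^sup>2"] by (simp add: l(2) power_mult_distrib)
            show "1 + (tan \<theta>)\<^sup>2 \<le> 1 + w\<^sup>2"
              using mult_right_mono[OF l2, of "(tan \<theta>)\<^sup>2"] by (simp add: l(1) power_mult_distrib)
          qed auto
          then have "(cmod x)\<^sup>2 * ((real m)\<^sup>2 * (1 + (tan \<theta>)\<^sup>2)) \<le> (cmod x)\<^sup>2 * ((real_of_int k)\<^sup>2 * (1 + w\<^sup>2))"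
            by (intro mult_left_mono) auto
          moreover have "(cmod x)\<^sup>2 * ((real m)\<^sup>2 * (1 + (tan \<theta>)\<^sup>2)) = 4"
            using 2(1) c tan_sec[of \<theta>] unfolding 2(4) norm_earring_point
            by (simp add: power_inverse)
          ultimately show ?thesis using False l 2(1) by simp
        qed
      qed
      show "\<exists>\<epsilon>>0. \<forall>\<^sub>F x in ?F. \<forall>w. \<bar>w - v\<bar> < \<epsilon> \<longrightarrow> (w, k) \<notin> earring_subgroup x"
      proof (cases "k = 0")
        case True
        then have "v \<noteq> 0" using vk by simp
        moreover have "\<forall>\<^sub>F x in ?F. \<forall>w. \<bar>w - v\<bar> < \<bar>v\<bar> \<longrightarrow> (w, k) \<notin> earring_subgroup x"
          using inA by eventually_elim (use mem True in fastforce)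
        ultimately show ?thesis by (intro exI[of _ "\<bar>v\<bar>"]) auto
      next
        case False
        have "((\<lambda>x. (cmod x)\<^sup>2 * C) \<longlongrightarrow> (cmod z)\<^sup>2 * C) ?F" by (intro tendsto_intros ident)
        then have "\<forall>\<^sub>F x in ?F. (cmod x)\<^sup>2 * C < 4" using 1 by (intro order_tendstoD(2)) auto
        with inA have "\<forall>\<^sub>F x in ?F. \<forall>w. \<bar>w - v\<bar> < 1 \<longrightarrow> (w, k) \<notin> earring_subgroup x"
        proof eventually_elim
          case (elim x)
          show ?case
          proof (intro allI impI notI)
            fix w assume w: "\<bar>w - v\<bar> < 1" "(w, k) \<in> earring_subgroup x"
            have "w\<^sup>2 \<le> (\<bar>v\<bar> + 1)\<^sup>2" using w(1) by (intro power2_le_iff_abs_le[THEN iffD2]) auto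
            then have "(cmod x)\<^sup>2 * ((real_of_int k)\<^sup>2 * (1 + w\<^sup>2)) \<le> (cmod x)\<^sup>2 * C"
              unfolding C_def by (intro mult_left_mono) auto
            then show False using mem[OF elim(1) w(2)] False elim(2) by linarith
          qed
        qed
        then show ?thesis by (intro exI[of _ 1]) auto
      qed
    qed
  qed
  then show "slicewise_limit earring_subgroup (nhdsin (top_of_set hawaiian_earring) z) (earring_subgroup z)"
    by (simp add: nhdsin_top_of_set[OF z])
qed

text \<open>Off the origin the earring is cut out by \<open>2 Re z / |z|\<^sup>2\<close> being a positive integer, which is a
  closed condition.\<close>

lemma compact_hawaiian_earring: "compact hawaiian_earring"
proof -
  have A: "hawaiian_earring = {z. z = 0 \<or> 2 * Re z / (cmod z)\<^sup>2 \<in> \<int> \<and> 1 \<le> 2 * Re z / (cmod z)\<^sup>2}"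
    (is "_ = ?B")
  proof (intro set_eqI iffI)
    fix z assume "z \<in> hawaiian_earring"
    then show "z \<in> ?B"
    proof (cases rule: earring_cases)
      case (2 m \<theta>)
      then have "cos \<theta> \<noteq> 0" using cos_gt_zero_pi[of \<theta>] by auto
      then have "2 * Re z / (cmod z)\<^sup>2 = real m" using earring_point_invariants(2)[of m \<theta>] 2 by simp
      then show ?thesis using 2(1) by simp
    qed simp
  next
    fix z assume z: "z \<in> ?B"
    show "z \<in> hawaiian_earring"
    proof (cases "z = 0")
      case False
      then obtain i where i: "2 * Re z / (cmod z)\<^sup>2 = of_int i" "i \<ge> 1"
      proof -
        obtain i where "2 * Re z / (cmod z)\<^sup>2 = of_int i"
          using z False by (auto simp del: times_divide_eq_left elim: Ints_cases)
        moreover from this have "i \<ge> 1" using z False by simp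
        ultimately show ?thesis using that by blast
      qed
      define m where "m = nat i"
      have m: "2 * Re z / (cmod z)\<^sup>2 = real m" "m \<ge> 1" using i by (auto simp: m_def)
      then have "2 * Re z / real m = (cmod z)\<^sup>2" using False by (simp add: field_simps)
      then have "(cmod (z - 1 / of_nat m))\<^sup>2 = (1 / real m)\<^sup>2"
        by (simp add: cmod_power2 Re_divide_of_nat Im_divide_of_nat power2_diff)
      then have "cmod (z - 1 / of_nat m) = 1 / real m"
        by (rule power2_eq_imp_eq) auto
      then show ?thesis using m(2)
        by (auto simp: hawaiian_earring_def dist_norm norm_minus_commute intro!: bexI[of _ m])
    qed (simp add: zero_in_earring)
  qed
  have "closed ?B"
  proof -
    have "open ((- {0}) \<inter> (\<lambda>z::complex. 2 * Re z / (cmod z)\<^sup>2) -` (- (\<int> \<inter> {1..})))"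
      by (intro continuous_open_preimage continuous_intros open_Compl closed_Int closed_Ints) auto
    moreover have "(- {0}) \<inter> (\<lambda>z::complex. 2 * Re z / (cmod z)\<^sup>2) -` (- (\<int> \<inter> {1..})) = - ?B"
      by auto
    ultimately show ?thesis by (simp add: closed_def)
  qed
  moreover have "bounded hawaiian_earring"
  proof (rule boundedI)
    fix z assume "z \<in> hawaiian_earring"
    then obtain m where m: "m \<ge> 1" "dist (1 / of_nat m) z = 1 / real m"
      by (auto simp: hawaiian_earring_def)
    have "norm z \<le> norm (1 / of_nat m - z) + norm (1 / of_nat m :: complex)" by norm
    also have "\<dots> \<le> 1 + 1" using m by (intro add_mono) (auto simp: dist_norm norm_divide)
    finally show "norm z \<le> 2" by simp
  qed
  ultimately show ?thesis unfolding compact_eq_bounded_closed A[symmetric] by simp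
qed

section \<open>Subgroups of the integers and stretching\<close>

lemma mem_multiples: "k \<in> multiples n \<longleftrightarrow> int n dvd k"
  by (auto simp: multiples_def dvd_def)

lemma multiples_closed_subgroup: "multiples n \<in> closed_subgroups"
  by (auto simp: closed_subgroups_def mem_multiples closed_def open_discrete)

lemma int_closed_subgroup_multiples:
  assumes "N \<in> (closed_subgroups :: int set set)"
  obtains n where "N = multiples n"
proof -
  note N = closed_subgroupsD[OF assms]
  have nat_mult: "int i * k \<in> N" if "k \<in> N" for i k
    by (induction i) (use N that in \<open>auto simp: distrib_right\<close>)
  have mult: "i * k \<in> N" if "k \<in> N" for i k
  proof (cases "i \<ge> 0")
    case True
    then show ?thesis using nat_mult[OF that, of "nat i"] by simp
  next
    case False
    then show ?thesis using N(4)[OF nat_mult[OF that, of "nat (- i)"]] by simp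
  qed
  show thesis
  proof (cases "N = {0}")
    case True
    then show ?thesis using that[of 0] by simp
  next
    case False
    then obtain k where k: "k \<in> N" "k \<noteq> 0" using N(2) by auto
    have ex: "nat \<bar>k\<bar> > 0 \<and> int (nat \<bar>k\<bar>) \<in> N"
      using k N(4)[OF k(1)] by (auto simp: abs_if)
    define n where "n = (LEAST n. n > 0 \<and> int n \<in> N)"
    have n: "n > 0" "int n \<in> N"
      unfolding n_def using LeastI[of "\<lambda>n. n > 0 \<and> int n \<in> N", OF ex] by auto
    have "int n dvd j" if j: "j \<in> N" for j
    proof -
      have "j + - (j div int n * int n) \<in> N" by (intro N j mult n)
      then have "j mod int n \<in> N" by (simp add: minus_div_mult_eq_mod)
      moreover have "0 \<le> j mod int n" "j mod int n < int n" using n by simp_all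
      ultimately have "\<not> nat (j mod int n) > 0"
        using not_less_Least[of "nat (j mod int n)" "\<lambda>n. n > 0 \<and> int n \<in> N"]
        unfolding n_def[symmetric] by (auto simp: nat_less_iff)
      then show ?thesis using \<open>0 \<le> j mod int n\<close> by (simp add: dvd_eq_mod_eq_0)
    qed
    then have "N = multiples n" using mult[OF n(2)] by (auto simp: mem_multiples dvd_def mult.commute)
    then show ?thesis by (rule that)
  qed
qed

text \<open>The group \<open>n\<int>\<close> is singled out by containing \<open>n\<close> and no smaller positive integer.\<close>

lemma openin_singleton_multiples:
  assumes "n > 0"
  shows "openin chabauty_topology {multiples n}"
proof -
  have "{multiples n} = {N \<in> closed_subgroups. N \<inter> {1..int n - 1} = {}} \<inter> {N \<in> closed_subgroups. N \<inter> {int n} \<noteq> {}}"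
    (is "_ = ?R")
  proof (intro set_eqI iffI)
    fix N assume "N \<in> {multiples n}"
    then show "N \<in> ?R" by (auto simp: multiples_closed_subgroup mem_multiples zdvd_not_zless)
  next
    fix N assume N: "N \<in> ?R"
    then obtain m where m: "N = multiples m" using int_closed_subgroup_multiples by blast
    have "int m dvd int n" using N m by (auto simp: mem_multiples)
    then have "m dvd n" by simp
    then have "0 < m" "m \<le> n" using assms by (auto dest: dvd_imp_le intro: Nat.gr0I)
    moreover have "int m \<in> multiples m" by (simp add: mem_multiples)
    then have "int m \<notin> {1..int n - 1}" using N m by blast
    ultimately have "m = n" by auto
    then show "N \<in> {multiples n}" using m by simp
  qed
  then show ?thesis
    by (simp only:) (intro openin_Int openin_chabauty_hit openin_chabauty_miss open_discrete finite_imp_compact finite_atLeastAtMost_int)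
qed

text \<open>A compact set of nonzero integers is finite and thus missed by \<open>n\<int>\<close> for large \<open>n\<close>; so the
  subgroups form a sequence together with its limit \<open>{0}\<close>.\<close>

lemma compact_chabauty_int: "compact_space (chabauty_topology :: int set topology)"
proof -
  have "eventually (\<lambda>n. multiples n \<in> U) sequentially" if U: "openin chabauty_topology U" "{0} \<in> U" for U
  proof -
    have "generate_topology_on ({{H \<in> closed_subgroups. H \<inter> K = {}} |K. compact K} \<union>
        {{H \<in> closed_subgroups. H \<inter> U \<noteq> {}} |U. open U}) U"
      using U(1) unfolding chabauty_topology_def by (rule openin_topology_generated_by)
    then show ?thesis using U(2)
    proof (induction rule: generate_topology_on.induct)
      case (Int a b)
      then show ?case by (auto intro: eventually_conj)
    next
      case (UN K)
      then obtain k where "k \<in> K" "{0} \<in> k" by blast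
      then have "eventually (\<lambda>n. multiples n \<in> k) sequentially" using UN by blast
      then show ?case by eventually_elim (use \<open>k \<in> K\<close> in blast)
    next
      case (Basis A)
      from Basis(1) consider (miss) K where "compact K" "A = {H \<in> closed_subgroups. H \<inter> K = {}}"
        | (hit) W where "open W" "A = {H \<in> closed_subgroups. H \<inter> W \<noteq> {}}" by blast
      then show ?case
      proof cases
        case miss
        obtain D where "finite D" "K \<subseteq> (\<Union>k\<in>D. {k})"
          using compactE_image[OF miss(1), of K "\<lambda>k. {k}"] by (auto simp: open_discrete)
        then have "finite K" by (auto intro: finite_subset)
        then have "bdd_above (abs ` K)" by simp
        then obtain B where B: "\<And>k. k \<in> K \<Longrightarrow> \<bar>k\<bar> \<le> B" by (auto simp: bdd_above_def)
        have "\<forall>\<^sub>F n in sequentially. n > nat B" by (rule eventually_gt_at_top)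
        then show ?thesis
        proof eventually_elim
          case (elim n)
          have "k \<notin> K" if "k \<in> multiples n" for k
          proof
            assume k: "k \<in> K"
            then have "k \<noteq> 0" using Basis(2) miss(2) by auto
            moreover have "int n dvd k" using that by (simp add: mem_multiples)
            ultimately have "\<bar>int n\<bar> \<le> \<bar>k\<bar>" by (rule dvd_imp_le_int)
            then show False using elim B[OF k] by linarith
          qed
          then show ?case using miss(2) by (auto simp: multiples_closed_subgroup)
        qed
      next
        case hit
        then have "0 \<in> W" using Basis(2) by auto
        then have "multiples n \<in> A" for n
          using hit(2) by (auto simp: multiples_closed_subgroup mem_multiples intro!: exI[of _ 0])
        then show ?thesis by simp
      qed
    qed simp
  qed
  then have "limitin chabauty_topology multiples {0} sequentially"
    using multiples_closed_subgroup[of 0] by (simp add: limitin_def)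
  moreover have "range multiples \<subseteq> topspace chabauty_topology" using multiples_closed_subgroup by auto
  ultimately have "compactin chabauty_topology (insert {0} (range multiples))"
    by (intro compactin_sequence_with_limit) auto
  moreover have "insert {0} (range multiples) = topspace chabauty_topology"
    using multiples_closed_subgroup multiples_closed_subgroup[of 0, unfolded multiples_0] by (auto elim!: int_closed_subgroup_multiples)
  ultimately show ?thesis by (simp add: compact_space_def)
qed

definition generator :: "int set \<Rightarrow> nat" where
  "generator N = (THE n. N = multiples n)"

lemma generator_multiples [simp]: "generator (multiples n) = n"
  unfolding generator_def by (rule the_equality) (simp_all add: multiples_eq_iff)

text \<open>For \<open>N = n\<int>\<close> with \<open>n > 0\<close> this is the image of \<open>L\<close> under \<open>(v, l) \<mapsto> (v, n l)\<close>, and for \<open>N = {0}\<close>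
  it is \<open>L \<inter> (\<real> \<times> {0})\<close>, because division by 0 yields 0.\<close>

definition stretch :: "int set \<Rightarrow> (real \<times> int) set \<Rightarrow> (real \<times> int) set" where
  "stretch N L = {(v, k). k \<in> N \<and> (v, k div int (generator N)) \<in> L}"

lemma mem_stretch: "(v, k) \<in> stretch (multiples n) L \<longleftrightarrow> int n dvd k \<and> (v, k div int n) \<in> L"
  by (simp add: stretch_def mem_multiples)

lemma stretch_closed_subgroup:
  assumes "N \<in> closed_subgroups" "L \<in> closed_subgroups"
  shows "stretch N L \<in> closed_subgroups"
proof -
  obtain n where n: "N = multiples n" by (rule int_closed_subgroup_multiples[OF assms(1)])
  note L = closed_subgroupsD[OF assms(2)]
  show ?thesis unfolding closed_subgroups_def n
  proof (intro CollectI conjI ballI)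
    show "closed (stretch (multiples n) L)"
    proof (rule closed_slicewise)
      fix k
      show "closed {v. (v, k) \<in> stretch (multiples n) L}"
        using closed_slice[OF L(1)] by (cases "int n dvd k") (simp_all add: mem_stretch)
    qed
    show "0 \<in> stretch (multiples n) L" using L(2) by (simp add: zero_prod_def mem_stretch)
    show "p + q \<in> stretch (multiples n) L"
      if pq: "p \<in> stretch (multiples n) L" "q \<in> stretch (multiples n) L" for p q
    proof -
      obtain v k w l where [simp]: "p = (v, k)" "q = (w, l)" by (cases p, cases q)
      have "(v, k div int n) + (w, l div int n) \<in> L" using pq by (intro L(3)) (auto simp: mem_stretch)
      then show ?thesis using pq by (auto simp: mem_stretch)
    qed
    show "- p \<in> stretch (multiples n) L" if p: "p \<in> stretch (multiples n) L" for p
    proof -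
      obtain v k where [simp]: "p = (v, k)" by (cases p)
      have "- (v, k div int n) \<in> L" using p by (intro L(4)) (auto simp: mem_stretch)
      then show ?thesis using p by (auto simp: mem_stretch dvd_neg_div)
    qed
  qed
qed

lemma filterlim_nhdsin:
  assumes "continuous_map X Y f" "a \<in> topspace X"
  shows "filterlim f (nhdsin Y (f a)) (nhdsin X a)"
  unfolding filterlim_iff
proof (intro allI impI)
  fix P assume P: "eventually P (nhdsin Y (f a))"
  have "f a \<in> topspace Y" using assms by (auto simp: continuous_map_def)
  then obtain S where S: "openin Y S" "f a \<in> S" "\<forall>y\<in>S. P y" using P by (auto simp: eventually_nhdsin)
  have "openin X {x \<in> topspace X. f x \<in> S}" by (rule openin_continuous_map_preimage[OF assms(1) S(1)])
  then show "\<forall>\<^sub>F x in nhdsin X a. P (f x)"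
    using S assms(2) unfolding eventually_nhdsin by (intro disjI2 exI[of _ "{x \<in> topspace X. f x \<in> S}"]) auto
qed

text \<open>The slice \<open>k = 0\<close> does not depend on \<open>N\<close>.  For \<open>k \<noteq> 0\<close>, either \<open>k \<in> N\<close>, then \<open>N \<noteq> {0}\<close> is
  isolated, or \<open>k \<notin> N\<close>, which persists nearby; this also settles the slices at the accumulation
  point \<open>{0}\<close>.\<close>

lemma continuous_map_stretch:
  "continuous_map (prod_topology chabauty_topology chabauty_topology) chabauty_topology
     (\<lambda>(N, L). stretch N L)"
proof (rule continuous_map_chabauty_slicewise)
  let ?X = "prod_topology (chabauty_topology :: int set topology) (chabauty_topology :: (real \<times> int) set topology)"
  fix p assume p: "p \<in> topspace ?X"
  obtain N L where [simp]: "p = (N, L)" by (cases p)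
  have NL: "N \<in> closed_subgroups" "L \<in> closed_subgroups" using p by auto
  then show "(case p of (N, L) \<Rightarrow> stretch N L) \<in> closed_subgroups" by (simp add: stretch_closed_subgroup)
  obtain n where n: "N = multiples n" by (rule int_closed_subgroup_multiples[OF NL(1)])
  let ?F = "nhdsin ?X p"
  have L: "slicewise_limit snd ?F L"
    using slicewise_limit_compose[OF slicewise_limit_id[OF NL(2)], of snd ?F]
      filterlim_nhdsin[OF continuous_map_snd p] by (simp add: comp_def)
  have fst: "\<forall>\<^sub>F q in ?F. fst q \<in> S" if "openin chabauty_topology S" "N \<in> S" for S
    using eventually_compose_filterlim[OF eventually_nhdsin_openin[OF that]
        filterlim_nhdsin[OF continuous_map_fst p, simplified]] by simp
  have const: "\<forall>\<^sub>F q in ?F. fst q = multiples n" if "n > 0"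
    using fst[OF openin_singleton_multiples[OF that]] n by simp
  have sub: "\<forall>\<^sub>F q in ?F. \<exists>m. fst q = multiples m"
  proof -
    have "\<forall>\<^sub>F q in ?F. fst q \<in> closed_subgroups"
      using fst[of closed_subgroups] NL(1) openin_topspace[of "chabauty_topology :: int set topology"] by simp
    then show ?thesis by eventually_elim (metis int_closed_subgroup_multiples)
  qed
  have reduce: "\<forall>\<^sub>F q in ?F. \<forall>w. (w, k) \<in> stretch (fst q) (snd q) \<longleftrightarrow> (w, k div int n) \<in> snd q"
    if "int n dvd k" for k
  proof (cases "k = 0")
    case True
    show ?thesis using sub
      by eventually_elim (auto simp: True mem_stretch)
  next
    case False
    then have "n > 0" using that by (cases n) auto
    from const[OF this] show ?thesis by eventually_elim (auto simp: mem_stretch that)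
  qed
  have "slicewise_limit (\<lambda>q. stretch (fst q) (snd q)) ?F (stretch N L)"
  proof (rule slicewise_limitI)
    fix v k and \<epsilon> :: real assume vk: "(v, k) \<in> stretch N L" "\<epsilon> > 0"
    then have k: "int n dvd k" "(v, k div int n) \<in> L" by (auto simp: n mem_stretch)
    show "\<forall>\<^sub>F q in ?F. \<exists>w. \<bar>w - v\<bar> < \<epsilon> \<and> (w, k) \<in> stretch (fst q) (snd q)"
      using slicewise_limitD1[OF L k(2) vk(2)] reduce[OF k(1)] by eventually_elim auto
  next
    fix v k assume vk: "(v, k) \<notin> stretch N L"
    show "\<exists>\<epsilon>>0. \<forall>\<^sub>F q in ?F. \<forall>w. \<bar>w - v\<bar> < \<epsilon> \<longrightarrow> (w, k) \<notin> stretch (fst q) (snd q)"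
    proof (cases "int n dvd k")
      case True
      then have "(v, k div int n) \<notin> L" using vk by (simp add: n mem_stretch)
      then obtain \<epsilon> where \<epsilon>: "\<epsilon> > 0" "\<forall>\<^sub>F q in ?F. \<forall>w. \<bar>w - v\<bar> < \<epsilon> \<longrightarrow> (w, k div int n) \<notin> snd q"
        by (rule slicewise_limitD2[OF L])
      from \<epsilon>(2) reduce[OF True]
      have "\<forall>\<^sub>F q in ?F. \<forall>w. \<bar>w - v\<bar> < \<epsilon> \<longrightarrow> (w, k) \<notin> stretch (fst q) (snd q)"
        by eventually_elim auto
      then show ?thesis using \<epsilon>(1) by blast
    next
      case False
      have "\<forall>\<^sub>F q in ?F. fst q \<in> {M \<in> closed_subgroups. M \<inter> {k} = {}}"
        using NL(1) False by (intro fst openin_chabauty_miss) (auto simp: n mem_multiples)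
      then have "\<forall>\<^sub>F q in ?F. \<forall>w. \<bar>w - v\<bar> < 1 \<longrightarrow> (w, k) \<notin> stretch (fst q) (snd q)"
        by eventually_elim (auto simp: stretch_def)
      then show ?thesis by (intro exI[of _ 1]) auto
    qed
  qed
  then show "slicewise_limit (\<lambda>(N, L). stretch N L) ?F (case p of (N, L) \<Rightarrow> stretch N L)"
    by (simp add: case_prod_unfold)
qed

lemma stretch_cyclic_subgroup:
  assumes "n > 0" "m > 0"
  shows "stretch (multiples n) (cyclic_subgroup x (int m)) = cyclic_subgroup x (int (n * m))"
proof (intro set_eqI, clarify)
  fix v k
  have "(int n dvd k \<and> k div int n = l * int m) \<longleftrightarrow> k = l * int (n * m)" for l
    using assms(1) by (auto simp: mult_ac elim!: dvdE)
  then show "(v, k) \<in> stretch (multiples n) (cyclic_subgroup x (int m))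
      \<longleftrightarrow> (v, k) \<in> cyclic_subgroup x (int (n * m))"
    unfolding mem_stretch mem_cyclic_subgroup by blast
qed

lemma stretch_trivial: "stretch (multiples n) {0} = {0}"
proof (intro set_eqI, clarify)
  fix v k
  show "(v, k) \<in> stretch (multiples n) {0} \<longleftrightarrow> (v, k) \<in> {0}"
    by (auto simp: mem_stretch zero_prod_def elim!: dvdE split: if_splits)
qed

lemma stretch_earring_point:
  assumes "n > 0" "m > 0"
  shows "stretch (multiples n) (earring_subgroup (earring_point m \<theta>))
    = earring_subgroup (earring_point (n * m) \<theta>)"
proof (cases "cos \<theta> = 0")
  case True
  then show ?thesis by (simp add: earring_point_end earring_subgroup_zero stretch_trivial)
next
  case False
  then show ?thesis using assms by (simp add: earring_subgroup_point stretch_cyclic_subgroup del: of_nat_mult)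
qed

lemma mem_earring_subgroup_zero:
  assumes "z \<in> hawaiian_earring"
  shows "(v, 0) \<in> earring_subgroup z \<longleftrightarrow> v = 0"
  using assms
proof (cases rule: earring_cases)
  case 1
  then show ?thesis by (simp add: earring_subgroup_zero zero_prod_def)
next
  case (2 m \<theta>)
  then have "cos \<theta> \<noteq> 0" using cos_gt_zero_pi[of \<theta>] by auto
  then show ?thesis using 2 earring_subgroup_point[of m \<theta>] by (auto simp: mem_cyclic_subgroup)
qed

lemma mem_stretch_zero_group: "(v, k) \<in> stretch {0} L \<longleftrightarrow> k = 0 \<and> (v, 0) \<in> L"
  using mem_stretch[of v k 0 L] by (cases "k = 0") simp_all

lemma stretch_zero_earring:
  assumes "z \<in> hawaiian_earring"
  shows "stretch {0} (earring_subgroup z) = {0}"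
  by (intro set_eqI)
    (auto simp: mem_stretch_zero_group mem_earring_subgroup_zero[OF assms] zero_prod_def)

section \<open>The blown-up line is parametrized by height\<close>

definition blown_up_carrier :: "(real \<times> real) set" where
  "blown_up_carrier = {(\<beta>, \<theta>). \<theta> \<in> {- pi / 2..pi / 2} \<and> (\<beta> \<notin> \<rat> \<longrightarrow> \<theta> = pi / 2)}"

lemma height_less_imp_lex:
  assumes "(\<beta>, \<theta>) \<in> blown_up_carrier" "(\<beta>', \<theta>') \<in> blown_up_carrier" "height \<beta> \<theta> < height \<beta>' \<theta>'"
  shows "\<beta> < \<beta>' \<or> \<beta> = \<beta>' \<and> \<theta> < \<theta>'"
proof (rule ccontr)
  assume *: "\<not> ?thesis"
  then consider "\<beta>' < \<beta>" | "\<beta>' = \<beta>" "\<theta>' = \<theta>" | "\<beta>' = \<beta>" "\<theta>' < \<theta>" by fastforce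
  then show False
  proof cases
    case 1
    then show False using height_strict_mono[OF 1, of \<theta>' \<theta>] assms by (auto simp: blown_up_carrier_def)
  next
    case 3
    then have "\<beta> \<in> \<rat>" using assms by (auto simp: blown_up_carrier_def)
    then show False using height_strict_mono_angle[of \<beta> \<theta>' \<theta>] 3 assms by (auto simp: blown_up_carrier_def)
  qed (use assms in auto)
qed

lemma lex_imp_height_less:
  assumes "(\<beta>, \<theta>) \<in> blown_up_carrier" "(\<beta>', \<theta>') \<in> blown_up_carrier" "\<beta> < \<beta>' \<or> \<beta> = \<beta>' \<and> \<theta> < \<theta>'"
  shows "height \<beta> \<theta> < height \<beta>' \<theta>'"
  using assms(3)
proof
  assume "\<beta> < \<beta>'"
  then show ?thesis using assms by (intro height_strict_mono) (auto simp: blown_up_carrier_def)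
next
  assume *: "\<beta> = \<beta>' \<and> \<theta> < \<theta>'"
  then have "\<beta> \<in> \<rat>" using assms by (auto simp: blown_up_carrier_def)
  then show ?thesis using * height_strict_mono_angle[of \<beta> \<theta> \<theta>'] assms by (auto simp: blown_up_carrier_def)
qed

lemma height_inj:
  assumes "(\<beta>, \<theta>) \<in> blown_up_carrier" "(\<beta>', \<theta>') \<in> blown_up_carrier" "height \<beta> \<theta> = height \<beta>' \<theta>'"
  shows "\<beta> = \<beta>'" "\<theta> = \<theta>'"
proof -
  have "\<not> (\<beta> < \<beta>' \<or> \<beta> = \<beta>' \<and> \<theta> < \<theta>')" "\<not> (\<beta>' < \<beta> \<or> \<beta>' = \<beta> \<and> \<theta>' < \<theta>)"
    using lex_imp_height_less[OF assms(1,2)] lex_imp_height_less[OF assms(2,1)] assms(3) by linarith+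
  then show "\<beta> = \<beta>'" "\<theta> = \<theta>'" by auto
qed

definition blown_up_point :: "real \<Rightarrow> real \<times> real" where
  "blown_up_point s = (SOME p. p \<in> blown_up_carrier \<and> height (fst p) (snd p) = s)"

abbreviation base :: "real \<Rightarrow> real" where "base s \<equiv> fst (blown_up_point s)"
abbreviation angle :: "real \<Rightarrow> real" where "angle s \<equiv> snd (blown_up_point s)"

lemma blown_up_point: "(base s, angle s) \<in> blown_up_carrier" "height (base s) (angle s) = s"
proof -
  have "\<exists>p. p \<in> blown_up_carrier \<and> height (fst p) (snd p) = s"
  proof -
    obtain \<beta> \<theta> where "\<theta> \<in> {- pi / 2..pi / 2}" "\<beta> \<notin> \<rat> \<longrightarrow> \<theta> = pi / 2" "height \<beta> \<theta> = s"
      using height_surj[of s] by blast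
    then show ?thesis by (intro exI[of _ "(\<beta>, \<theta>)"]) (simp add: blown_up_carrier_def)
  qed
  from someI_ex[OF this] show "(base s, angle s) \<in> blown_up_carrier" "height (base s) (angle s) = s"
    unfolding blown_up_point_def by auto
qed

lemma blown_up_point_height:
  assumes "(\<beta>, \<theta>) \<in> blown_up_carrier"
  shows "blown_up_point (height \<beta> \<theta>) = (\<beta>, \<theta>)"
  using height_inj[OF blown_up_point(1) assms blown_up_point(2)] by (simp add: prod_eq_iff)

text \<open>Hence the parametrization by height descends to the quotients by integer translations.\<close>

lemma blown_up_point_add_int: "blown_up_point (s + of_int n) = (base s + of_int n, angle s)"
proof -
  note p = blown_up_point[of s]
  have r: "base s + of_int n \<in> \<rat> \<longleftrightarrow> base s \<in> \<rat>"
    using Rats_add[of "base s" "of_int n"] Rats_diff[of "base s + of_int n" "of_int n"] by auto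
  then have "(base s + of_int n, angle s) \<in> blown_up_carrier"
    using p(1) by (auto simp: blown_up_carrier_def)
  moreover have "height (base s + of_int n) (angle s) = s + of_int n"
    using p by (subst height_add_int) (auto simp: blown_up_carrier_def)
  ultimately show ?thesis using blown_up_point_height by metis
qed

lemma angle_range: "- pi / 2 \<le> angle s" "angle s \<le> pi / 2"
  using blown_up_point(1)[of s] by (auto simp: blown_up_carrier_def)

lemma cos_angle_nonzero:
  assumes "cos (angle s) \<noteq> 0"
  shows "base s \<in> \<rat>" "- pi / 2 < angle s" "angle s < pi / 2" "arctan (tan (angle s)) = angle s"
proof -
  have "angle s \<noteq> pi / 2" "angle s \<noteq> - (pi / 2)" using assms by (metis cos_pi_half cos_minus)+
  then show "base s \<in> \<rat>" and *: "- pi / 2 < angle s" "angle s < pi / 2"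
    using blown_up_point(1)[of s] unfolding blown_up_carrier_def by auto
  show "arctan (tan (angle s)) = angle s" using * by (intro arctan_tan) auto
qed

section \<open>Lattices and their limits\<close>

definition offset :: "real \<Rightarrow> real \<Rightarrow> real" where
  "offset a s = (if a = 0 then base s else (THE y. warp a y = s))"

lemma warp_less_iff:
  assumes "a > 0"
  shows "warp a y < warp a z \<longleftrightarrow> y < z"
  using warp_strict_mono[OF assms, of y z] warp_strict_mono[OF assms, of z y]
  by (cases y z rule: linorder_cases) auto

lemma offset_eqI:
  assumes "a > 0" "warp a y = s"
  shows "offset a s = y"
proof -
  have "z = y" if "warp a z = s" for z
    using warp_less_iff[OF assms(1), of y z] warp_less_iff[OF assms(1), of z y] assms(2) that by simp
  then have "(THE y. warp a y = s) = y" using assms(2) by (intro the_equality)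
  then show ?thesis using assms(1) by (simp add: offset_def)
qed

lemma warp_offset:
  assumes "a > 0"
  shows "warp a (offset a s) = s"
proof -
  obtain y where "warp a y = s" using warp_surj[OF assms] by blast
  then show ?thesis using offset_eqI[OF assms, of y s] by simp
qed

lemma offset_less_iff: "a > 0 \<Longrightarrow> offset a s < y \<longleftrightarrow> s < warp a y"
  using warp_less_iff[of a "offset a s" y] by (simp add: warp_offset)

lemma less_offset_iff: "a > 0 \<Longrightarrow> y < offset a s \<longleftrightarrow> warp a y < s"
  using warp_less_iff[of a y "offset a s"] by (simp add: warp_offset)

lemma offset_add_int: "a \<ge> 0 \<Longrightarrow> offset a (s + of_int n) = offset a s + of_int n"
proof (cases "a = 0")
  case True
  then show ?thesis by (simp add: offset_def blown_up_point_add_int)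
next
  case False
  assume "a \<ge> 0"
  with False show ?thesis by (intro offset_eqI) (auto simp: warp_add_int warp_offset)
qed

text \<open>At \<open>a = 0\<close> this is the group attached to the boundary point of height \<open>s\<close>: cyclic when the point is
  interior to the segment over a rational, and trivial otherwise.  The test on the cosine
  is needed since the tangent has the default value 0 at \<open>\<plusminus> \<pi> / 2\<close>.\<close>

definition lattice :: "real \<Rightarrow> real \<Rightarrow> (real \<times> int) set" where
  "lattice a s = (if a = 0 then
       (if cos (angle s) = 0 then {0} else cyclic_subgroup (tan (angle s)) (int (denominator (base s))))
     else {(v, k). of_int k * offset a s - a * v \<in> \<int>})"

lemma lattice_zero_pole: "cos (angle s) = 0 \<Longrightarrow> lattice 0 s = {0}"
  and lattice_zero_cyclic: "cos (angle s) \<noteq> 0 \<Longrightarrow>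
    lattice 0 s = cyclic_subgroup (tan (angle s)) (int (denominator (base s)))"
  and mem_lattice: "a \<noteq> 0 \<Longrightarrow> (v, k) \<in> lattice a s \<longleftrightarrow> of_int k * offset a s - a * v \<in> \<int>"
  by (simp_all add: lattice_def)

lemma lattice_add_int: "a \<ge> 0 \<Longrightarrow> lattice a (s + of_int n) = lattice a s"
proof -
  assume a: "a \<ge> 0"
  have "of_int k * (offset a s + of_int n) - a * v \<in> \<int> \<longleftrightarrow> of_int k * offset a s - a * v \<in> \<int>" for k v
  proof -
    have "of_int k * (offset a s + of_int n) - a * v = (of_int k * offset a s - a * v) + of_int (k * n)"
      by (simp add: algebra_simps)
    then show ?thesis by (simp only: add_in_Ints_iff_right[OF Ints_of_int])
  qed
  then show ?thesis using offset_add_int[OF a]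
    by (simp add: lattice_def blown_up_point_add_int denominator_add_int)
qed

lemma lattice_closed_subgroup: "lattice a s \<in> closed_subgroups"
proof (cases "a = 0")
  case True
  show ?thesis
  proof (cases "cos (angle s) = 0")
    case True
    then show ?thesis using \<open>a = 0\<close> cyclic_subgroup_closed[of 0 0]
      by (simp add: lattice_zero_pole cyclic_subgroup_trivial)
  next
    case False
    then show ?thesis
      using \<open>a = 0\<close> cyclic_subgroup_closed denominator(1)[OF cos_angle_nonzero(1)[OF False]]
      by (simp add: lattice_zero_cyclic)
  qed
next
  case a: False
  show ?thesis unfolding closed_subgroups_def
  proof (intro CollectI conjI ballI)
    show "closed (lattice a s)"
    proof (rule closed_slicewise)
      fix k
      have "closed ((\<lambda>v. of_int k * offset a s - a * v) -` \<int>)"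
        by (intro closed_vimage closed_Ints continuous_intros)
      then show "closed {v. (v, k) \<in> lattice a s}" by (simp add: mem_lattice[OF a] vimage_def)
    qed
    show "0 \<in> lattice a s" by (simp add: zero_prod_def mem_lattice[OF a])
    show "p + q \<in> lattice a s" if pq: "p \<in> lattice a s" "q \<in> lattice a s" for p q
    proof -
      obtain v k w l where p: "p = (v, k)" "q = (w, l)" by (cases p, cases q)
      have "(of_int k * offset a s - a * v) + (of_int l * offset a s - a * w) \<in> \<int>"
        using pq by (intro Ints_add) (auto simp: p mem_lattice[OF a])
      then show ?thesis by (simp add: p mem_lattice[OF a] algebra_simps)
    qed
    show "- p \<in> lattice a s" if pp: "p \<in> lattice a s" for p
    proof -
      obtain v k where p: "p = (v, k)" by (cases p)
      have "- (of_int k * offset a s - a * v) \<in> \<int>"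
        using pp by (intro Ints_minus) (auto simp: p mem_lattice[OF a])
      then show ?thesis by (simp add: p mem_lattice[OF a] algebra_simps)
    qed
  qed
qed

lemma lattice_Ints: "(v, k) \<in> lattice a s \<Longrightarrow> of_int k * offset a s - a * v \<in> \<int>"
proof (cases "a = 0")
  case True
  assume vk: "(v, k) \<in> lattice a s"
  show ?thesis
  proof (cases "cos (angle s) = 0")
    case True
    then show ?thesis using vk \<open>a = 0\<close> by (simp add: lattice_zero_pole zero_prod_def)
  next
    case False
    then have "int (denominator (base s)) dvd k"
      using vk \<open>a = 0\<close> by (auto simp: lattice_zero_cyclic mem_cyclic_subgroup)
    then show ?thesis
      using int_mult_Ints_iff_denominator_dvd[OF cos_angle_nonzero(1)[OF False]] \<open>a = 0\<close>
      by (simp add: offset_def)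
  qed
qed (simp add: mem_lattice)

text \<open>The value of \<open>s\<close> at which \<open>b (y - q) / a\<close> passes through \<open>x\<close>.  Comparing \<open>s\<close> with thresholds treats
  the interior \<open>a > 0\<close> and the boundary \<open>a = 0\<close> in the same way, and thresholds are continuous at
  \<open>a = 0\<close> by \<open>warp_blow_up\<close>.\<close>

definition threshold :: "real \<Rightarrow> real \<Rightarrow> real \<Rightarrow> real" where
  "threshold a q x = (if a = 0 then height q (arctan x) else warp a (q + a * x / of_nat (denominator q)))"

lemma rational_in_carrier: "q \<in> \<rat> \<Longrightarrow> (q, arctan x) \<in> blown_up_carrier"
  using arctan_bounded[of x] by (auto simp: blown_up_carrier_def)

lemma less_thresholdD:
  assumes "q \<in> \<rat>" "s < threshold a q x" "a \<ge> 0"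
  shows "a > 0 \<Longrightarrow> offset a s < q + a * x / of_nat (denominator q)"
    and "a = 0 \<Longrightarrow> base s < q \<or> base s = q \<and> angle s < arctan x"
proof -
  show "offset a s < q + a * x / of_nat (denominator q)" if "a > 0"
    using assms that by (simp add: threshold_def offset_less_iff)
  show "base s < q \<or> base s = q \<and> angle s < arctan x" if "a = 0"
    using assms that by (intro height_less_imp_lex blown_up_point rational_in_carrier)
      (auto simp: threshold_def blown_up_point)
qed

lemma threshold_lessD:
  assumes "q \<in> \<rat>" "threshold a q x < s" "a \<ge> 0"
  shows "a > 0 \<Longrightarrow> q + a * x / of_nat (denominator q) < offset a s"
    and "a = 0 \<Longrightarrow> q < base s \<or> q = base s \<and> arctan x < angle s"
proof -
  show "q + a * x / of_nat (denominator q) < offset a s" if "a > 0"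
    using assms that by (simp add: threshold_def less_offset_iff)
  show "q < base s \<or> q = base s \<and> arctan x < angle s" if "a = 0"
    using assms that by (intro height_less_imp_lex blown_up_point rational_in_carrier)
      (auto simp: threshold_def blown_up_point)
qed

abbreviation half_plane :: "(real \<times> real) set" where "half_plane \<equiv> {0..} \<times> UNIV"
abbreviation boundary_filter :: "real \<Rightarrow> (real \<times> real) filter" where
  "boundary_filter s \<equiv> inf (nhds (0, s)) (principal half_plane)"

lemma boundary_filter_tendsto:
  "(fst \<longlongrightarrow> 0) (boundary_filter s)" "(snd \<longlongrightarrow> s) (boundary_filter s)"
  "\<forall>\<^sub>F p in boundary_filter s. fst p \<ge> 0"
proof -
  have id: "((\<lambda>p. p) \<longlongrightarrow> (0, s)) (boundary_filter s)" by (simp add: filterlim_def le_infI1)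
  show "(fst \<longlongrightarrow> 0) (boundary_filter s)" "(snd \<longlongrightarrow> s) (boundary_filter s)"
    using tendsto_fst[OF id] tendsto_snd[OF id] by simp_all
  show "\<forall>\<^sub>F p in boundary_filter s. fst p \<ge> 0"
    by (auto simp: eventually_inf_principal intro!: always_eventually)
qed

lemma eventually_less_threshold:
  assumes q: "q \<in> \<rat>" and s: "s < height q (arctan x)"
  shows "\<forall>\<^sub>F p in boundary_filter s. snd p < threshold (fst p) q x"
proof -
  obtain c where c: "s < c" "c < height q (arctan x)" using dense[OF s] by blast
  have "\<forall>\<^sub>F a in at_right 0. c < warp a (q + a * x / of_nat (denominator q))"
    using order_tendstoD(1)[OF warp_blow_up[OF q] c(2)] .
  then obtain d where d: "d > 0" "\<And>a. 0 < a \<Longrightarrow> a < d \<Longrightarrow> c < warp a (q + a * x / of_nat (denominator q))"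
    by (auto simp: eventually_at_right_field)
  have "\<forall>\<^sub>F p in boundary_filter s. fst p < d" "\<forall>\<^sub>F p in boundary_filter s. snd p < c"
    using order_tendstoD(2)[OF boundary_filter_tendsto(1) d(1)]
      order_tendstoD(2)[OF boundary_filter_tendsto(2) c(1)] .
  with boundary_filter_tendsto(3) show ?thesis
  proof eventually_elim
    case (elim p)
    then have "c < threshold (fst p) q x"
      using d(2)[of "fst p"] c(2) by (cases "fst p = 0") (simp_all add: threshold_def)
    with elim(3) show ?case by simp
  qed
qed

lemma eventually_threshold_less:
  assumes q: "q \<in> \<rat>" and s: "height q (arctan x) < s"
  shows "\<forall>\<^sub>F p in boundary_filter s. threshold (fst p) q x < snd p"
proof -
  obtain c where c: "height q (arctan x) < c" "c < s" using dense[OF s] by blast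
  have "\<forall>\<^sub>F a in at_right 0. warp a (q + a * x / of_nat (denominator q)) < c"
    using order_tendstoD(2)[OF warp_blow_up[OF q] c(1)] .
  then obtain d where d: "d > 0" "\<And>a. 0 < a \<Longrightarrow> a < d \<Longrightarrow> warp a (q + a * x / of_nat (denominator q)) < c"
    by (auto simp: eventually_at_right_field)
  have "\<forall>\<^sub>F p in boundary_filter s. fst p < d" "\<forall>\<^sub>F p in boundary_filter s. c < snd p"
    using order_tendstoD(2)[OF boundary_filter_tendsto(1) d(1)]
      order_tendstoD(1)[OF boundary_filter_tendsto(2) c(2)] .
  with boundary_filter_tendsto(3) show ?thesis
  proof eventually_elim
    case (elim p)
    then have "threshold (fst p) q x < c"
      using d(2)[of "fst p"] c(1) by (cases "fst p = 0") (simp_all add: threshold_def)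
    with elim(3) show ?case by simp
  qed
qed

text \<open>Squeeze \<open>base s\<close> between two rationals and use their thresholds at \<open>x = 0\<close>.\<close>

lemma offset_tendsto_base:
  "((\<lambda>p. offset (fst p) (snd p)) \<longlongrightarrow> base s) (boundary_filter s)"
proof (rule order_tendstoI)
  have half: "(0 :: real) \<in> {- pi / 2..pi / 2}" by simp
  have ang: "angle s \<in> {- pi / 2..pi / 2}" using angle_range[of s] by simp
  fix y assume "y < base s"
  then obtain q where q: "q \<in> \<rat>" "y < q" "q < base s" using Rats_dense_in_real by blast
  have "height q (arctan 0) < s"
    using height_strict_mono[OF q(3) half ang] by (simp add: blown_up_point)
  from eventually_threshold_less[OF q(1) this] boundary_filter_tendsto(3)
  show "\<forall>\<^sub>F p in boundary_filter s. y < offset (fst p) (snd p)"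
  proof eventually_elim
    case (elim p)
    then show ?case using threshold_lessD[OF q(1) elim] q(2)
      by (cases "fst p = 0") (auto simp: offset_def)
  qed
next
  have half: "(0 :: real) \<in> {- pi / 2..pi / 2}" by simp
  have ang: "angle s \<in> {- pi / 2..pi / 2}" using angle_range[of s] by simp
  fix y assume "base s < y"
  then obtain q where q: "q \<in> \<rat>" "base s < q" "q < y" using Rats_dense_in_real by blast
  have "s < height q (arctan 0)"
    using height_strict_mono[OF q(2) ang half] by (simp add: blown_up_point)
  from eventually_less_threshold[OF q(1) this] boundary_filter_tendsto(3)
  show "\<forall>\<^sub>F p in boundary_filter s. offset (fst p) (snd p) < y"
  proof eventually_elim
    case (elim p)
    then show ?case using less_thresholdD[OF q(1) elim] q(3)
      by (cases "fst p = 0") (auto simp: offset_def)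
  qed
qed

text \<open>The first coordinate of the element of the lattice close to the generator of the limit group;
  at \<open>a = 0\<close> it is that generator.\<close>

definition slope :: "real \<Rightarrow> real \<Rightarrow> real \<Rightarrow> real" where
  "slope q a s = (if a = 0 then tan (angle s) else of_nat (denominator q) * (offset a s - q) / a)"

lemma slope_less:
  assumes "q \<in> \<rat>" "s < threshold a q x" "a \<ge> 0" "a = 0 \<Longrightarrow> base s = q \<and> cos (angle s) \<noteq> 0"
  shows "slope q a s < x"
proof (cases "a = 0")
  case True
  then have "arctan (tan (angle s)) < arctan x"
    using less_thresholdD(2)[OF assms(1-3)] assms(4) cos_angle_nonzero(4)[of s] by auto
  then show ?thesis using True by (simp add: slope_def arctan_less_iff)
next
  case False
  then show ?thesis using less_thresholdD(1)[OF assms(1-3)] denominator(1)[OF assms(1)] assms(3)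
    by (simp add: slope_def field_simps)
qed

lemma less_slope:
  assumes "q \<in> \<rat>" "threshold a q x < s" "a \<ge> 0" "a = 0 \<Longrightarrow> base s = q \<and> cos (angle s) \<noteq> 0"
  shows "x < slope q a s"
proof (cases "a = 0")
  case True
  then have "arctan x < arctan (tan (angle s))"
    using threshold_lessD(2)[OF assms(1-3)] assms(4) cos_angle_nonzero(4)[of s] by auto
  then show ?thesis using True by (simp add: slope_def arctan_less_iff)
next
  case False
  then show ?thesis using threshold_lessD(1)[OF assms(1-3)] denominator(1)[OF assms(1)] assms(3)
    by (simp add: slope_def field_simps)
qed

text \<open>The form \<open>c y - a v\<close> decides about membership in a lattice; its values stay in an open set
  uniformly for \<open>w\<close> near \<open>v\<close>.\<close>

lemma form_stays_in_open:
  fixes A Y :: "'p \<Rightarrow> real"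
  assumes "(A \<longlongrightarrow> a) F" "(Y \<longlongrightarrow> y) F" "open U" "c * y - a * v \<in> U"
  shows "\<exists>\<epsilon>>0. \<forall>\<^sub>F p in F. \<forall>w. \<bar>w - v\<bar> < \<epsilon> \<longrightarrow> c * Y p - A p * w \<in> U"
proof -
  have "((\<lambda>pw. c * Y (fst pw) - A (fst pw) * snd pw) \<longlongrightarrow> c * y - a * v) (F \<times>\<^sub>F nhds v)"
    by (intro tendsto_intros filterlim_compose[OF assms(1) filterlim_fst]
        filterlim_compose[OF assms(2) filterlim_fst] filterlim_snd)
  from topological_tendstoD[OF this assms(3,4)]
  obtain Pf Pg where P: "eventually Pf F" "eventually Pg (nhds v)"
    "\<And>p w. Pf p \<Longrightarrow> Pg w \<Longrightarrow> c * Y p - A p * w \<in> U"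
    by (auto simp: eventually_prod_filter)
  obtain \<epsilon> where \<epsilon>: "\<epsilon> > 0" "\<And>w. dist w v < \<epsilon> \<Longrightarrow> Pg w"
    using P(2) by (auto simp: eventually_nhds_metric)
  from P(1) have "\<forall>\<^sub>F p in F. \<forall>w. \<bar>w - v\<bar> < \<epsilon> \<longrightarrow> c * Y p - A p * w \<in> U"
    by eventually_elim (use P(3) \<epsilon>(2) in \<open>auto simp: dist_real_def\<close>)
  then show ?thesis using \<epsilon>(1) by blast
qed

lemma Ints_close_eq:
  assumes "x \<in> \<int>" "y \<in> \<int>" "\<bar>x - y\<bar> < (1 :: real)"
  shows "x = y"
proof -
  obtain i j where ij: "x = of_int i" "y = of_int j" using assms(1,2) by (auto elim!: Ints_cases)
  then have "\<bar>i - j\<bar> < 1" using assms(3) by linarith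
  then show ?thesis using ij by simp
qed

lemma lattice_limit_interior:
  assumes "(A \<longlongrightarrow> a) F" "((\<lambda>p. offset (A p) (S p)) \<longlongrightarrow> offset a s) F" "a > 0"
  shows "slicewise_limit (\<lambda>p. lattice (A p) (S p)) F (lattice a s)"
proof -
  have pos: "\<forall>\<^sub>F p in F. A p > 0" using order_tendstoD(1)[OF assms(1,3)] .
  show ?thesis
  proof (rule slicewise_limitI)
    fix v k and \<epsilon> :: real assume vk: "(v, k) \<in> lattice a s" and \<epsilon>: "\<epsilon> > 0"
    then obtain m where m: "of_int k * offset a s - a * v = of_int m"
      using lattice_Ints[OF vk] by (auto elim!: Ints_cases)
    have "((\<lambda>p. (of_int k * offset (A p) (S p) - of_int m) / A p)
        \<longlongrightarrow> (of_int k * offset a s - of_int m) / a) F"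
      using assms(3) by (intro tendsto_intros assms) auto
    also have "(of_int k * offset a s - of_int m) / a = v" using m assms(3) by (simp add: field_simps)
    finally have "\<forall>\<^sub>F p in F. dist ((of_int k * offset (A p) (S p) - of_int m) / A p) v < \<epsilon>"
      using \<epsilon> by (rule tendstoD)
    then show "\<forall>\<^sub>F p in F. \<exists>w. \<bar>w - v\<bar> < \<epsilon> \<and> (w, k) \<in> lattice (A p) (S p)"
      using pos
    proof eventually_elim
      case (elim p)
      then show ?case
        by (intro exI[of _ "(of_int k * offset (A p) (S p) - of_int m) / A p"])
          (simp add: mem_lattice dist_real_def)
    qed
  next
    fix v k assume "(v, k) \<notin> lattice a s"
    then have "of_int k * offset a s - a * v \<in> - \<int>" using assms(3) by (simp add: mem_lattice)
    from form_stays_in_open[OF assms(1,2) open_Compl[OF closed_Ints] this]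
    obtain \<epsilon> where \<epsilon>: "\<epsilon> > 0" "\<forall>\<^sub>F p in F. \<forall>w. \<bar>w - v\<bar> < \<epsilon> \<longrightarrow>
        of_int k * offset (A p) (S p) - A p * w \<in> - \<int>" by blast
    from \<epsilon>(2) have "\<forall>\<^sub>F p in F. \<forall>w. \<bar>w - v\<bar> < \<epsilon> \<longrightarrow> (w, k) \<notin> lattice (A p) (S p)"
      by eventually_elim (use lattice_Ints in blast)
    then show "\<exists>\<epsilon>>0. \<forall>\<^sub>F p in F. \<forall>w. \<bar>w - v\<bar> < \<epsilon> \<longrightarrow> (w, k) \<notin> lattice (A p) (S p)"
      using \<epsilon>(1) by blast
  qed
qed

lemma offset_tendsto:
  assumes "(A \<longlongrightarrow> a) F" "(S \<longlongrightarrow> s) F" "a > 0"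
  shows "((\<lambda>p. offset (A p) (S p)) \<longlongrightarrow> offset a s) F"
proof -
  have pos: "\<forall>\<^sub>F p in F. A p > 0" using order_tendstoD(1)[OF assms(1,3)] .
  have lim: "((\<lambda>p. S p - warp (A p) y) \<longlongrightarrow> s - warp a y) F" for y
    by (intro tendsto_intros assms warp_tendsto)
  show ?thesis
  proof (rule order_tendstoI)
    fix y assume "y < offset a s"
    then have "0 < s - warp a y" using assms(3) by (simp add: less_offset_iff)
    from order_tendstoD(1)[OF lim this] pos
    show "\<forall>\<^sub>F p in F. y < offset (A p) (S p)" by eventually_elim (simp add: less_offset_iff)
  next
    fix y assume "offset a s < y"
    then have "s - warp a y < 0" using assms(3) by (simp add: offset_less_iff)
    from order_tendstoD(2)[OF lim this] pos
    show "\<forall>\<^sub>F p in F. offset (A p) (S p) < y" by eventually_elim (simp add: offset_less_iff)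
  qed
qed

lemma lattice_zero_mem: "(0, 0) \<in> lattice a s"
  using closed_subgroupsD(2)[OF lattice_closed_subgroup] by (simp add: zero_prod_def)

text \<open>An element of the limit group is an integer multiple of the generator over \<open>q = base s\<close>, and the
  thresholds of \<open>q\<close> at \<open>tan (angle s) \<plusminus> \<delta>\<close> trap the slope.

  Conversely, let \<open>(v, k)\<close> be outside the limit group.  If \<open>k base s\<close> is not an integer, the form
  \<open>k y - a w\<close>, which is close to it, cannot be an integer.  Otherwise the form, being an integer,
  must equal \<open>k base s\<close>; this forces \<open>w = 0\<close> for \<open>k = 0\<close>, and \<open>w = j slope\<close> with \<open>j = k / b\<close> for
  \<open>k \<noteq> 0\<close>.  A threshold of \<open>q\<close> strictly between \<open>s\<close> and the one that belongs to \<open>v / j\<close> then keeps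
  the slope away from \<open>v / j\<close>.\<close>

lemma lattice_limit_boundary:
  "slicewise_limit (\<lambda>p. lattice (fst p) (snd p)) (boundary_filter s) (lattice 0 s)"
proof (rule slicewise_limitI)
  let ?F = "boundary_filter s"
  fix v k and \<epsilon> :: real assume vk: "(v, k) \<in> lattice 0 s" and \<epsilon>: "\<epsilon> > 0"
  show "\<forall>\<^sub>F p in ?F. \<exists>w. \<bar>w - v\<bar> < \<epsilon> \<and> (w, k) \<in> lattice (fst p) (snd p)"
  proof (cases "(v, k) = (0, 0)")
    case True
    then show ?thesis using \<epsilon> lattice_zero_mem by (intro always_eventually allI exI[of _ 0]) auto
  next
    case False
    then have c: "cos (angle s) \<noteq> 0" using vk lattice_zero_pole[of s] by (auto simp: zero_prod_def)
    note c' = cos_angle_nonzero[OF c]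
    define q where "q = base s"
    have q: "q \<in> \<rat>" using c'(1) by (simp add: q_def)
    let ?d = "denominator q" and ?t = "tan (angle s)"
    have d: "?d > 0" by (rule denominator(1)[OF q])
    obtain l where l: "v = of_int l * ?t" "k = l * int ?d"
      using vk by (auto simp: lattice_zero_cyclic[OF c] mem_cyclic_subgroup q_def)
    define \<delta> where "\<delta> = \<epsilon> / (\<bar>of_int l\<bar> + 1)"
    have \<delta>: "\<delta> > 0" "\<bar>of_int l\<bar> * \<delta> < \<epsilon>"
      using \<epsilon> by (auto simp: \<delta>_def field_simps)
    have carr: "(q, arctan y) \<in> blown_up_carrier" for y by (rule rational_in_carrier[OF q])
    have hs: "height q (arctan ?t) = s" using blown_up_point(2)[of s] by (simp add: c'(4) q_def)
    have "s < height q (arctan (?t + \<delta>))" "height q (arctan (?t - \<delta>)) < s"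
      using lex_imp_height_less[OF carr carr, of ?t "?t + \<delta>"] lex_imp_height_less[OF carr carr, of "?t - \<delta>" ?t]
        \<delta>(1) hs by (auto simp: arctan_less_iff)
    then have "\<forall>\<^sub>F p in ?F. snd p < threshold (fst p) q (?t + \<delta>)"
      "\<forall>\<^sub>F p in ?F. threshold (fst p) q (?t - \<delta>) < snd p"
      using eventually_less_threshold[OF q] eventually_threshold_less[OF q] by blast+
    with boundary_filter_tendsto(3) show ?thesis
    proof eventually_elim
      case (elim p)
      define a where "a = fst p"
      define u where "u = snd p"
      have zero: "base u = q \<and> cos (angle u) \<noteq> 0" if "a = 0"
      proof -
        have b: "base u = q" and an: "angle u < arctan (?t + \<delta>)" "arctan (?t - \<delta>) < angle u"
          using less_thresholdD(2)[OF q elim(2,1)] threshold_lessD(2)[OF q elim(3,1)] that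
          by (auto simp: a_def u_def)
        have "- (pi / 2) < angle u" "angle u < pi / 2"
          using an arctan_bounded[of "?t + \<delta>"] arctan_bounded[of "?t - \<delta>"] by linarith+
        then show ?thesis using b cos_gt_zero_pi[of "angle u"] by simp
      qed
      have "slope q a u < ?t + \<delta>" "?t - \<delta> < slope q a u"
        using slope_less[OF q, of u a] less_slope[OF q, of a _ u] elim zero by (auto simp: a_def u_def)
      then have "\<bar>slope q a u - ?t\<bar> \<le> \<delta>" by linarith
      then have "\<bar>of_int l\<bar> * \<bar>slope q a u - ?t\<bar> \<le> \<bar>of_int l\<bar> * \<delta>" by (intro mult_left_mono) auto
      then have "\<bar>of_int l * slope q a u - v\<bar> < \<epsilon>"
        using \<delta>(2) unfolding l(1) by (simp add: abs_mult[symmetric] right_diff_distrib)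
      moreover have "(of_int l * slope q a u, k) \<in> lattice a u"
      proof (cases "a = 0")
        case True
        then show ?thesis using zero[OF True] l(2)
          by (auto simp: lattice_zero_cyclic mem_cyclic_subgroup slope_def)
      next
        case False
        have "of_int k * offset a u - a * (of_int l * slope q a u) = of_int l * (of_nat ?d * q)"
          using False by (simp add: slope_def l(2) field_simps)
        also have "\<dots> \<in> \<int>" by (rule Ints_mult[OF Ints_of_int denominator(2)[OF q]])
        finally show ?thesis using False by (simp add: mem_lattice)
      qed
      ultimately show ?case unfolding a_def u_def by blast
    qed
  qed
next
  let ?F = "boundary_filter s"
  fix v k assume vk: "(v, k) \<notin> lattice 0 s"
  note lim = form_stays_in_open[OF boundary_filter_tendsto(1)[of s] offset_tendsto_base[of s], of _ "of_int k" v]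
  show "\<exists>\<epsilon>>0. \<forall>\<^sub>F p in ?F. \<forall>w. \<bar>w - v\<bar> < \<epsilon> \<longrightarrow> (w, k) \<notin> lattice (fst p) (snd p)"
  proof (cases "of_int k * base s \<in> \<int>")
    case False
    then obtain \<epsilon> where \<epsilon>: "\<epsilon> > 0" "\<forall>\<^sub>F p in ?F. \<forall>w. \<bar>w - v\<bar> < \<epsilon> \<longrightarrow>
        of_int k * offset (fst p) (snd p) - fst p * w \<in> - \<int>"
      using lim[OF open_Compl[OF closed_Ints]] by auto
    from \<epsilon>(2) have "\<forall>\<^sub>F p in ?F. \<forall>w. \<bar>w - v\<bar> < \<epsilon> \<longrightarrow> (w, k) \<notin> lattice (fst p) (snd p)"
      by eventually_elim (use lattice_Ints in blast)
    then show ?thesis using \<epsilon>(1) by blast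
  next
    case int: True
    obtain \<epsilon> where \<epsilon>: "\<epsilon> > 0" "\<forall>\<^sub>F p in ?F. \<forall>w. \<bar>w - v\<bar> < \<epsilon> \<longrightarrow>
        of_int k * offset (fst p) (snd p) - fst p * w \<in> ball (of_int k * base s) 1"
      using lim[OF open_ball, of "of_int k * base s" 1] by auto
    have eq: "of_int k * offset a u - a * w = of_int k * base s"
      if "(w, k) \<in> lattice a u" "of_int k * offset a u - a * w \<in> ball (of_int k * base s) 1" for a u w
      using Ints_close_eq[OF lattice_Ints[OF that(1)] int] that(2) by (simp add: dist_real_def abs_minus_commute)
    show ?thesis
    proof (cases "k = 0")
      case True
      have v: "v \<noteq> 0" using vk lattice_zero_mem True by auto
      from \<epsilon>(2) have "\<forall>\<^sub>F p in ?F. \<forall>w. \<bar>w - v\<bar> < min \<epsilon> \<bar>v\<bar> \<longrightarrow> (w, k) \<notin> lattice (fst p) (snd p)"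
      proof eventually_elim
        case (elim p)
        show ?case
        proof (intro allI impI notI)
          fix w assume w: "\<bar>w - v\<bar> < min \<epsilon> \<bar>v\<bar>" "(w, k) \<in> lattice (fst p) (snd p)"
          then have "fst p * w = 0" using eq[OF w(2)] elim True by auto
          moreover have "w \<noteq> 0" using w(1) by auto
          ultimately have "fst p = 0" by simp
          then have "w = 0" using w(2) True denominator(1)[OF cos_angle_nonzero(1), of "snd p"]
            by (cases "cos (angle (snd p)) = 0")
              (auto simp: lattice_zero_pole lattice_zero_cyclic mem_cyclic_subgroup zero_prod_def)
          with \<open>w \<noteq> 0\<close> show False by simp
        qed
      qed
      then show ?thesis using \<epsilon>(1) v by (intro exI[of _ "min \<epsilon> \<bar>v\<bar>"]) auto
    next
      case k: False
      define q where "q = base s"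
      have q: "q \<in> \<rat>"
      proof -
        have "of_int k * q / of_int k \<in> \<rat>" using int Ints_subset_Rats by (intro Rats_divide) (auto simp: q_def)
        then show ?thesis using k by simp
      qed
      let ?d = "denominator q"
      have d: "?d > 0" by (rule denominator(1)[OF q])
      obtain j where j: "k = int ?d * j"
        using int int_mult_Ints_iff_denominator_dvd[OF q] by (auto simp: q_def)
      have j0: "j \<noteq> 0" using j k by auto
      then have j1: "1 \<le> \<bar>real_of_int j\<bar>" by linarith
      have slope_eq: "w = of_int j * slope q a u \<and> (a = 0 \<longrightarrow> base u = q \<and> cos (angle u) \<noteq> 0)"
        if m: "(w, k) \<in> lattice a u" "of_int k * offset a u - a * w \<in> ball (of_int k * base s) 1" for a u w
      proof (cases "a = 0")
        case True
        then have "base u = q" using eq[OF m] k by (simp add: offset_def q_def)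
        moreover have "cos (angle u) \<noteq> 0"
          using m(1) True k by (auto simp: lattice_zero_pole zero_prod_def)
        ultimately show ?thesis using m(1) True d j
          by (auto simp: lattice_zero_cyclic mem_cyclic_subgroup slope_def)
      next
        case False
        have "a * w = a * (of_int j * slope q a u)"
          using eq[OF m] False by (simp add: slope_def j q_def field_simps)
        then show ?thesis using False by simp
      qed
      define w0 where "w0 = v / of_int j"
      have v: "v = of_int j * w0" using j0 by (simp add: w0_def)
      have "angle s \<noteq> arctan w0"
      proof
        assume e: "angle s = arctan w0"
        then have c: "cos (angle s) \<noteq> 0" by simp
        have "(v, k) \<in> lattice 0 s"
          unfolding lattice_zero_cyclic[OF c] mem_cyclic_subgroup
          by (intro exI[of _ j]) (simp add: v j e tan_arctan q_def[symmetric])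
        with vk show False by simp
      qed
      then consider "angle s < arctan w0" | "arctan w0 < angle s" by linarith
      then have "\<exists>\<delta>>0. \<forall>\<^sub>F p in ?F. (fst p = 0 \<longrightarrow> base (snd p) = q \<and> cos (angle (snd p)) \<noteq> 0) \<longrightarrow>
          \<delta> \<le> \<bar>slope q (fst p) (snd p) - w0\<bar>"
      proof cases
        case 1
        \<comment> \<open>When the angle is \<open>- \<pi> / 2\<close> every real number is large enough.\<close>
        have "\<exists>x<w0. angle s < arctan x"
        proof (cases "cos (angle s) = 0")
          case True
          have "angle s \<noteq> pi / 2" using 1 arctan_bounded[of w0] by auto
          moreover have "angle s \<noteq> 0" using True by auto
          ultimately have "angle s < arctan (w0 - 1)"
            using True angle_range[of s] arctan_bounded[of "w0 - 1"] cos_gt_zero_pi[of "angle s"] by fastforce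
          then show ?thesis by (intro exI[of _ "w0 - 1"]) auto
        next
          case False
          then have "tan (angle s) < w0" using 1 cos_angle_nonzero(4)[OF False] arctan_less_iff by metis
          then obtain x where "tan (angle s) < x" "x < w0" using dense by blast
          then show ?thesis using cos_angle_nonzero(4)[OF False] arctan_less_iff by metis
        qed
        then obtain x where x: "x < w0" "angle s < arctan x" by blast
        have "s < height q (arctan x)"
          using lex_imp_height_less[OF blown_up_point(1)[of s] rational_in_carrier[OF q, of x]] x(2)
          by (auto simp: q_def blown_up_point)
        from eventually_less_threshold[OF q this] boundary_filter_tendsto(3)
        have "\<forall>\<^sub>F p in ?F. (fst p = 0 \<longrightarrow> base (snd p) = q \<and> cos (angle (snd p)) \<noteq> 0) \<longrightarrow>
          w0 - x \<le> \<bar>slope q (fst p) (snd p) - w0\<bar>"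
        proof eventually_elim
          case (elim p)
          then show ?case using slope_less[OF q elim] by fastforce
        qed
        then show ?thesis using x(1) by (intro exI[of _ "w0 - x"]) auto
      next
        case 2
        \<comment> \<open>When the angle is \<open>\<pi> / 2\<close> every real number is small enough.\<close>
        have "\<exists>x>w0. arctan x < angle s"
        proof (cases "cos (angle s) = 0")
          case True
          have "angle s \<noteq> - pi / 2" using 2 arctan_bounded[of w0] by auto
          then have "arctan (w0 + 1) < angle s"
            using True angle_range[of s] arctan_bounded[of "w0 + 1"] cos_gt_zero_pi[of "angle s"] by fastforce
          then show ?thesis by (intro exI[of _ "w0 + 1"]) auto
        next
          case False
          then have "w0 < tan (angle s)" using 2 cos_angle_nonzero(4)[OF False] arctan_less_iff by metis
          then obtain x where "w0 < x" "x < tan (angle s)" using dense by blast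
          then show ?thesis using cos_angle_nonzero(4)[OF False] arctan_less_iff by metis
        qed
        then obtain x where x: "w0 < x" "arctan x < angle s" by blast
        have "height q (arctan x) < s"
          using lex_imp_height_less[OF rational_in_carrier[OF q, of x] blown_up_point(1)[of s]] x(2)
          by (auto simp: q_def blown_up_point)
        from eventually_threshold_less[OF q this] boundary_filter_tendsto(3)
        have "\<forall>\<^sub>F p in ?F. (fst p = 0 \<longrightarrow> base (snd p) = q \<and> cos (angle (snd p)) \<noteq> 0) \<longrightarrow>
          x - w0 \<le> \<bar>slope q (fst p) (snd p) - w0\<bar>"
        proof eventually_elim
          case (elim p)
          then show ?case using less_slope[OF q elim] by fastforce
        qed
        then show ?thesis using x(1) by (intro exI[of _ "x - w0"]) auto
      qed
      then obtain \<delta> where \<delta>: "\<delta> > 0" "\<forall>\<^sub>F p in ?F.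
          (fst p = 0 \<longrightarrow> base (snd p) = q \<and> cos (angle (snd p)) \<noteq> 0) \<longrightarrow>
          \<delta> \<le> \<bar>slope q (fst p) (snd p) - w0\<bar>" by blast
      from \<epsilon>(2) \<delta>(2)
      have "\<forall>\<^sub>F p in ?F. \<forall>w. \<bar>w - v\<bar> < min \<epsilon> \<delta> \<longrightarrow> (w, k) \<notin> lattice (fst p) (snd p)"
      proof eventually_elim
        case (elim p)
        show ?case
        proof (intro allI impI notI)
          fix w assume w: "\<bar>w - v\<bar> < min \<epsilon> \<delta>" "(w, k) \<in> lattice (fst p) (snd p)"
          then have *: "w = of_int j * slope q (fst p) (snd p)"
            "fst p = 0 \<longrightarrow> base (snd p) = q \<and> cos (angle (snd p)) \<noteq> 0"
            using slope_eq[OF w(2)] elim(1) by auto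
          have "\<delta> \<le> \<bar>slope q (fst p) (snd p) - w0\<bar>" using elim(2) *(2) by blast
          also have "\<dots> \<le> \<bar>real_of_int j\<bar> * \<bar>slope q (fst p) (snd p) - w0\<bar>"
            using mult_right_mono[OF j1, of "\<bar>slope q (fst p) (snd p) - w0\<bar>"] by simp
          also have "\<dots> = \<bar>w - v\<bar>" by (simp add: *(1) v abs_mult[symmetric] right_diff_distrib)
          finally show False using w(1) by simp
        qed
      qed
      then show ?thesis using \<epsilon>(1) \<delta>(1) by (intro exI[of _ "min \<epsilon> \<delta>"]) auto
    qed
  qed
qed

section \<open>The family over the closed cone\<close>

definition family :: "ennreal \<Rightarrow> real \<Rightarrow> (real \<times> int) set" where
  "family a s = (if a = \<infinity> then UNIV else lattice (enn2real a) s)"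

lemma family_closed_subgroup: "family a s \<in> closed_subgroups"
  by (simp add: family_def lattice_closed_subgroup) (simp add: closed_subgroups_def)

lemma family_add_int: "family a (s + of_int n) = family a s"
  by (simp add: family_def lattice_add_int)

text \<open>At \<open>a = \<infinity>\<close> the lattices become dense: in the slice \<open>k\<close> they have a point within \<open>1 / a\<close> of any
  \<open>v\<close>.  For \<open>0 < a < \<infinity>\<close> nothing degenerates, and \<open>a = 0\<close> is \<open>lattice_limit_boundary\<close>.\<close>

lemma continuous_map_family:
  "continuous_map (prod_topology euclidean euclidean) chabauty_topology (\<lambda>(a, s). family a s)"
proof (rule continuous_map_chabauty_slicewise)
  fix p :: "ennreal \<times> real"
  obtain a s where p: "p = (a, s)" by (cases p)
  show "(case p of (a, s) \<Rightarrow> family a s) \<in> closed_subgroups" by (simp add: p family_closed_subgroup)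
  have nh: "nhdsin (prod_topology euclidean euclidean) p = nhds p"
    using nhdsin_top_of_set[of p UNIV] by simp
  have id: "((\<lambda>p. p) \<longlongrightarrow> (a, s)) (nhds p)" by (simp add: p filterlim_ident)
  have fst: "(fst \<longlongrightarrow> a) (nhds p)" and snd: "(snd \<longlongrightarrow> s) (nhds p)"
    using tendsto_fst[OF id] tendsto_snd[OF id] by simp_all
  have "slicewise_limit (\<lambda>p. family (fst p) (snd p)) (nhds p) (family a s)"
  proof (cases "a = \<infinity>")
    case True
    show ?thesis
    proof (rule slicewise_limitI)
      fix v k and \<epsilon> :: real assume \<epsilon>: "\<epsilon> > 0"
      have "ennreal (1 / \<epsilon>) < a" using True by simp
      from order_tendstoD(1)[OF fst this]
      show "\<forall>\<^sub>F p in nhds p. \<exists>w. \<bar>w - v\<bar> < \<epsilon> \<and> (w, k) \<in> family (fst p) (snd p)"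
      proof eventually_elim
        case (elim r)
        show ?case
        proof (cases "fst r = \<infinity>")
          case True
          then show ?thesis using \<epsilon> by (intro exI[of _ v]) (simp add: family_def)
        next
          case False
          define b where "b = enn2real (fst r)"
          have "fst r = ennreal b" using False by (simp add: b_def less_top infinity_ennreal_def)
          then have b1: "1 / \<epsilon> < b" using elim \<epsilon> by (simp add: ennreal_less_iff)
          then have b: "b > 0" using \<epsilon> by (meson less_trans zero_less_divide_1_iff)
          define y where "y = of_int k * offset b (snd r)"
          \<comment> \<open>The last point before \<open>v\<close> at which the form \<open>y - b w\<close> is an integer.\<close>
          define w where "w = (y + of_int \<lfloor>b * v - y\<rfloor>) / b"
          have "w - v = (of_int \<lfloor>b * v - y\<rfloor> - (b * v - y)) / b"
            using b by (simp add: w_def field_simps)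
          moreover have "\<bar>of_int \<lfloor>b * v - y\<rfloor> - (b * v - y)\<bar> \<le> 1" by linarith
          ultimately have "\<bar>w - v\<bar> \<le> 1 / b" using b by (simp add: divide_right_mono)
          also have "\<dots> < \<epsilon>" using b1 b \<epsilon> by (simp add: field_simps)
          finally have "\<bar>w - v\<bar> < \<epsilon>" .
          moreover have "y - b * w = - of_int \<lfloor>b * v - y\<rfloor>" using b by (simp add: w_def)
          then have "(w, k) \<in> lattice b (snd r)" using b by (simp add: mem_lattice y_def[symmetric])
          ultimately show ?thesis using False by (auto simp: family_def b_def)
        qed
      qed
    qed (simp add: family_def True)
  next
    case False
    define b where "b = enn2real a"
    have b: "a = ennreal b" "b \<ge> 0" using False by (simp_all add: b_def less_top infinity_ennreal_def)
    have lim: "((\<lambda>p. enn2real (fst p)) \<longlongrightarrow> b) (nhds p)"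
      using fst b by (intro tendsto_enn2real) auto
    have "slicewise_limit (\<lambda>p. lattice (enn2real (fst p)) (snd p)) (nhds p) (lattice b s)"
    proof (cases "b = 0")
      case True
      have "filterlim (\<lambda>p. (enn2real (fst p), snd p)) (boundary_filter s) (nhds p)"
        using tendsto_Pair[OF lim snd] by (simp add: True filterlim_inf filterlim_principal)
      from slicewise_limit_compose[OF lattice_limit_boundary this] show ?thesis by (simp add: True)
    next
      case False
      then show ?thesis
        using b(2) by (intro lattice_limit_interior offset_tendsto lim snd) auto
    qed
    moreover have "\<forall>\<^sub>F p in nhds p. fst p \<noteq> \<infinity>"
      using fst False by (rule tendsto_imp_eventually_ne)
    then have "\<forall>\<^sub>F p in nhds p. lattice (enn2real (fst p)) (snd p) = family (fst p) (snd p)"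
      by eventually_elim (simp add: family_def)
    ultimately have "slicewise_limit (\<lambda>p. family (fst p) (snd p)) (nhds p) (lattice b s)"
      by (rule slicewise_limit_cong)
    then show ?thesis using False by (simp add: family_def b_def)
  qed
  then show "slicewise_limit (\<lambda>(a, s). family a s) (nhdsin (prod_topology euclidean euclidean) p)
      (case p of (a, s) \<Rightarrow> family a s)"
    unfolding nh by (simp add: p case_prod_unfold)
qed

lemma topspace_circle: "topspace circle = range circle_class"
  by (simp add: circle_def)

definition circle_family :: "ennreal \<Rightarrow> real set \<Rightarrow> (real \<times> int) set" where
  "circle_family a C = family a (SOME s. s \<in> C)"

lemma circle_family_class: "circle_family a (circle_class s) = family a s"
proof -
  have "s \<in> circle_class s" by (simp add: circle_class_def)
  then have "(SOME t. t \<in> circle_class s) \<in> circle_class s" by (rule someI)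
  then obtain n where "(SOME t. t \<in> circle_class s) - s = of_int n"
    by (auto simp: circle_class_def elim: Ints_cases)
  then have "(SOME t. t \<in> circle_class s) = s + of_int n" by simp
  then show ?thesis by (simp only: circle_family_def family_add_int)
qed

lemma compact_ennreal: "compact_space (euclidean :: ennreal topology)"
  using compact_UNIV by (simp add: compact_space_def)

lemma Hausdorff_ennreal: "Hausdorff_space (euclidean :: ennreal topology)"
  using hausdorff by (fastforce simp: Hausdorff_space_def disjnt_def)

lemma continuous_map_circle_family:
  "continuous_map (prod_topology euclidean circle) chabauty_topology (\<lambda>(a, C). circle_family a C)"
proof (rule continuous_compose_quotient_map)
  show "quotient_map (prod_topology euclidean euclidean) (prod_topology euclidean circle)
      (\<lambda>(a :: ennreal, s). (a, circle_class s))"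
    unfolding circle_def
    using compact_imp_locally_compact_space[OF compact_ennreal] Hausdorff_ennreal
    by (intro quotient_map_prod_right quotient_map_final_topology) auto
  have "(\<lambda>(a, C). circle_family a C) \<circ> (\<lambda>(a, s). (a, circle_class s)) = (\<lambda>(a, s). family a s)"
    by (auto simp: circle_family_class)
  then show "continuous_map (prod_topology euclidean euclidean) chabauty_topology
      ((\<lambda>(a, C). circle_family a C) \<circ> (\<lambda>(a, s). (a, circle_class s)))"
    using continuous_map_family by (simp only:)
qed

section \<open>Height identifies the blown-up circle with the circle\<close>

lemma topspace_blown_up_line: "topspace blown_up_line = blown_up_carrier"
  unfolding blown_up_line_def order_topology_on_def topology_generated_by_topspace
  by (auto simp: blown_up_carrier_def)

lemma topspace_blown_up_circle:
  "topspace blown_up_circle = (\<lambda>(\<beta>, \<theta>). (circle_class \<beta>, \<theta>)) ` blown_up_carrier"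
  by (simp add: blown_up_circle_def topspace_blown_up_line)

lemma lex_iff_height_less:
  assumes "p \<in> blown_up_carrier" "q \<in> blown_up_carrier"
  shows "lex_le p q \<and> p \<noteq> q \<longleftrightarrow> height (fst p) (snd p) < height (fst q) (snd q)"
proof -
  have "lex_le p q \<and> p \<noteq> q \<longleftrightarrow> fst p < fst q \<or> fst p = fst q \<and> snd p < snd q"
    by (auto simp: lex_le_def prod_eq_iff)
  then show ?thesis
    using height_less_imp_lex[of "fst p" "snd p" "fst q" "snd q"]
      lex_imp_height_less[of "fst p" "snd p" "fst q" "snd q"] assms by auto
qed

text \<open>An increasing bijection is continuous for order topologies: since every real number is the height
  of a point, the preimages of open rays are open rays.\<close>

lemma continuous_map_height: "continuous_map blown_up_line euclideanreal (\<lambda>(\<beta>, \<theta>). height \<beta> \<theta>)"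
  unfolding continuous_map_upper_lower_semicontinuous_lt topspace_blown_up_line
proof (intro conjI allI)
  fix s
  define p where "p = blown_up_point s"
  have p: "p \<in> blown_up_carrier" "height (fst p) (snd p) = s"
    using blown_up_point[of s] by (simp_all add: p_def)
  have up: "{x \<in> blown_up_carrier. s < (case x of (\<beta>, \<theta>) \<Rightarrow> height \<beta> \<theta>)}
      = {x \<in> blown_up_carrier. lex_le p x \<and> x \<noteq> p}"
    using lex_iff_height_less[OF p(1)] by (auto simp: p(2) case_prod_unfold)
  have low: "{x \<in> blown_up_carrier. (case x of (\<beta>, \<theta>) \<Rightarrow> height \<beta> \<theta>) < s}
      = {x \<in> blown_up_carrier. lex_le x p \<and> x \<noteq> p}"
    using lex_iff_height_less[OF _ p(1)] by (auto simp: p(2) case_prod_unfold)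
  show "openin blown_up_line {x \<in> blown_up_carrier. s < (case x of (\<beta>, \<theta>) \<Rightarrow> height \<beta> \<theta>)}"
    unfolding up blown_up_line_def order_topology_on_def blown_up_carrier_def[symmetric]
    using p(1) by (intro topology_generated_by_Basis) auto
  show "openin blown_up_line {x \<in> blown_up_carrier. (case x of (\<beta>, \<theta>) \<Rightarrow> height \<beta> \<theta>) < s}"
    unfolding low blown_up_line_def order_topology_on_def blown_up_carrier_def[symmetric]
    using p(1) by (intro topology_generated_by_Basis) auto
qed

definition height_class :: "real set \<times> real \<Rightarrow> real set" where
  "height_class p = circle_class (height (SOME \<beta>. \<beta> \<in> fst p) (snd p))"

lemma height_class_eq:
  assumes "(\<beta>, \<theta>) \<in> blown_up_carrier"
  shows "height_class (circle_class \<beta>, \<theta>) = circle_class (height \<beta> \<theta>)"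
proof -
  have "\<beta> \<in> circle_class \<beta>" by (simp add: circle_class_def)
  then have "(SOME t. t \<in> circle_class \<beta>) \<in> circle_class \<beta>" by (rule someI)
  then obtain n where "(SOME t. t \<in> circle_class \<beta>) - \<beta> = of_int n"
    by (auto simp: circle_class_def elim: Ints_cases)
  then have n: "(SOME t. t \<in> circle_class \<beta>) = \<beta> + of_int n" by simp
  have "height (\<beta> + of_int n) \<theta> = height \<beta> \<theta> + of_int n"
    using assms by (intro height_add_int) (auto simp: blown_up_carrier_def)
  then show ?thesis by (simp add: height_class_def n circle_class_eq_iff)
qed

lemma continuous_map_height_class: "continuous_map blown_up_circle circle height_class"
  unfolding blown_up_circle_def
proof (rule continuous_compose_quotient_map[OF quotient_map_final_topology])
  have "continuous_map blown_up_line circle (circle_class \<circ> (\<lambda>(\<beta>, \<theta>). height \<beta> \<theta>))"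
    unfolding circle_def
    by (rule continuous_map_compose[OF continuous_map_height
          quotient_imp_continuous_map[OF quotient_map_final_topology]])
  then show "continuous_map blown_up_line circle (height_class \<circ> (\<lambda>(\<beta>, \<theta>). (circle_class \<beta>, \<theta>)))"
    by (rule continuous_map_eq) (auto simp: topspace_blown_up_line height_class_eq)
qed

lemma inj_on_height_class: "inj_on height_class (topspace blown_up_circle)"
proof (rule inj_onI)
  fix p p' assume "p \<in> topspace blown_up_circle" "p' \<in> topspace blown_up_circle"
    and eq: "height_class p = height_class p'"
  then obtain \<beta> \<theta> \<beta>' \<theta>' where p: "p = (circle_class \<beta>, \<theta>)" "p' = (circle_class \<beta>', \<theta>')"
    and c: "(\<beta>, \<theta>) \<in> blown_up_carrier" "(\<beta>', \<theta>') \<in> blown_up_carrier"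
    by (auto simp: topspace_blown_up_circle)
  from eq obtain n where "height \<beta> \<theta> - height \<beta>' \<theta>' = of_int n"
    using c by (auto simp: p height_class_eq circle_class_eq_iff elim: Ints_cases)
  then have n: "height \<beta> \<theta> = height \<beta>' \<theta>' + of_int n" by simp
  have "(\<beta>, \<theta>) = blown_up_point (height \<beta>' \<theta>' + of_int n)"
    by (simp only: n[symmetric] blown_up_point_height[OF c(1)])
  also have "\<dots> = (\<beta>' + of_int n, \<theta>')"
    by (simp only: blown_up_point_add_int blown_up_point_height[OF c(2)] fst_conv snd_conv)
  finally have "\<beta> = \<beta>' + of_int n" "\<theta> = \<theta>'" by simp_all
  then show "p = p'" by (simp add: p circle_class_eq_iff)
qed

lemma height_class_surj: "height_class ` topspace blown_up_circle = topspace circle"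
proof
  show "height_class ` topspace blown_up_circle \<subseteq> topspace circle"
    using continuous_map_height_class by (auto simp: continuous_map_def)
  show "topspace circle \<subseteq> height_class ` topspace blown_up_circle"
  proof
    fix C assume "C \<in> topspace circle"
    then obtain s where s: "C = circle_class s" by (auto simp: topspace_circle)
    have "C = height_class (circle_class (base s), angle s)"
      by (simp add: height_class_eq[OF blown_up_point(1)] blown_up_point(2) s)
    moreover have "(circle_class (base s), angle s) \<in> topspace blown_up_circle"
      unfolding topspace_blown_up_circle using blown_up_point(1)[of s]
      by (intro image_eqI[of _ _ "(base s, angle s)"]) (simp_all only: prod.case)
    ultimately show "C \<in> height_class ` topspace blown_up_circle" by blast
  qed
qed

section \<open>Functions on quotients\<close>

text \<open>For a function that is constant on the classes of a relation, its factorization through the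
  quotient.\<close>

definition lift :: "('a \<Rightarrow> 'b) \<Rightarrow> 'a set \<Rightarrow> 'b" where
  "lift f C = f (SOME x. x \<in> C)"

lemma lift_generated_class:
  assumes "\<And>x y. (x, y) \<in> r \<Longrightarrow> f x = f y"
  shows "lift f (generated_class r x) = f x"
proof -
  have "f y = f x" if "(x, y) \<in> (r \<union> r\<inverse>)\<^sup>*" for y
    using that by (induction rule: rtrancl_induct) (use assms in force)+
  moreover have "(SOME y. y \<in> generated_class r x) \<in> generated_class r x"
    by (rule someI[of "\<lambda>y. y \<in> generated_class r x", OF generated_class_self])
  then have "(x, SOME y. y \<in> generated_class r x) \<in> (r \<union> r\<inverse>)\<^sup>*"
    unfolding generated_class_def by blast
  ultimately show ?thesis unfolding lift_def by blast
qed

lemma continuous_map_lift: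
  assumes "\<And>x y. (x, y) \<in> r \<Longrightarrow> f x = f y" "continuous_map X Y f"
  shows "continuous_map (quotient_topology X r) Y (lift f)"
  unfolding quotient_topology_def
proof (rule continuous_compose_quotient_map[OF quotient_map_final_topology])
  have "lift f \<circ> generated_class r = f" using lift_generated_class[of r f, OF assms(1)] by auto
  then show "continuous_map X Y (lift f \<circ> generated_class r)" using assms(2) by simp
qed

lemma generated_class_eqI:
  assumes "(x, y) \<in> r"
  shows "generated_class r x = generated_class r y"
proof -
  let ?E = "(r \<union> r\<inverse>)\<^sup>*"
  have "sym ?E" by (intro sym_rtrancl) (auto simp: sym_def)
  moreover have "(x, y) \<in> ?E" using assms by auto
  ultimately have "(y, x) \<in> ?E" "(x, y) \<in> ?E" by (auto dest: symD)
  then show ?thesis unfolding generated_class_def by (auto intro: rtrancl_trans)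
qed

lemma compact_space_quotient_topology:
  assumes "compact_space X"
  shows "compact_space (quotient_topology X r)"
  unfolding quotient_topology_def compact_space_def topspace_final_topology
  by (rule image_compactin[of X])
    (use assms in \<open>auto simp: compact_space_def intro: quotient_imp_continuous_map quotient_map_final_topology\<close>)

lemma topspace_quotient_topology: "topspace (quotient_topology X r) = generated_class r ` topspace X"
  by (simp add: quotient_topology_def)

lemma compact_space_disjoint_union:
  assumes "compact_space X" "compact_space Y"
  shows "compact_space (disjoint_union_topology X Y)"
proof -
  let ?D = "disjoint_union_topology X Y"
  have "continuous_map X ?D Inl" "continuous_map Y ?D Inr"
  proof -
    have "{x \<in> topspace X. Inl x \<in> U} = Inl -` U" "{y \<in> topspace Y. Inr y \<in> U} = Inr -` U"
      if "openin ?D U" for U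
      using that by (auto simp: openin_disjoint_union_topology dest!: openin_subset)
    then show "continuous_map X ?D Inl" "continuous_map Y ?D Inr"
      by (auto simp: continuous_map_def openin_disjoint_union_topology)
  qed
  then have "compactin ?D (Inl ` topspace X)" "compactin ?D (Inr ` topspace Y)"
    using assms by (auto simp: compact_space_def intro: image_compactin)
  then have "compactin ?D (Inl ` topspace X \<union> Inr ` topspace Y)" by (rule compactin_Un)
  then show ?thesis by (simp add: compact_space_def Plus_def)
qed

lemma continuous_map_case_sum:
  assumes "continuous_map X Z f" "continuous_map Y Z g"
  shows "continuous_map (disjoint_union_topology X Y) Z (case_sum f g)"
  unfolding continuous_map_def
proof (intro conjI allI impI)
  show "case_sum f g \<in> topspace (disjoint_union_topology X Y) \<rightarrow> topspace Z"
    using assms by (auto simp: continuous_map_def)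
  fix U assume U: "openin Z U"
  have "Inl -` {x \<in> topspace X <+> topspace Y. case_sum f g x \<in> U} = {x \<in> topspace X. f x \<in> U}"
    "Inr -` {x \<in> topspace X <+> topspace Y. case_sum f g x \<in> U} = {x \<in> topspace Y. g x \<in> U}"
    by auto
  then show "openin (disjoint_union_topology X Y)
      {x \<in> topspace (disjoint_union_topology X Y). case_sum f g x \<in> U}"
    using openin_continuous_map_preimage[OF assms(1) U] openin_continuous_map_preimage[OF assms(2) U]
    by (simp add: openin_disjoint_union_topology)
qed

section \<open>Closed subgroups of the real line\<close>

lemma int_multiple_in_subgroup:
  assumes "H \<in> closed_subgroups" "(v, k) \<in> H"
  shows "(of_int i * v, i * k) \<in> (H :: (real \<times> int) set)"
proof -
  note H = closed_subgroupsD[OF assms(1)]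
  have nat: "(of_nat j * v, int j * k) \<in> H" for j
  proof (induction j)
    case 0
    then show ?case using H(2) by (simp add: zero_prod_def)
  next
    case (Suc j)
    then show ?case using H(3)[OF assms(2) Suc] by (simp add: algebra_simps)
  qed
  show ?thesis
  proof (cases "i \<ge> 0")
    case True
    then show ?thesis using nat[of "nat i"] by simp
  next
    case False
    then show ?thesis using H(4)[OF nat[of "nat (- i)"]] by simp
  qed
qed

text \<open>Let \<open>c\<close> be the infimum of the positive elements.  If \<open>c = 0\<close> the group is dense, hence everything;
  otherwise \<open>c\<close> belongs to the group and division with remainder shows that it generates.\<close>

lemma real_closed_subgroup_cases:
  assumes "K \<in> (closed_subgroups :: real set set)" and mult: "\<And>i v. v \<in> K \<Longrightarrow> of_int i * v \<in> K"
  obtains "K = {0}" | "K = UNIV" | a where "a > 0" "K = {v. a * v \<in> \<int>}"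
proof (cases "K = {0}")
  case False
  note K = closed_subgroupsD[OF assms(1)]
  define P where "P = {v \<in> K. v > 0}"
  obtain v where v: "v \<in> K" "v \<noteq> 0" using False K(2) by auto
  then have "\<bar>v\<bar> \<in> P" using K(4) by (auto simp: P_def abs_if)
  then have ne: "P \<noteq> {}" by blast
  have bdd: "bdd_below P" by (intro bdd_belowI[of _ 0]) (auto simp: P_def)
  define c where "c = Inf P"
  have c0: "c \<ge> 0" unfolding c_def using ne by (intro cInf_greatest) (auto simp: P_def)
  have rem: "v - of_int i * p \<in> K" if "v \<in> K" "p \<in> K" for v i p
    using K(3)[OF that(1) K(4)[OF mult[OF that(2), of i]]] by simp
  show ?thesis
  proof (cases "c = 0")
    case True
    have "v \<in> K" for v
    proof -
      have "v \<in> closure K"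
        unfolding closure_approachable
      proof (intro allI impI)
        fix e :: real assume e: "e > 0"
        then obtain p where p: "p \<in> P" "p < e" using cInf_less_iff[OF ne bdd, of e] True c_def by auto
        then have pp: "p > 0" "p \<in> K" by (auto simp: P_def)
        have "of_int \<lfloor>v / p\<rfloor> * p \<le> v" "v < of_int \<lfloor>v / p\<rfloor> * p + p"
          using floor_divide_lower[OF pp(1), of v] floor_divide_upper[OF pp(1), of v]
          by (simp_all add: distrib_right)
        then have "dist (of_int \<lfloor>v / p\<rfloor> * p) v < e" using p(2) by (simp add: dist_real_def)
        then show "\<exists>y\<in>K. dist y v < e" using mult[OF pp(2)] by blast
      qed
      then show ?thesis using K(1) by simp
    qed
    then show ?thesis using that(2) by blast
  next
    case False
    then have c: "c > 0" using c0 by simp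
    have "c \<in> closure P" unfolding c_def by (rule closure_contains_Inf[OF ne bdd])
    moreover have "closure P \<subseteq> K" using K(1) by (intro closure_minimal) (auto simp: P_def)
    ultimately have cK: "c \<in> K" by blast
    have "v \<in> K \<longleftrightarrow> (1 / c) * v \<in> \<int>" for v
    proof
      assume v: "v \<in> K"
      define u where "u = v - of_int \<lfloor>v / c\<rfloor> * c"
      have u: "0 \<le> u" "u < c"
        using floor_divide_lower[OF c, of v] floor_divide_upper[OF c, of v]
        by (simp_all add: u_def distrib_right)
      have "u \<in> K" unfolding u_def by (rule rem[OF v cK])
      then have "\<not> u > 0" using cInf_lower[OF _ bdd, of u] u(2) by (auto simp: P_def c_def)
      then have "u = 0" using u(1) by simp
      then have "(1 / c) * v = of_int \<lfloor>v / c\<rfloor>" using c by (simp add: u_def field_simps)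
      then show "(1 / c) * v \<in> \<int>" by (metis Ints_of_int)
    next
      assume "(1 / c) * v \<in> \<int>"
      then obtain i where "(1 / c) * v = of_int i" by (auto elim: Ints_cases)
      then have "v = of_int i * c" using c by (simp add: field_simps)
      then show "v \<in> K" using mult[OF cK] by simp
    qed
    then show ?thesis using that(3)[of "1 / c"] c by auto
  qed
qed (use that in blast)

section \<open>Recovering the parameters from the subgroup\<close>

lemma mem_lattice_zero: "(v, 0) \<in> lattice a s \<longleftrightarrow> (if a = 0 then v = 0 else a * v \<in> \<int>)"
proof (cases "a = 0")
  case True
  show ?thesis
  proof (cases "cos (angle s) = 0")
    case True
    then show ?thesis using \<open>a = 0\<close> by (simp add: lattice_zero_pole zero_prod_def)
  next
    case False
    then show ?thesis using \<open>a = 0\<close> denominator(1)[OF cos_angle_nonzero(1)[OF False]]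
      by (auto simp: lattice_zero_cyclic mem_cyclic_subgroup)
  qed
qed (simp add: mem_lattice)

lemma stretch_zero_family: "stretch {0} (family a s) = stretch {0} (family a t)"
proof -
  have "(v, 0) \<in> family a s \<longleftrightarrow> (v, 0) \<in> family a t" for v
    by (simp add: family_def mem_lattice_zero)
  then show ?thesis by (intro set_eqI) (simp only: split_paired_all mem_stretch_zero_group)
qed

lemma mem_stretch_zero: "N \<in> closed_subgroups \<Longrightarrow> (v, 0) \<in> stretch N L \<longleftrightarrow> (v, 0) \<in> L"
  by (erule int_closed_subgroup_multiples) (simp add: mem_stretch)

lemma family_nontrivial:
  assumes "a \<noteq> 0"
  obtains v where "v \<noteq> 0" "(v, 0) \<in> family a s"
proof (cases "a = \<infinity>")
  case True
  then show ?thesis using that[of 1] by (simp add: family_def)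
next
  case False
  then have "enn2real a \<noteq> 0" using assms by (auto simp: enn2real_eq_0_iff infinity_ennreal_def)
  then show ?thesis using that[of "1 / enn2real a"] False by (simp add: family_def mem_lattice_zero)
qed

text \<open>A lattice of real numbers determines its positive generator: the quotient of two generators is a
  positive integer, and so is its inverse.\<close>

lemma family_scale_unique:
  assumes "a \<noteq> 0" "b \<noteq> 0" and eq: "\<And>v. (v, 0) \<in> family a s \<longleftrightarrow> (v, 0) \<in> family b t"
  shows "a = b"
proof -
  have half: "(1 / (2 * enn2real c), 0) \<notin> family c u" if "c \<noteq> 0" "c \<noteq> \<infinity>" for c u
  proof -
    have "enn2real c \<noteq> 0" using that by (auto simp: enn2real_eq_0_iff infinity_ennreal_def)
    moreover have "(1 / 2 :: real) \<notin> \<int>" using Ints_close_eq[of "1 / 2 :: real" 0] by auto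
    ultimately show ?thesis using that by (simp add: family_def mem_lattice_zero)
  qed
  show ?thesis
  proof (cases "a = \<infinity> \<or> b = \<infinity>")
    case True
    moreover have "(v, 0) \<in> family \<infinity> u" for v u by (simp add: family_def)
    ultimately show ?thesis using half[of a s] half[of b t] eq assms(1,2) by metis
  next
    case False
    define x where "x = enn2real a"
    define y where "y = enn2real b"
    have ab: "a = ennreal x" "b = ennreal y" "x > 0" "y > 0"
      using False assms(1,2)
      by (auto simp: x_def y_def infinity_ennreal_def less_top enn2real_positive_iff zero_less_iff_neq_zero)
    have e: "x * v \<in> \<int> \<longleftrightarrow> y * v \<in> \<int>" for v
      using eq[of v] False ab(3,4) by (simp add: family_def mem_lattice_zero x_def y_def)
    have "x / y \<in> \<int>" "y / x \<in> \<int>" using e[of "1 / x"] e[of "1 / y"] ab(3,4) by auto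
    then obtain i j where ij: "x / y = of_int i" "y / x = of_int j" by (auto elim!: Ints_cases)
    have "real_of_int i > 0" "real_of_int j > 0" using ab(3,4) by (simp_all add: ij[symmetric])
    then have "i \<ge> 1" "j \<ge> 1" by linarith+
    then have "x / y \<ge> 1" "y / x \<ge> 1" by (simp_all add: ij)
    then have "x = y" using ab(3,4) by (simp add: field_simps)
    then show ?thesis using ab by simp
  qed
qed

lemma family_projection: "a \<noteq> 0 \<Longrightarrow> \<exists>v. (v, k) \<in> family a s"
proof (cases "a = \<infinity>")
  case False
  assume "a \<noteq> 0"
  then have "enn2real a \<noteq> 0" using False by (auto simp: enn2real_eq_0_iff infinity_ennreal_def)
  then show ?thesis using False
    by (intro exI[of _ "of_int k * offset (enn2real a) s / enn2real a"]) (simp add: family_def mem_lattice)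
qed (simp add: family_def)

lemma family_parameter_unique:
  assumes "a \<noteq> 0" "a \<noteq> \<infinity>" "family a s = family a t"
  shows "circle_class s = circle_class t"
proof -
  define x where "x = enn2real a"
  have x: "x > 0"
    using assms(1,2) by (auto simp: x_def infinity_ennreal_def less_top enn2real_positive_iff zero_less_iff_neq_zero)
  have L: "lattice x s = lattice x t" using assms by (simp add: family_def x_def)
  have "(offset x s / x, 1) \<in> lattice x s" using x by (simp add: mem_lattice)
  then have "offset x t - offset x s \<in> \<int>" using x unfolding L by (simp add: mem_lattice)
  then obtain n where "offset x t - offset x s = of_int n" by (auto elim: Ints_cases)
  then have "warp x (offset x t) = warp x (offset x s) + of_int n"
    using warp_add_int[of x "offset x s" n] by (simp add: algebra_simps)
  then have "t = s + of_int n" using x by (simp add: warp_offset)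
  then show ?thesis by (simp add: circle_class_eq_iff)
qed

section \<open>The map on the adjunction space\<close>

text \<open>Composing a homeomorphism onto the blown-up circle with the height gives a self-homeomorphism of
  the circle, called \<open>parameter\<close> below, and the family is pulled back along it.\<close>

locale blown_up_circle_parametrization =
  fixes \<xi> :: "real set \<Rightarrow> real set \<times> real"
  assumes homeo: "homeomorphic_map circle blown_up_circle \<xi>"
begin

definition parameter :: "real set \<Rightarrow> real set" where
  "parameter x = height_class (\<xi> x)"

lemma xi_image: "\<xi> ` topspace circle = topspace blown_up_circle"
  and xi_inj: "inj_on \<xi> (topspace circle)"
  and xi_continuous: "continuous_map circle blown_up_circle \<xi>"
  using homeo by (auto simp: homeomorphic_eq_everything_map)

lemma parameter_comp: "parameter = height_class \<circ> \<xi>"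
  by (simp add: fun_eq_iff parameter_def)

lemma parameter_continuous: "continuous_map circle circle parameter"
  unfolding parameter_comp by (rule continuous_map_compose[OF xi_continuous continuous_map_height_class])

lemma parameter_inj: "inj_on parameter (topspace circle)"
  unfolding parameter_comp
  by (rule comp_inj_on[OF xi_inj]) (simp add: xi_image inj_on_height_class)

lemma parameter_image: "parameter ` topspace circle = topspace circle"
  unfolding parameter_comp by (simp only: image_comp[symmetric] xi_image height_class_surj)

lemma parameter_class:
  assumes "x \<in> topspace circle"
  obtains s where "parameter x = circle_class s"
proof -
  have "parameter x \<in> range circle_class"
    using assms parameter_image topspace_circle by (metis image_eqI)
  then show thesis using that by auto
qed

definition cone_family :: "ennreal \<times> real set \<Rightarrow> (real \<times> int) set" where
  "cone_family = (\<lambda>(a, x). circle_family a (parameter x))"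

lemma cone_family_eq: "parameter x = circle_class s \<Longrightarrow> cone_family (a, x) = family a s"
  by (simp add: cone_family_def circle_family_class)

lemma continuous_map_cone_family:
  "continuous_map (prod_topology euclidean circle) chabauty_topology cone_family"
proof -
  have "continuous_map (prod_topology euclidean circle) (prod_topology euclidean circle)
      (\<lambda>(a :: ennreal, x). (a, parameter x))"
    using parameter_continuous by (simp add: continuous_map_prod_top)
  from continuous_map_compose[OF this continuous_map_circle_family]
  show ?thesis by (simp add: cone_family_def comp_def case_prod_unfold)
qed

lemma cone_family_respects: "(p, q) \<in> cone_rel \<Longrightarrow> cone_family p = cone_family q"
  by (auto simp: cone_rel_def cone_family_def circle_family_def family_def)

lemma lift_cone_family: "lift cone_family (cone_point a x) = cone_family (a, x)"
  unfolding cone_point_def by (rule lift_generated_class[OF cone_family_respects])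

definition layer_family :: "int set \<times> (ennreal \<times> real set) set \<Rightarrow> (real \<times> int) set" where
  "layer_family = (\<lambda>(N, c). stretch N (lift cone_family c))"

lemma layer_family_point:
  "parameter x = circle_class s \<Longrightarrow> layer_family (N, cone_point a x) = stretch N (family a s)"
  by (simp add: layer_family_def lift_cone_family cone_family_eq)

lemma continuous_map_layer_family:
  "continuous_map (prod_topology chabauty_topology closed_cone) chabauty_topology layer_family"
proof -
  have "continuous_map closed_cone chabauty_topology (lift cone_family)"
    unfolding closed_cone_def by (rule continuous_map_lift[OF cone_family_respects continuous_map_cone_family])
  then have "continuous_map (prod_topology chabauty_topology closed_cone)
      (prod_topology chabauty_topology chabauty_topology) (\<lambda>(N, c). (N, lift cone_family c))"
    by (simp add: continuous_map_prod_top)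
  from continuous_map_compose[OF this continuous_map_stretch]
  show ?thesis by (simp add: layer_family_def comp_def case_prod_unfold)
qed

lemma layer_family_respects:
  assumes "(p, q) \<in> infinite_cone_rel"
  shows "layer_family p = layer_family q"
proof -
  obtain a x y where pq: "p = ({0}, cone_point a x)" "q = ({0}, cone_point a y)"
    "x \<in> topspace circle" "y \<in> topspace circle"
    using assms by (auto simp: infinite_cone_rel_def)
  obtain s t where "parameter x = circle_class s" "parameter y = circle_class t"
    using pq parameter_class by metis
  then show ?thesis using stretch_zero_family[of a s t] by (simp add: pq layer_family_point)
qed

lemma lift_layer_family:
  "lift layer_family (infinite_cone_point N c) = layer_family (N, c)"
  unfolding infinite_cone_point_def by (rule lift_generated_class[OF layer_family_respects])

text \<open>Over the boundary of the cone the family is the one of the earring, transported by the attaching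
  map.\<close>

lemma boundary_value:
  assumes "x \<in> topspace circle"
  obtains m \<theta> where "m > 0" "\<theta> \<in> {- pi/2 .. pi/2}" "cone_attach \<xi> (cone_point 0 x) = earring_point m \<theta>"
    "lift cone_family (cone_point 0 x) = earring_subgroup (earring_point m \<theta>)"
proof -
  have "\<xi> x \<in> topspace blown_up_circle" using assms xi_image by blast
  then obtain \<beta> \<theta> where \<xi>: "\<xi> x = (circle_class \<beta>, \<theta>)" and c: "(\<beta>, \<theta>) \<in> blown_up_carrier"
    by (auto simp: topspace_blown_up_circle)
  have \<theta>: "\<theta> \<in> {- pi/2 .. pi/2}" using c by (simp add: blown_up_carrier_def)
  define s where "s = height \<beta> \<theta>"
  have p: "base s = \<beta>" "angle s = \<theta>" using blown_up_point_height[OF c] by (simp_all add: s_def)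
  have "parameter x = circle_class s" by (simp add: parameter_def \<xi> height_class_eq[OF c] s_def)
  then have L: "lift cone_family (cone_point 0 x) = lattice 0 s"
    by (simp add: lift_cone_family cone_family_eq family_def)
  show thesis
  proof (cases "\<beta> \<in> \<rat>")
    case True
    then obtain r where r: "\<beta> = of_rat r" by (auto elim: Rats_cases)
    obtain a d where ad: "quotient_of r = (a, d)" by (cases "quotient_of r")
    define b where "b = nat d"
    have b: "b > 0" "d = int b" using quotient_of_denom_pos[OF ad] by (simp_all add: b_def)
    have cop: "coprime a (int b)" using quotient_of_coprime[OF ad] b by simp
    have \<beta>: "\<beta> = of_int a / of_nat b"
      using quotient_of_div[OF ad] by (simp add: r b(2) of_rat_divide)
    have att: "cone_attach \<xi> (cone_point 0 x) = earring_point b \<theta>"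
      using cone_attach_rational[OF assms b(1) cop, of \<xi>] by (simp add: \<xi> \<beta>)
    have den: "denominator \<beta> = b" unfolding \<beta> by (rule denominator_fraction[OF b(1) cop])
    have "lattice 0 s = earring_subgroup (earring_point b \<theta>)"
    proof (cases "cos \<theta> = 0")
      case True
      then show ?thesis by (simp add: lattice_zero_pole p earring_point_end earring_subgroup_zero)
    next
      case False
      then show ?thesis by (simp add: lattice_zero_cyclic p den earring_subgroup_point[OF b(1)])
    qed
    then show ?thesis using that[OF b(1) \<theta> att] L by simp
  next
    case False
    then have "\<theta> = pi / 2" using c by (simp add: blown_up_carrier_def)
    then have "cos \<theta> = 0" by (simp only: cos_pi_half)
    moreover have "circle_class \<beta> \<notin> circle_class ` \<rat>"
    proof
      assume "circle_class \<beta> \<in> circle_class ` \<rat>"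
      then obtain q where q: "q \<in> \<rat>" "\<beta> - q \<in> \<int>" by (auto simp: circle_class_eq_iff)
      then have "\<beta> - q + q \<in> \<rat>" using Ints_subset_Rats by (intro Rats_add) auto
      with False show False by simp
    qed
    then have "cone_attach \<xi> (cone_point 0 x) = 0"
      by (intro cone_attach_irrational[OF assms]) (simp add: \<xi>)
    ultimately show ?thesis using that[of 1 \<theta>] \<theta> L
      by (simp add: lattice_zero_pole p earring_point_end earring_subgroup_zero)
  qed
qed

lemma attach_value:
  assumes "b \<in> infinite_cone_boundary"
  shows "infinite_cone_attach \<xi> b \<in> hawaiian_earring"
    "earring_subgroup (infinite_cone_attach \<xi> b) = lift layer_family b"
proof -
  obtain N x where N: "N \<in> closed_subgroups" "x \<in> topspace circle"
    and b: "b = infinite_cone_point N (cone_point 0 x)"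
    using assms by (auto simp: infinite_cone_boundary_def cone_boundary_def)
  obtain n where n: "N = multiples n" by (rule int_closed_subgroup_multiples[OF N(1)])
  have cb: "cone_point 0 x \<in> cone_boundary" using N by (simp add: cone_boundary_def)
  obtain m \<theta> where m: "m > 0" "\<theta> \<in> {- pi/2 .. pi/2}" "cone_attach \<xi> (cone_point 0 x) = earring_point m \<theta>"
    "lift cone_family (cone_point 0 x) = earring_subgroup (earring_point m \<theta>)"
    by (rule boundary_value[OF N(2)])
  have F: "lift layer_family b = stretch (multiples n) (earring_subgroup (earring_point m \<theta>))"
    unfolding b n lift_layer_family by (simp add: layer_family_def m(4))
  consider "n = 0" | "n > 0" by blast
  then have "infinite_cone_attach \<xi> b \<in> hawaiian_earring \<and>
    earring_subgroup (infinite_cone_attach \<xi> b) = lift layer_family b"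
  proof cases
    case 1
    then have "infinite_cone_attach \<xi> b = 0"
      using infinite_cone_attach_zero[OF cb, of \<xi>] by (simp add: b n)
    then show ?thesis
      using F 1 zero_in_earring stretch_zero_earring[OF earring_point_in[OF m(1)]]
      by (simp add: earring_subgroup_zero)
  next
    case 2
    then have "infinite_cone_attach \<xi> b = earring_point (n * m) \<theta>"
      using infinite_cone_attach_pos[OF cb 2 m(1,2,3)] by (simp add: b n)
    then show ?thesis using F 2 m(1) by (simp add: earring_point_in stretch_earring_point)
  qed
  then show "infinite_cone_attach \<xi> b \<in> hawaiian_earring"
    "earring_subgroup (infinite_cone_attach \<xi> b) = lift layer_family b" by auto
qed

abbreviation glued_family where
  "glued_family \<equiv> case_sum (lift layer_family) earring_subgroup"

abbreviation gluing_rel where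
  "gluing_rel \<equiv> {(Inl b, Inr (infinite_cone_attach \<xi> b)) | b. b \<in> infinite_cone_boundary}"

lemma glued_family_respects: "(u, v) \<in> gluing_rel \<Longrightarrow> glued_family u = glued_family v"
  by (auto simp: attach_value(2))

abbreviation cone_element :: "int set \<Rightarrow> ennreal \<Rightarrow> real set \<Rightarrow>
    (int set \<times> (ennreal \<times> real set) set) set + complex" where
  "cone_element N a x \<equiv> Inl (infinite_cone_point N (cone_point a x))"

lemma topspace_infinite_cone:
  "e \<in> topspace infinite_cone \<longleftrightarrow>
     (\<exists>N a x. e = infinite_cone_point N (cone_point a x) \<and> N \<in> closed_subgroups \<and> x \<in> topspace circle)"
proof -
  have "c \<in> topspace closed_cone \<longleftrightarrow> (\<exists>a x. c = cone_point a x \<and> x \<in> topspace circle)" for c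
    by (auto simp: closed_cone_def topspace_quotient_topology cone_point_def)
  then show ?thesis
    by (auto simp: infinite_cone_def topspace_quotient_topology infinite_cone_point_def image_iff Bex_def)
qed

text \<open>Boundary points of the infinite cone are replaced by the points of the earring to which they are
  glued, so that only the subgroups meeting \<open>\<real>\<close> nontrivially remain represented in the cone.\<close>

lemma normal_form:
  assumes "u \<in> topspace infinite_cone <+> hawaiian_earring"
  obtains z where "z \<in> hawaiian_earring" "generated_class gluing_rel u = generated_class gluing_rel (Inr z)"
    "glued_family u = earring_subgroup z"
  | n a x s where "a \<noteq> 0" "x \<in> topspace circle" "parameter x = circle_class s" "u = cone_element (multiples n) a x"
    "glued_family u = stretch (multiples n) (family a s)"
  using assms
proof (cases u)
  case (Inr z)
  then show ?thesis using assms that(1)[of z] by auto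
next
  case (Inl e)
  then obtain N a x where e: "e = infinite_cone_point N (cone_point a x)"
    "N \<in> closed_subgroups" "x \<in> topspace circle"
    using assms by (auto simp: topspace_infinite_cone)
  show ?thesis
  proof (cases "a = 0")
    case True
    then have b: "e \<in> infinite_cone_boundary"
      using e by (auto simp: infinite_cone_boundary_def cone_boundary_def)
    then have "(u, Inr (infinite_cone_attach \<xi> e)) \<in> gluing_rel" by (auto simp: Inl)
    then have "generated_class gluing_rel u = generated_class gluing_rel (Inr (infinite_cone_attach \<xi> e))"
      by (rule generated_class_eqI)
    then show ?thesis using that(1) attach_value[OF b] by (simp add: Inl)
  next
    case False
    obtain n where "N = multiples n" by (rule int_closed_subgroup_multiples[OF e(2)])
    moreover obtain s where "parameter x = circle_class s" by (rule parameter_class[OF e(3)])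
    ultimately show ?thesis using that(2)[OF False e(3), of s n]
      by (simp add: Inl e(1) lift_layer_family layer_family_point)
  qed
qed

text \<open>Intersection with \<open>\<real>\<close> separates the earring from the cones and recovers \<open>a\<close>, the projection
  recovers \<open>n\<close>, and for \<open>n > 0\<close> and \<open>a < \<infinity>\<close> the slice \<open>k = n\<close> recovers the point of the circle.  In the
  remaining cases the definition of the quotients has already identified the points.\<close>

lemma glued_family_inj:
  assumes u: "u \<in> topspace infinite_cone <+> hawaiian_earring"
    and v: "v \<in> topspace infinite_cone <+> hawaiian_earring"
    and eq: "glued_family u = glued_family v"
  shows "generated_class gluing_rel u = generated_class gluing_rel v"
proof -
  have mixed: False if m: "z \<in> hawaiian_earring" "a \<noteq> 0" "earring_subgroup z = stretch (multiples n) (family a s)"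
    for z a n s
  proof -
    obtain w where "w \<noteq> 0" "(w, 0) \<in> family a s" by (rule family_nontrivial[OF m(2)])
    then show False
      using m(1,3) mem_earring_subgroup_zero mem_stretch_zero[OF multiples_closed_subgroup] by blast
  qed
  from u show ?thesis
  proof (cases rule: normal_form)
    case u': (1 z)
    from v show ?thesis
    proof (cases rule: normal_form)
      case (1 w)
      then have "z = w" using u' eq earring_subgroup_inj by (auto dest: inj_onD)
      then show ?thesis using 1 u' by simp
    next
      case (2 n a x s)
      then show ?thesis using mixed[OF u'(1) 2(1)] u' eq by metis
    qed
  next
    case u': (2 n a x s)
    from v show ?thesis
    proof (cases rule: normal_form)
      case (1 w)
      then show ?thesis using mixed[OF 1(1) u'(1)] u' eq by metis
    next
      case v': (2 n' a' x' s')
      have S: "stretch (multiples n) (family a s) = stretch (multiples n') (family a' s')"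
        using eq u'(5) v'(5) by simp
      have "a = a'"
      proof (rule family_scale_unique[OF u'(1) v'(1)])
        show "(w, 0) \<in> family a s \<longleftrightarrow> (w, 0) \<in> family a' s'" for w
          using S mem_stretch_zero[OF multiples_closed_subgroup] by blast
      qed
      have proj: "k \<in> multiples j \<longleftrightarrow> (\<exists>w. (w, k) \<in> stretch (multiples j) (family c t))"
        if "c \<noteq> 0" for k j c t
        using family_projection[OF that] by (auto simp: mem_stretch mem_multiples)
      have "k \<in> multiples n \<longleftrightarrow> k \<in> multiples n'" for k
        unfolding proj[OF u'(1), of k n s] proj[OF v'(1), of k n' s'] S by (rule refl)
      then have "multiples n = multiples n'" by blast
      then have n: "n = n'" by (simp only: multiples_eq_iff)
      have "infinite_cone_point (multiples n) (cone_point a x) = infinite_cone_point (multiples n) (cone_point a x')"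
      proof (cases "n = 0")
        case True
        have "(({0}, cone_point a x), ({0}, cone_point a x')) \<in> infinite_cone_rel"
          using u'(2) v'(2) by (auto simp: infinite_cone_rel_def)
        then show ?thesis unfolding infinite_cone_point_def True multiples_0 by (rule generated_class_eqI)
      next
        case False
        have "(w, l) \<in> family a s \<longleftrightarrow> (w, l) \<in> family a s'" for w l
        proof -
          have "(w, int n * l) \<in> stretch (multiples n) L \<longleftrightarrow> (w, l) \<in> L" for L
            using False by (simp add: mem_stretch)
          then show ?thesis using S n \<open>a = a'\<close> by blast
        qed
        then have fam: "family a s = family a s'" by auto
        have "cone_point a x = cone_point a x'"
        proof (cases "a = \<infinity>")
          case True
          have "((\<infinity>, x), (\<infinity>, x')) \<in> cone_rel" using u'(2) v'(2) by (auto simp: cone_rel_def)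
          then show ?thesis unfolding cone_point_def True by (rule generated_class_eqI)
        next
          case fin: False
          have "parameter x = parameter x'"
            using family_parameter_unique[OF u'(1) fin fam] u'(3) v'(3) by simp
          then show ?thesis using parameter_inj u'(2) v'(2) by (auto dest: inj_onD)
        qed
        then show ?thesis by simp
      qed
      then show ?thesis using u'(4) v'(4) n \<open>a = a'\<close> by simp
    qed
  qed
qed

lemma parameter_surj:
  obtains x where "x \<in> topspace circle" "parameter x = circle_class s"
proof -
  have "circle_class s \<in> parameter ` topspace circle" by (simp only: parameter_image) (simp add: topspace_circle)
  then show thesis using that by force
qed

text \<open>Take \<open>w\<close> with \<open>(w, n) \<in> H\<close>, where \<open>n\<close> generates the projection of \<open>H\<close>, and let \<open>K\<close> be the
  intersection with \<open>\<real>\<close>.  Then \<open>(v, n l) \<in> H\<close> means \<open>v - l w \<in> K\<close>, and the three possibilities for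
  \<open>K\<close> give an earring point, a cone apex, or the lattice with \<open>y = a w\<close>.\<close>

lemma glued_family_surj:
  assumes H: "H \<in> closed_subgroups"
  obtains u where "u \<in> topspace infinite_cone <+> hawaiian_earring" "glued_family u = H"
proof -
  note HD = closed_subgroupsD[OF H]
  note Hmult = int_multiple_in_subgroup[OF H]
  have diff: "p - q \<in> H" if "p \<in> H" "q \<in> H" for p q
    using HD(3)[OF that(1) HD(4)[OF that(2)]] by simp
  have "snd ` H \<in> closed_subgroups"
    unfolding closed_subgroups_def
  proof (intro CollectI conjI ballI)
    show "closed (snd ` H)" by (simp add: closed_def open_discrete)
    show "0 \<in> snd ` H" using HD(2) by force
    show "k + l \<in> snd ` H" if "k \<in> snd ` H" "l \<in> snd ` H" for k l
      using that HD(3) by (metis (no_types, lifting) image_iff snd_add)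
    show "- k \<in> snd ` H" if "k \<in> snd ` H" for k
      using that HD(4) by (metis (no_types, lifting) image_iff snd_uminus)
  qed
  then obtain n where n: "snd ` H = multiples n" by (rule int_closed_subgroup_multiples)
  have dvd: "int n dvd k" if "(v, k) \<in> H" for v k
  proof -
    have "k \<in> snd ` H" using that by force
    then show ?thesis by (simp add: n mem_multiples)
  qed
  have "int n \<in> snd ` H" unfolding n by (simp add: mem_multiples)
  then obtain w where w: "(w, int n) \<in> H" by force
  have shift: "(v, l * int n) \<in> H \<longleftrightarrow> (v - of_int l * w, 0) \<in> H" for v l
    using diff[OF _ Hmult[OF w, of l], of "(v, l * int n)"] HD(3)[OF _ Hmult[OF w, of l], of "(v - of_int l * w, 0)"]
    by (auto simp: mult.commute)
  define K where "K = {v. (v, 0) \<in> H}"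
  have K: "K \<in> closed_subgroups"
    unfolding closed_subgroups_def
  proof (intro CollectI conjI ballI)
    show "closed K" unfolding K_def by (rule closed_slice[OF HD(1)])
    show "0 \<in> K" using HD(2) by (simp add: K_def zero_prod_def)
    show "u + v \<in> K" if "u \<in> K" "v \<in> K" for u v
      using that HD(3)[of "(u, 0)" "(v, 0)"] by (simp add: K_def)
    show "- v \<in> K" if "v \<in> K" for v
      using that HD(4)[of "(v, 0)"] by (simp add: K_def)
  qed
  have Kmult: "of_int i * v \<in> K" if "v \<in> K" for i v
    using Hmult[of v 0 i] that by (simp add: K_def)
  have member: "(v, k) \<in> H \<longleftrightarrow> int n dvd k \<and> v - of_int (k div int n) * w \<in> K" for v k
  proof (cases "int n dvd k")
    case True
    then have "k = k div int n * int n" by simp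
    then show ?thesis using shift[of v "k div int n"] True by (simp add: K_def)
  next
    case False
    then show ?thesis using dvd by blast
  qed
  have cone: "cone_element (multiples n) a x \<in> topspace infinite_cone <+> hawaiian_earring \<and>
      glued_family (cone_element (multiples n) a x) = stretch (multiples n) (family a s)"
    if x: "x \<in> topspace circle" "parameter x = circle_class s" for a x s
  proof
    have "infinite_cone_point (multiples n) (cone_point a x) \<in> topspace infinite_cone"
      unfolding topspace_infinite_cone using x(1) multiples_closed_subgroup by blast
    then show "cone_element (multiples n) a x \<in> topspace infinite_cone <+> hawaiian_earring"
      by (rule InlI)
    show "glued_family (cone_element (multiples n) a x) = stretch (multiples n) (family a s)"
      using x(2) by (simp add: lift_layer_family layer_family_point)
  qed
  consider "K = {0}" | "K = UNIV" | a where "a > 0" "K = {v. a * v \<in> \<int>}"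
  proof (rule real_closed_subgroup_cases[OF K])
    show "of_int i * v \<in> K" if "v \<in> K" for i v using Kmult[OF that] .
  qed (use that in blast)+
  then show thesis
  proof cases
    case 1
    show ?thesis
    proof (cases "n = 0")
      case True
      then have "H = {0}" using 1 by (auto simp: member zero_prod_def)
      then show ?thesis using that[OF InrI[OF zero_in_earring]] by (simp add: earring_subgroup_zero)
    next
      case False
      have "(v, k) \<in> H \<longleftrightarrow> (v, k) \<in> cyclic_subgroup w (int n)" for v k
        using False by (auto simp: member 1 mem_cyclic_subgroup elim!: dvdE)
      then have "H = cyclic_subgroup w (int n)" by auto
      also have "\<dots> = earring_subgroup (earring_point n (arctan w))"
        using False by (simp add: earring_subgroup_point tan_arctan)
      finally show ?thesis
        using that[OF InrI[OF earring_point_in]] False by simp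
    qed
  next
    case 2
    obtain x where x: "x \<in> topspace circle" "parameter x = circle_class 0" by (rule parameter_surj)
    have "(v, k) \<in> H \<longleftrightarrow> (v, k) \<in> stretch (multiples n) (family \<infinity> 0)" for v k
      by (simp add: member 2 mem_stretch family_def)
    then have "H = stretch (multiples n) (family \<infinity> 0)" by auto
    then show ?thesis using that cone[OF x, of \<infinity>] by blast
  next
    case (3 a)
    define s where "s = warp a (a * w)"
    have off: "offset a s = a * w" using 3(1) by (intro offset_eqI) (simp_all add: s_def)
    obtain x where x: "x \<in> topspace circle" "parameter x = circle_class s" by (rule parameter_surj)
    have fam: "family (ennreal a) s = lattice a s" using 3(1) by (simp add: family_def)
    have "(v, k) \<in> H \<longleftrightarrow> (v, k) \<in> stretch (multiples n) (family (ennreal a) s)" for v k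
    proof -
      have "of_int (k div int n) * (a * w) - a * v = - (a * (v - of_int (k div int n) * w))"
        by (simp add: algebra_simps)
      then have "of_int (k div int n) * (a * w) - a * v \<in> \<int> \<longleftrightarrow> a * (v - of_int (k div int n) * w) \<in> \<int>"
        by (simp only: minus_in_Ints_iff)
      then show ?thesis using 3 unfolding member fam mem_stretch by (simp add: mem_lattice off)
    qed
    then have "H = stretch (multiples n) (family (ennreal a) s)" by auto
    then show ?thesis using that cone[OF x, of "ennreal a"] by blast
  qed
qed

lemma compact_adjunction:
  "compact_space (adjunction_space infinite_cone (top_of_set hawaiian_earring)
     infinite_cone_boundary (infinite_cone_attach \<xi>))"
proof -
  have "compact_space circle"
  proof -
    have "circle_class ` {0..1} = topspace circle"
    proof
      show "topspace circle \<subseteq> circle_class ` {0..1}"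
      proof
        fix C assume "C \<in> topspace circle"
        then obtain s where "C = circle_class s" by (auto simp: topspace_circle)
        then have "C = circle_class (frac s)"
          by (simp add: circle_class_eq_iff frac_def)
        moreover have "frac s \<in> {0..1}" using frac_ge_0[of s] frac_lt_1[of s] by simp
        ultimately show "C \<in> circle_class ` {0..1}" by blast
      qed
    qed (auto simp: topspace_circle)
    moreover have "compactin circle (circle_class ` {0..1})"
      unfolding circle_def
      by (rule image_compactin[OF _ quotient_imp_continuous_map[OF quotient_map_final_topology]]) simp
    ultimately show ?thesis by (simp add: compact_space_def)
  qed
  then have "compact_space closed_cone"
    unfolding closed_cone_def
    by (intro compact_space_quotient_topology) (simp add: compact_space_prod_topology compact_ennreal)
  then have "compact_space infinite_cone"
    unfolding infinite_cone_def
    by (intro compact_space_quotient_topology) (simp add: compact_space_prod_topology compact_chabauty_int)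
  then show ?thesis
    unfolding adjunction_space_def
    by (intro compact_space_quotient_topology compact_space_disjoint_union)
      (simp_all add: compact_hawaiian_earring compact_space_subtopology)
qed

lemma homeomorphic_chabauty_adjunction:
  "(chabauty_topology :: (real \<times> int) set topology) homeomorphic_space
    adjunction_space infinite_cone (top_of_set hawaiian_earring)
      infinite_cone_boundary (infinite_cone_attach \<xi>)"
proof -
  let ?D = "disjoint_union_topology infinite_cone (top_of_set hawaiian_earring)"
  let ?Q = "adjunction_space infinite_cone (top_of_set hawaiian_earring)
      infinite_cone_boundary (infinite_cone_attach \<xi>)"
  let ?f = "lift glued_family"
  have f: "?f (generated_class gluing_rel u) = glued_family u" for u
    by (rule lift_generated_class[OF glued_family_respects])
  have top: "topspace ?Q = generated_class gluing_rel ` (topspace infinite_cone <+> hawaiian_earring)"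
    by (simp add: adjunction_space_def topspace_quotient_topology)
  have "continuous_map infinite_cone chabauty_topology (lift layer_family)"
    unfolding infinite_cone_def
    by (rule continuous_map_lift[OF layer_family_respects continuous_map_layer_family])
  then have D: "continuous_map ?D chabauty_topology glued_family"
    by (rule continuous_map_case_sum[OF _ continuous_map_earring_subgroup])
  have cont: "continuous_map ?Q chabauty_topology ?f"
    unfolding adjunction_space_def by (rule continuous_map_lift[OF glued_family_respects D])
  have "?f ` topspace ?Q = topspace chabauty_topology"
  proof
    show "?f ` topspace ?Q \<subseteq> topspace chabauty_topology" using cont by (auto simp: continuous_map_def)
    show "topspace chabauty_topology \<subseteq> ?f ` topspace ?Q"
    proof
      fix H :: "(real \<times> int) set" assume "H \<in> topspace chabauty_topology"
      then obtain u where u: "u \<in> topspace infinite_cone <+> hawaiian_earring" "glued_family u = H"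
        using glued_family_surj[of H] by auto
      show "H \<in> ?f ` topspace ?Q"
        unfolding top using u f[of u] by (intro image_eqI[of _ _ "generated_class gluing_rel u"]) auto
    qed
  qed
  moreover have "inj_on ?f (topspace ?Q)"
  proof (rule inj_onI)
    fix C C' assume C: "C \<in> topspace ?Q" "C' \<in> topspace ?Q" "?f C = ?f C'"
    then obtain u v where "u \<in> topspace infinite_cone <+> hawaiian_earring" "C = generated_class gluing_rel u"
      "v \<in> topspace infinite_cone <+> hawaiian_earring" "C' = generated_class gluing_rel v"
      unfolding top by blast
    then show "C = C'" using glued_family_inj[of u v] C(3) f[of u] f[of v] by metis
  qed
  ultimately have "homeomorphic_map ?Q chabauty_topology ?f"
    by (intro continuous_imp_homeomorphic_map cont compact_adjunction Hausdorff_chabauty)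
  then show ?thesis
    using homeomorphic_map_imp_homeomorphic_space homeomorphic_space_sym by blast
qed

end

theorem mainTheorem1:
  fixes \<xi> :: "real set \<Rightarrow> real set \<times> real"
  assumes "homeomorphic_map circle blown_up_circle \<xi>"
  shows "(chabauty_topology :: (real \<times> int) set topology) homeomorphic_space
    adjunction_space infinite_cone (top_of_set hawaiian_earring)
      infinite_cone_boundary (infinite_cone_attach \<xi>)"
proof -
  interpret blown_up_circle_parametrization \<xi> by standard (rule assms)
  show ?thesis by (rule homeomorphic_chabauty_adjunction)
qed

end
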